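(* There exists a universal constant $\alpha$ such that for all $n,d\in\mathbb{N}$ and any convex body $K\subseteq\mathbb{R}^{n+d}$ with $\omega(K)>2cn(n+d)^{5/2}\alpha n^{n+1}$ for some real $c>0$, the following holds for $\nu:=\mu_{mixed,K}$: $$\mathcal{F}(\mathbb{Z}^n\times\mathbb{R}^d,\nu)\ge e^{-\frac1c-1}+e^{-\frac2c}-1.$$ In particular, when $c$ is such that $e^{-\frac1c-1}+e^{-\frac2c}-1\ge 2^{-n-1}$, we have $$\mathcal{F}(\mathbb{Z}^n\times\mathbb{R}^d,\nu)\ge\frac{1}{2^n}\cdot\frac12\ge\frac{1}{2^n}\left(\frac{d}{d+1}\right)^d\ge\frac{1}{2^n}\cdot\frac1e.$$
   Context: A convex body is a compact convex set with nonempty interior. $\mathbb{N}$ denotes the positive integers. For a Borel probability measure $\mu$ on $\mathbb{R}^m$ and a nonempty closed $S\subseteq\mathbb{R}^m$, $\mathcal{F}(S,\mu):=\max_{x\in S}\inf_{u\in\mathcal{S}^{m-1}}\mu(H^+(u,x))$, where $\mathcal{S}^{m-1}$ is the unit sphere and $H^+(u,x)=\{y\in\mathbb{R}^m:u\cdot(y-x)\ge0\}$. Mixed-integer volume with respect to $K\subseteq\mathbb{R}^n\times\mathbb{R}^d$ (when the denominator is nonzero): for Lebesgue measurable $C\subseteq\mathbb{R}^n\times\mathbb{R}^d$, $$\mu_{mixed,K}(C):=\frac{\sum_{z\in\mathbb{Z}^n}\operatorname{vol}_d(C\cap K\cap(\{z\}\times\mathbb{R}^d))}{\sum_{z\in\mathbb{Z}^n}\operatorname{vol}_d(K\cap(\{z\}\times\mathbb{R}^d))},$$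 with $\operatorname{vol}_d$ the $d$-dimensional Lebesgue measure. Lattice-width: $\omega(K):=\min_{z\in\mathbb{Z}^n\setminus\{0\}}\left[\max_{x\in K}z\cdot x-\min_{x\in K}z\cdot x\right]$, where for $K\subseteq\mathbb{R}^{n+d}$ the vector $z$ is paired with the first $n$ coordinates of $x$ (i.e. it is the lattice width of the projection of $K$ onto the first $n$ coordinates). *)

theory Defs
  imports "HOL-Analysis.Analysis"
begin

text \<open>
  The dimensions are bound inside the scope of the universal constant, so they cannot be types.
  A point of \<open>m\<close>-dimensional space is an extensional function on \<open>{..<m}\<close>,
  as in \<^const>\<open>product_topology\<close> and \<^const>\<open>PiM\<close>. In dimension \<open>n + d\<close> the integer
  coordinates are \<open>{..<n}\<close> and the continuous ones \<open>{n..<n + d}\<close>.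
\<close>

abbreviation Rn :: "nat \<Rightarrow> (nat \<Rightarrow> real) set" where
  "Rn m \<equiv> {..<m} \<rightarrow>\<^sub>E UNIV"

abbreviation Zn :: "nat \<Rightarrow> (nat \<Rightarrow> real) set" where
  "Zn n \<equiv> {..<n} \<rightarrow>\<^sub>E \<int>"

definition dot :: "nat \<Rightarrow> (nat \<Rightarrow> real) \<Rightarrow> (nat \<Rightarrow> real) \<Rightarrow> real" where
  "dot m x y = (\<Sum>i<m. x i * y i)"

definition convex_body :: "nat \<Rightarrow> (nat \<Rightarrow> real) set \<Rightarrow> bool" where
  "convex_body m K \<longleftrightarrow>
     compactin (powertop_real {..<m}) K \<and>
     (powertop_real {..<m}) interior_of K \<noteq> {} \<and>
     (\<forall>x\<in>K. \<forall>y\<in>K. \<forall>u\<ge>0. \<forall>v\<ge>0. u + v = 1 \<longrightarrow> (\<lambda>i\<in>{..<m}. u * x i + v * y i) \<in> K)"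

definition halfspace :: "nat \<Rightarrow> (nat \<Rightarrow> real) \<Rightarrow> (nat \<Rightarrow> real) \<Rightarrow> (nat \<Rightarrow> real) set" where
  "halfspace m u x = {y \<in> Rn m. dot m u (\<lambda>i. y i - x i) \<ge> 0}"

definition unit_sphere :: "nat \<Rightarrow> (nat \<Rightarrow> real) set" where
  "unit_sphere m = {u \<in> Rn m. dot m u u = 1}"

definition depth :: "nat \<Rightarrow> (nat \<Rightarrow> real) measure \<Rightarrow> (nat \<Rightarrow> real) \<Rightarrow> real" where
  "depth m \<mu> x = (INF u\<in>unit_sphere m. measure \<mu> (halfspace m u x))"

text \<open>
  The maximum is written as a supremum: by lemma \<open>calF_attained\<close> below it is attained for
  every nonempty closed \<open>S\<close> and every finite Borel measure \<open>\<mu>\<close>.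
\<close>

definition calF :: "nat \<Rightarrow> (nat \<Rightarrow> real) set \<Rightarrow> (nat \<Rightarrow> real) measure \<Rightarrow> real" where
  "calF m S \<mu> = (SUP x\<in>S. depth m \<mu> x)"

definition mixed_lattice :: "nat \<Rightarrow> nat \<Rightarrow> (nat \<Rightarrow> real) set" where
  "mixed_lattice n d = {x \<in> Rn (n + d). \<forall>i<n. x i \<in> \<int>}"

definition fiber :: "nat \<Rightarrow> nat \<Rightarrow> (nat \<Rightarrow> real) set \<Rightarrow> (nat \<Rightarrow> real) \<Rightarrow> (nat \<Rightarrow> real) set" where
  "fiber n d C z = {y \<in> {n..<n + d} \<rightarrow>\<^sub>E UNIV. merge {..<n} {n..<n + d} (z, y) \<in> C}"

definition mixed_vol :: "nat \<Rightarrow> nat \<Rightarrow> (nat \<Rightarrow> real) set \<Rightarrow> ennreal" where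
  "mixed_vol n d C =
     (\<integral>\<^sup>+z. emeasure (\<Pi>\<^sub>M i\<in>{n..<n + d}. lborel) (fiber n d C z) \<partial>count_space (Zn n))"

text \<open>
  The mixed-integer volume is taken on Borel sets: a fiber of a Lebesgue measurable set need not
  be Lebesgue measurable. By lemma \<open>emeasure_mixed_measure\<close> below, the set function is indeed a
  measure. If the denominator is zero, the result is the zero measure.
\<close>

definition mixed_measure :: "nat \<Rightarrow> nat \<Rightarrow> (nat \<Rightarrow> real) set \<Rightarrow> (nat \<Rightarrow> real) measure" where
  "mixed_measure n d K =
     measure_of (Rn (n + d)) (sets (\<Pi>\<^sub>M i\<in>{..<n + d}. borel))
       (\<lambda>C. mixed_vol n d (C \<inter> K) / mixed_vol n d K)"

text \<open>
  The extrema are attained for convex bodies: see \<open>convex_body_dot_attained\<close> and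
  \<open>lattice_width_attained\<close> below.
\<close>

definition lattice_width :: "nat \<Rightarrow> (nat \<Rightarrow> real) set \<Rightarrow> real" where
  "lattice_width n K =
     (INF z\<in>Zn n - {\<lambda>i\<in>{..<n}. 0}. (SUP x\<in>K. dot n z x) - (INF x\<in>K. dot n z x))"

lemma closedin_powertop_real_imp_sets:
  fixes K :: "(nat \<Rightarrow> real) set"
  assumes "closedin (powertop_real I) K"
  shows "K \<in> sets (\<Pi>\<^sub>M i\<in>I. borel)"
proof -
  let ?e = "\<lambda>x i. if i \<in> I then x i else (0::real)"
  let ?r = "\<lambda>x::nat \<Rightarrow> real. restrict x I"
  have KI: "K \<subseteq> I \<rightarrow>\<^sub>E UNIV"
    using closedin_subset[OF assms] by simp
  have "continuous_map (powertop_real UNIV) (powertop_real I) ?r"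
    using continuous_map_product_coordinates[of _ UNIV "\<lambda>_. euclideanreal"]
    by (auto simp: continuous_map_componentwise)
  from closedin_continuous_map_preimage[OF this assms]
  have "closedin (powertop_real UNIV) {x. ?r x \<in> K}"
    by simp
  then have "closed {x. ?r x \<in> K}"
    by (simp add: euclidean_product_topology)
  then have "{x. ?r x \<in> K} \<in> sets (\<Pi>\<^sub>M i\<in>(UNIV::nat set). (borel::real measure))"
    by (subst sets_PiM_equal_borel) (rule borel_closed)
  moreover have "?e \<in> (\<Pi>\<^sub>M i\<in>I. borel) \<rightarrow>\<^sub>M (\<Pi>\<^sub>M i\<in>(UNIV::nat set). (borel::real measure))"
  proof (rule measurable_PiM_single')
    fix i :: nat
    show "(\<lambda>x. ?e x i) \<in> borel_measurable (\<Pi>\<^sub>M i\<in>I. borel)"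
      by (cases "i \<in> I") auto
  qed auto
  ultimately have "?e -` {x. ?r x \<in> K} \<inter> space (\<Pi>\<^sub>M i\<in>I. borel) \<in> sets (\<Pi>\<^sub>M i\<in>I. borel)"
    by (rule measurable_sets[rotated])
  moreover have "?e -` {x. ?r x \<in> K} \<inter> space (\<Pi>\<^sub>M i\<in>I. borel) = K"
  proof -
    have "?r (?e x) = x" if "x \<in> I \<rightarrow>\<^sub>E UNIV" for x
      using that by (auto simp: fun_eq_iff PiE_def extensional_def)
    then show ?thesis
      using KI by (auto simp: space_PiM) 
  qed
  ultimately show ?thesis by simp
qed

lemma convex_body_sets:
  assumes "convex_body m K"
  shows "K \<in> sets (\<Pi>\<^sub>M i\<in>{..<m}. borel)"
proof (rule closedin_powertop_real_imp_sets)
  show "closedin (powertop_real {..<m}) K"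
    using assms unfolding convex_body_def
    by (intro compactin_imp_closedin) (auto simp: Hausdorff_space_product_topology)
qed

lemma fiber_sets:
  assumes "C \<in> sets (\<Pi>\<^sub>M i\<in>{..<n + d}. borel)" "z \<in> Rn n"
  shows "fiber n d C z \<in> sets (\<Pi>\<^sub>M i\<in>{n..<n + d}. lborel)"
proof -
  have U: "{..<n} \<union> {n..<n + d} = {..<n + d}" by auto
  have "(\<lambda>y. merge {..<n} {n..<n + d} (z, y)) \<in> (\<Pi>\<^sub>M i\<in>{n..<n + d}. borel) \<rightarrow>\<^sub>M (\<Pi>\<^sub>M i\<in>{..<n + d}. borel)"
    using measurable_compose[OF measurable_Pair1' measurable_merge[of "{..<n}" "{n..<n + d}" "\<lambda>_. borel"],
        of z] assms(2) by (simp add: U space_PiM)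
  from measurable_sets[OF this assms(1)]
  have "fiber n d C z \<in> sets (\<Pi>\<^sub>M i\<in>{n..<n + d}. borel)"
    by (rule back_subst[where P = "\<lambda>A. A \<in> _"]) (auto simp: fiber_def space_PiM)
  then show ?thesis
    by (simp cong: sets_PiM_cong)
qed

lemma emeasure_mixed_measure:
  assumes K: "K \<in> sets (\<Pi>\<^sub>M i\<in>{..<n + d}. borel)"
    and C: "C \<in> sets (\<Pi>\<^sub>M i\<in>{..<n + d}. borel)"
  shows "emeasure (mixed_measure n d K) C = mixed_vol n d (C \<inter> K) / mixed_vol n d K"
proof -
  let ?B = "\<Pi>\<^sub>M i\<in>{..<n + d}. (borel::real measure)"
  let ?V = "\<Pi>\<^sub>M i\<in>{n..<n + d}. (lborel::real measure)"
  have sp: "space ?B = Rn (n + d)" by (simp add: space_PiM)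
  have 0: "fiber n d {} z = {}" for z by (simp add: fiber_def)
  show ?thesis
    unfolding mixed_measure_def
  proof (rule emeasure_measure_of_sigma)
    show "sigma_algebra (Rn (n + d)) (sets ?B)"
      using sets.sigma_algebra_axioms[of ?B] by (simp only: sp)
    show "positive (sets ?B) (\<lambda>C. mixed_vol n d (C \<inter> K) / mixed_vol n d K)"
      by (simp add: positive_def mixed_vol_def 0)
    show "countably_additive (sets ?B) (\<lambda>C. mixed_vol n d (C \<inter> K) / mixed_vol n d K)"
    proof (rule countably_additiveI)
      fix A :: "nat \<Rightarrow> (nat \<Rightarrow> real) set"
      assume A: "range A \<subseteq> sets ?B" "disjoint_family A"
      have "(\<Sum>i. mixed_vol n d (A i \<inter> K)) =
          (\<integral>\<^sup>+z. (\<Sum>i. emeasure ?V (fiber n d (A i \<inter> K) z)) \<partial>count_space (Zn n))"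
        unfolding mixed_vol_def by (rule nn_integral_suminf[symmetric]) simp
      also have "\<dots> = mixed_vol n d (\<Union> (range A) \<inter> K)"
        unfolding mixed_vol_def
      proof (rule nn_integral_cong)
        fix z assume "z \<in> space (count_space (Zn n))"
        then have z: "z \<in> Rn n" by (auto simp: PiE_iff)
        have "range (\<lambda>i. fiber n d (A i \<inter> K) z) \<subseteq> sets ?V"
          using A(1) K by (auto intro!: fiber_sets z)
        moreover have "disjoint_family (\<lambda>i. fiber n d (A i \<inter> K) z)"
          using A(2) by (fastforce simp: disjoint_family_on_def fiber_def)
        ultimately have "(\<Sum>i. emeasure ?V (fiber n d (A i \<inter> K) z)) =
            emeasure ?V (\<Union>i. fiber n d (A i \<inter> K) z)"
          by (rule suminf_emeasure)
        also have "(\<Union>i. fiber n d (A i \<inter> K) z) = fiber n d (\<Union> (range A) \<inter> K) z"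
          by (auto simp: fiber_def)
        finally show "(\<Sum>i. emeasure ?V (fiber n d (A i \<inter> K) z)) = 
            emeasure ?V (fiber n d (\<Union> (range A) \<inter> K) z)" .
      qed
      finally show "(\<Sum>i. mixed_vol n d (A i \<inter> K) / mixed_vol n d K) =
          mixed_vol n d (\<Union> (range A) \<inter> K) / mixed_vol n d K"
        by (simp add: divide_ennreal_def ennreal_suminf_multc)
    qed
  qed (use C in simp)
qed

lemma dot_diff: "dot m u (\<lambda>i. y i - x i) = dot m u y - dot m u x"
  by (simp add: dot_def algebra_simps sum_subtractf)

lemma continuous_map_dot:
  assumes "n \<le> m"
  shows "continuous_map (powertop_real {..<m}) euclideanreal (dot n u)"
  unfolding dot_def using assms
  by (intro continuous_map_sum continuous_map_real_mult continuous_map_product_projection) auto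

lemma closed_level:
  fixes M :: "(nat \<Rightarrow> real) measure"
  assumes M: "finite_measure M" "sets M = sets (\<Pi>\<^sub>M i\<in>{..<m}. borel)"
  shows "closed {a. t \<le> measure M {y \<in> Rn m. a \<le> dot m u y}}"
proof -
  interpret finite_measure M by fact
  let ?H = "\<lambda>a. {y \<in> Rn m. a \<le> dot m u y}"
  have H: "?H a \<in> sets M" for a
  proof -
    have "closedin (powertop_real {..<m}) {y \<in> topspace (powertop_real {..<m}). dot m u y \<in> {a..}}"
      by (rule closedin_continuous_map_preimage[OF continuous_map_dot]) auto
    from closedin_powertop_real_imp_sets[OF this] show ?thesis
      by (simp add: M)
  qed
  show ?thesis
    unfolding closed_sequential_limits
  proof (intro allI impI, elim conjE)
    fix s a assume s: "\<forall>k::nat. s k \<in> {a. t \<le> measure M (?H a)}" and lim: "s \<longlonglongrightarrow> a"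
    define b where "b j = a - 1 / real (Suc j)" for j
    have "(\<lambda>j. measure M (?H (b j))) \<longlonglongrightarrow> measure M (\<Inter>j. ?H (b j))"
    proof (rule finite_Lim_measure_decseq)
      have "b i \<le> b j" if "i \<le> j" for i j
        using that by (simp add: b_def frac_le)
      then show "decseq (\<lambda>j. ?H (b j))"
        by (force simp: decseq_def)
    qed (use H in auto)
    moreover have "(\<Inter>j. ?H (b j)) = ?H a"
    proof (intro equalityI subsetI)
      fix y assume y: "y \<in> (\<Inter>j. ?H (b j))"
      have "b \<longlonglongrightarrow> a"
        unfolding b_def using tendsto_diff[OF tendsto_const LIMSEQ_inverse_real_of_nat, of a]
        by (simp add: inverse_eq_divide)
      then have "a \<le> dot m u y"
        by (rule LIMSEQ_le_const2) (use y in auto)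
      then show "y \<in> ?H a" using y by auto
    next
      fix y assume "y \<in> ?H a"
      moreover have "b j \<le> a" for j by (simp add: b_def)
      ultimately show "y \<in> (\<Inter>j. ?H (b j))" by (auto intro: order_trans)
    qed
    ultimately have *: "(\<lambda>j. measure M (?H (b j))) \<longlonglongrightarrow> measure M (?H a)" by simp
    have "t \<le> measure M (?H (b j))" for j
    proof -
      have "b j < a" by (simp add: b_def)
      then have "\<exists>k. b j < s k"
        using order_tendstoD(1)[OF lim, of "b j"] by (auto simp: eventually_sequentially)
      then obtain k where "b j < s k" ..
      then have "?H (s k) \<subseteq> ?H (b j)"
        by (intro Collect_mono conj_mono impI) linarith+
      then have "measure M (?H (s k)) \<le> measure M (?H (b j))"
        by (rule finite_measure_mono[OF _ H])
      moreover have "t \<le> measure M (?H (s k))" using s by blast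
      ultimately show ?thesis by (rule order_trans[rotated])
    qed
    then have "t \<le> measure M (?H a)"
      by (intro LIMSEQ_le_const[OF *]) auto
    then show "a \<in> {a. t \<le> measure M (?H a)}" by simp
  qed
qed

lemma calF_attained:
  assumes M: "finite_measure M" "sets M = sets (\<Pi>\<^sub>M i\<in>{..<m}. borel)"
    and m: "m \<ge> 1" and S: "closedin (powertop_real {..<m}) S" "S \<noteq> {}"
  shows "\<exists>x\<in>S. depth m M x = calF m S M" "\<forall>x\<in>S. depth m M x \<le> calF m S M"
proof -
  interpret finite_measure M by fact
  let ?X = "powertop_real {..<m}"
  have spM: "space M = Rn m"
    using sets_eq_imp_space_eq[OF M(2)] by (simp add: space_PiM)
  have SR: "S \<subseteq> Rn m" using closedin_subset[OF S(1)] by simp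
  define e where "e i \<sigma> = (\<lambda>j\<in>{..<m}. if j = i then \<sigma> else (0::real))" for i \<sigma>
  have dot_e: "dot m (e i \<sigma>) v = \<sigma> * v i" if "i < m" for i \<sigma> v
  proof -
    have "dot m (e i \<sigma>) v = (\<Sum>j<m. if j = i then \<sigma> * v j else 0)"
      unfolding dot_def e_def by (rule sum.cong) auto
    then show ?thesis using that by simp
  qed
  have sphere_e: "e i \<sigma> \<in> unit_sphere m" if "i < m" "\<sigma> * \<sigma> = 1" for i \<sigma>
    using that by (simp add: unit_sphere_def dot_e) (simp add: e_def)
  have ne: "unit_sphere m \<noteq> {}" using sphere_e[of 0 1] m by auto
  have bb: "bdd_below ((\<lambda>u. measure M (halfspace m u x)) ` unit_sphere m)" for x
    by (rule bdd_belowI[of _ 0]) auto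
  have nn: "0 \<le> depth m M x" for x
    unfolding depth_def by (rule cINF_greatest[OF ne]) simp
  have le: "depth m M x \<le> measure M (halfspace m u x)" if "u \<in> unit_sphere m" for u x
    unfolding depth_def by (rule cINF_lower[OF bb that])
  have "depth m M x \<le> measure M (space M)" for x
    using le[OF sphere_e[of 0 1]] m bounded_measure by (force intro: order_trans)
  then have ba: "bdd_above (depth m M ` S)" by (auto intro!: bdd_aboveI)
  show up: "\<forall>x\<in>S. depth m M x \<le> calF m S M"
    unfolding calF_def by (auto intro: cSUP_upper[OF _ ba])
  have cl: "closedin ?X {x \<in> Rn m. t \<le> depth m M x}" for t
  proof -
    have H: "halfspace m u x = {y \<in> Rn m. dot m u x \<le> dot m u y}" for u x
      by (simp add: halfspace_def dot_diff)
    have iff: "t \<le> depth m M x \<longleftrightarrow>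
        (\<forall>u\<in>unit_sphere m. t \<le> measure M {y \<in> Rn m. dot m u x \<le> dot m u y})" for x
      using le_cINF_iff[OF ne bb, of t x] by (simp only: depth_def H)
    have "{x \<in> Rn m. t \<le> depth m M x} = (\<Inter>u\<in>unit_sphere m.
        {x \<in> topspace ?X. dot m u x \<in> {a. t \<le> measure M {y \<in> Rn m. a \<le> dot m u y}}})"
      unfolding iff topspace_product_topology topspace_euclidean using ne by blast
    also have "closedin ?X \<dots>"
      by (intro closedin_INT ne closedin_continuous_map_preimage[OF continuous_map_dot])
        (auto intro: closed_level[OF M])
    finally show ?thesis .
  qed
  show "\<exists>x\<in>S. depth m M x = calF m S M"
  proof (cases "calF m S M \<le> 0")
    case True
    then show ?thesis using up nn S(2) by (meson all_not_in_conv order_antisym order_trans)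
  next
    case False
    define s where "s = calF m S M"
    have s: "s > 0" using False by (simp add: s_def)
    define A where "A k = {y \<in> Rn m. \<forall>i<m. \<bar>y i\<bar> \<le> real k}" for k :: nat
    have A_PiE: "A k = (\<Pi>\<^sub>E i\<in>{..<m}. {- real k..real k})" for k
    proof -
      have "\<bar>a\<bar> \<le> real k \<longleftrightarrow> a \<in> {- real k..real k}" for a by auto
      then show ?thesis unfolding A_def by (simp add: PiE_iff set_eq_iff) blast
    qed
    have A_sets: "A k \<in> sets M" for k
      unfolding A_PiE M(2) by (rule sets_PiM_I_finite) auto
    have "A i \<subseteq> A j" if "i \<le> j" for i j
      unfolding A_def using order_trans[of _ "real i" "real j"] that by auto
    then have "incseq A" by (simp add: incseq_def)
    then have "(\<lambda>k. measure M (A k)) \<longlonglongrightarrow> measure M (\<Union>k. A k)"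
      by (intro finite_Lim_measure_incseq) (use A_sets in auto)
    moreover have "(\<Union>k. A k) = space M"
    proof -
      have "\<exists>k. y \<in> A k" if "y \<in> Rn m" for y
      proof -
        obtain k where "(\<Sum>i<m. \<bar>y i\<bar>) \<le> real k" using real_arch_simple by blast
        then have "\<bar>y i\<bar> \<le> real k" if "i < m" for i
          using member_le_sum[of i "{..<m}" "\<lambda>i. \<bar>y i\<bar>"] that by auto
        then show ?thesis using that by (auto simp: A_def)
      qed
      then show ?thesis by (auto simp: spM A_def)
    qed
    ultimately have "\<exists>k. measure M (space M) - s / 2 < measure M (A k)"
      using order_tendstoD(1)[of "\<lambda>k. measure M (A k)" "measure M (space M)" sequentially
          "measure M (space M) - s / 2"] s by (auto simp: eventually_sequentially)
    then obtain k where "measure M (space M) - s / 2 < measure M (A k)" ..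
    then have k: "measure M (space M - A k) < s / 2"
      using finite_measure_compl[OF A_sets, of k] by linarith
    have inA: "x \<in> A k" if x: "x \<in> S" "s / 2 \<le> depth m M x" for x
    proof (rule ccontr)
      assume "x \<notin> A k"
      then obtain i where i: "i < m" "real k < \<bar>x i\<bar>" using x SR by (auto simp: A_def)
      then have x0: "x i \<noteq> 0" by auto
      define u where "u = e i (sgn (x i))"
      have "halfspace m u x \<subseteq> space M - A k"
      proof
        fix y assume y: "y \<in> halfspace m u x"
        then have "0 \<le> sgn (x i) * (y i - x i)"
          using i by (simp add: halfspace_def u_def dot_e)
        then have "real k < \<bar>y i\<bar>" using i x0 by (auto simp: sgn_if split: if_splits)
        then show "y \<in> space M - A k" using y i by (auto simp: halfspace_def A_def spM)
      qed
      then have "measure M (halfspace m u x) \<le> measure M (space M - A k)"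
        using A_sets by (intro finite_measure_mono) auto
      moreover have "u \<in> unit_sphere m"
        unfolding u_def using x0 i by (intro sphere_e) (auto simp: sgn_if)
      ultimately show False using le[of u x] k x by simp
    qed
    define L where "L t = S \<inter> {x \<in> Rn m. t \<le> depth m M x}" for t
    have Lne: "L t \<noteq> {}" if "t < s" for t
    proof -
      obtain x where "x \<in> S" "t < depth m M x"
        using \<open>t < s\<close> unfolding s_def calF_def less_cSUP_iff[OF S(2) ba] by (elim bexE)
      then have "x \<in> L t" using SR by (simp add: L_def subset_iff)
      then show ?thesis by blast
    qed
    have comp: "compactin ?X (A k)"
      unfolding A_PiE compactin_PiE by (auto simp: compactin_euclidean_iff)
    have "A k \<inter> \<Inter> (L ` {s / 2..<s}) \<noteq> {}"
    proof -
      have "\<forall>C\<in>L ` {s / 2..<s}. closedin ?X C"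
        using S cl by (auto simp: L_def)
      moreover have "A k \<inter> \<Inter> G \<noteq> {}" if G: "finite G" "G \<subseteq> L ` {s / 2..<s}" for G
      proof -
        obtain T where T: "finite T" "T \<subseteq> {s / 2..<s}" "G = L ` T"
          using finite_subset_image[OF G] by auto
        define t where "t = Max (insert (s / 2) T)"
        have "t \<in> insert (s / 2) T" unfolding t_def using T by (intro Max_in) auto
        then have t: "t \<in> {s / 2..<s}" using T(2) s by auto
        have tr: "r \<le> t" if "r \<in> T" for r unfolding t_def using T that by (intro Max_ge) auto
        from t obtain x where x: "x \<in> L t" using Lne by auto
        then have "x \<in> A k" using t inA by (auto simp: L_def)
        moreover have "x \<in> L r" if "r \<in> T" for r using x tr[OF that] by (auto simp: L_def)
        ultimately show ?thesis using T by auto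
      qed
      ultimately show ?thesis using comp unfolding compactin_fip by blast
    qed
    then obtain x where "x \<in> \<Inter> (L ` {s / 2..<s})" by blast
    then have x: "x \<in> L t" if "t \<in> {s / 2..<s}" for t using that by (rule INT_D)
    have xS: "x \<in> S" using x[of "s / 2"] s by (auto simp: L_def)
    have "s \<le> depth m M x"
    proof (rule dense_le)
      fix t assume "t < s"
      then have "max t (s / 2) \<in> {s / 2..<s}" using s by auto
      from x[OF this] show "t \<le> depth m M x" by (auto simp: L_def)
    qed
    then show ?thesis using xS up by (metis s_def order_antisym)
  qed
qed

lemma finite_measure_mixed_measure:
  assumes K: "K \<in> sets (\<Pi>\<^sub>M i\<in>{..<n + d}. borel)"
  shows "finite_measure (mixed_measure n d K)"
proof (rule finite_measureI)
  let ?B = "\<Pi>\<^sub>M i\<in>{..<n + d}. (borel::real measure)"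
  have sp: "space (mixed_measure n d K) = space ?B"
    by (simp add: mixed_measure_def space_measure_of_conv space_PiM)
  have "space ?B \<inter> K = K" using sets.sets_into_space[OF K] by auto
  then have "emeasure (mixed_measure n d K) (space (mixed_measure n d K)) =
      mixed_vol n d K / mixed_vol n d K"
    unfolding sp using emeasure_mixed_measure[OF K sets.top] by simp
  also have "\<dots> \<noteq> \<infinity>"
    by (cases "mixed_vol n d K = 0 \<or> mixed_vol n d K = \<infinity>")
      (auto simp: divide_ennreal_def ennreal_divide_self[unfolded divide_ennreal_def] top.not_eq_extremum)
  finally show "emeasure (mixed_measure n d K) (space (mixed_measure n d K)) \<noteq> \<infinity>" .
qed

corollary calF_mixed_measure_attained:
  assumes K: "convex_body (n + d) K" and n: "n \<ge> 1"
  shows "\<exists>x\<in>mixed_lattice n d. depth (n + d) (mixed_measure n d K) x =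
      calF (n + d) (mixed_lattice n d) (mixed_measure n d K)"
proof (rule calF_attained(1))
  let ?X = "powertop_real {..<n + d}"
  show "finite_measure (mixed_measure n d K)"
    by (rule finite_measure_mixed_measure[OF convex_body_sets[OF K]])
  show "sets (mixed_measure n d K) = sets (\<Pi>\<^sub>M i\<in>{..<n + d}. borel)"
    unfolding mixed_measure_def
    using sets.sigma_sets_eq[of "\<Pi>\<^sub>M i\<in>{..<n + d}. (borel::real measure)"]
      sets.space_closed[of "\<Pi>\<^sub>M i\<in>{..<n + d}. (borel::real measure)"]
    by (simp add: sets_measure_of space_PiM)
  show "closedin ?X (mixed_lattice n d)"
  proof -
    have "mixed_lattice n d = (\<Inter>i\<in>{..<n}. {x \<in> topspace ?X. x i \<in> \<int>})"
    proof -
      have "0 \<in> {..<n}" using n by simp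
      then show ?thesis
        unfolding mixed_lattice_def topspace_product_topology topspace_euclidean by blast
    qed
    also have "closedin ?X \<dots>"
      by (intro closedin_INT closedin_continuous_map_preimage[of ?X euclideanreal]
          continuous_map_product_projection) (use n in \<open>auto dest: equals0D[of _ 0]\<close>)
    finally show ?thesis .
  qed
  have "(\<lambda>i\<in>{..<n + d}. 0) \<in> mixed_lattice n d" by (simp add: mixed_lattice_def)
  then show "mixed_lattice n d \<noteq> {}" by blast
  show "1 \<le> n + d" using n by simp
qed

lemma convex_body_dot_attained:
  assumes K: "convex_body m K" and nm: "n \<le> m"
  shows "\<exists>x\<in>K. dot n z x = (SUP x\<in>K. dot n z x)" "\<exists>x\<in>K. dot n z x = (INF x\<in>K. dot n z x)"
    "bdd_above (dot n z ` K)" "bdd_below (dot n z ` K)"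
proof -
  have "compactin euclideanreal (dot n z ` K)"
    using K unfolding convex_body_def by (blast intro: image_compactin continuous_map_dot[OF nm])
  then have c: "compact (dot n z ` K)" by (simp add: compactin_euclidean_iff)
  have ne: "dot n z ` K \<noteq> {}"
    using K interior_of_subset[of "powertop_real {..<m}" K] by (auto simp: convex_body_def)
  have cl: "closed (dot n z ` K)" using c by (rule compact_imp_closed)
  show b: "bdd_above (dot n z ` K)" "bdd_below (dot n z ` K)"
    using c by (auto dest!: compact_imp_bounded intro: bounded_imp_bdd_above bounded_imp_bdd_below)
  show "\<exists>x\<in>K. dot n z x = (SUP x\<in>K. dot n z x)"
    using closed_contains_Sup[OF ne b(1) cl] by force
  show "\<exists>x\<in>K. dot n z x = (INF x\<in>K. dot n z x)"
    using closed_contains_Inf[OF ne b(2) cl] by force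
qed

lemma lattice_width_attained:
  assumes K: "convex_body m K" and nm: "n \<le> m" and n: "n \<ge> 1"
  defines "w \<equiv> \<lambda>z. (SUP x\<in>K. dot n z x) - (INF x\<in>K. dot n z x)"
  shows "\<exists>z\<in>Zn n - {\<lambda>i\<in>{..<n}. 0}. w z = lattice_width n K"
    "\<forall>z\<in>Zn n - {\<lambda>i\<in>{..<n}. 0}. lattice_width n K \<le> w z"
proof -
  let ?X = "powertop_real {..<m}" and ?Z = "Zn n - {\<lambda>i\<in>{..<n}. 0}"
  have diff: "dot n z x - dot n z y \<le> w z" if "x \<in> K" "y \<in> K" for x y z
    unfolding w_def using that convex_body_dot_attained(3,4)[OF K nm, of z]
    by (intro diff_mono cSUP_upper cINF_lower)
  have "?X interior_of K \<noteq> {}" using K unfolding convex_body_def by (elim conjE)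
  then obtain p where p: "p \<in> ?X interior_of K" by (meson all_not_in_conv)
  have pK: "p \<in> K" using p interior_of_subset[of ?X K] by (rule rev_subsetD)
  have pR: "p \<in> Rn m"
    using rev_subsetD[OF p interior_of_subset_topspace[of ?X K]] by simp
  have "\<exists>r>0. p(i := p i + r) \<in> K" if i: "i < n" for i
  proof -
    have im: "i < m" using i nm by simp
    have "continuous_map euclideanreal ?X (\<lambda>t. p(i := t))"
      unfolding continuous_map_componentwise
    proof (intro conjI ballI)
      show "(\<lambda>t. p(i := t)) ` topspace euclideanreal \<subseteq> extensional {..<m}"
        using pR im by (auto simp: PiE_def extensional_def)
      show "continuous_map euclideanreal euclideanreal (\<lambda>t. (p(i := t)) k)" for k
        by (cases "k = i") auto
    qed
    from openin_continuous_map_preimage[OF this openin_interior_of[of ?X K]]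
    have "open {t. p(i := t) \<in> ?X interior_of K}" by simp
    moreover have "p i \<in> {t. p(i := t) \<in> ?X interior_of K}" using p by simp
    ultimately obtain \<epsilon> where \<epsilon>: "\<epsilon> > 0" "ball (p i) \<epsilon> \<subseteq> {t. p(i := t) \<in> ?X interior_of K}"
      by (meson open_contains_ball)
    have "p i + \<epsilon> / 2 \<in> ball (p i) \<epsilon>" using \<epsilon>(1) by (simp add: dist_real_def)
    then have "p(i := p i + \<epsilon> / 2) \<in> K" using \<epsilon>(2) interior_of_subset[of ?X K] by blast
    then show ?thesis using \<epsilon>(1) by (intro exI[of _ "\<epsilon> / 2"]) auto
  qed
  then obtain r where r: "\<And>i. i < n \<Longrightarrow> r i > 0" "\<And>i. i < n \<Longrightarrow> p(i := p i + r i) \<in> K"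
    by metis
  have wr: "\<bar>z i\<bar> \<le> w z / r i" if i: "i < n" for z i
  proof -
    have "dot n z (p(i := p i + r i)) - dot n z p = (\<Sum>j<n. if j = i then z i * r i else 0)"
      unfolding dot_def sum_subtractf[symmetric] by (rule sum.cong) (auto simp: algebra_simps)
    then have "dot n z (p(i := p i + r i)) - dot n z p = z i * r i" using i by simp
    then have "\<bar>z i * r i\<bar> \<le> w z"
      using diff[OF r(2)[OF i] pK, of z] diff[OF pK r(2)[OF i], of z] by linarith
    then show ?thesis using r(1)[OF i] by (simp add: abs_mult pos_le_divide_eq)
  qed
  have "(\<lambda>i\<in>{..<n}. 1) \<noteq> (\<lambda>i\<in>{..<n}. 0::real)"
    using n by (auto dest!: fun_cong[of _ _ 0])
  then have "(\<lambda>i\<in>{..<n}. 1) \<in> ?Z" by auto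
  then obtain z0 where z0: "z0 \<in> ?Z" by blast
  let ?T = "{z \<in> ?Z. w z \<le> w z0}"
  have "finite ?T"
  proof (rule finite_subset)
    show "?T \<subseteq> (\<Pi>\<^sub>E i\<in>{..<n}. {a \<in> \<int>. \<bar>a\<bar> \<le> w z0 / r i})"
    proof
      fix z assume z: "z \<in> ?T"
      have "\<bar>z i\<bar> \<le> w z0 / r i" if i: "i < n" for i
      proof -
        have "w z / r i \<le> w z0 / r i" using z r(1)[OF i] by (intro divide_right_mono) auto
        with wr[OF i, of z] show ?thesis by linarith
      qed
      then show "z \<in> (\<Pi>\<^sub>E i\<in>{..<n}. {a \<in> \<int>. \<bar>a\<bar> \<le> w z0 / r i})"
        using z by (auto simp: PiE_iff)
    qed
    show "finite (\<Pi>\<^sub>E i\<in>{..<n}. {a \<in> \<int>. \<bar>a\<bar> \<le> w z0 / r i})"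
      by (intro finite_PiE finite_abs_int_segment) auto
  qed
  moreover have "?T \<noteq> {}" using z0 by blast
  ultimately obtain z1 where z1: "is_arg_min w (\<lambda>z. z \<in> ?T) z1"
    using ex_is_arg_min_if_finite[of ?T w] by blast
  then have z1Z: "z1 \<in> ?Z" and min: "w z1 \<le> w z" if "z \<in> ?T" for z
    using that by (auto simp: is_arg_min_linorder)
  have le: "w z1 \<le> w z" if "z \<in> ?Z" for z
    using min[of z] min[of z0] z0 that by fastforce
  have "lattice_width n K = w z1"
    unfolding lattice_width_def w_def[symmetric]
    by (rule cInf_eq_minimum) (use z1Z z0 le in auto)
  then show "\<exists>z\<in>?Z. w z = lattice_width n K" "\<forall>z\<in>?Z. lattice_width n K \<le> w z"
    using z1Z z0 le by auto
qed

end

theory Submission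
  imports Defs "HOL-Library.Function_Algebras" "HOL-Probability.Probability_Measure"
begin

text \<open>
  The mixed-integer volume of a body that is fat in every lattice direction is almost its Lebesgue
  volume, and for the Lebesgue volume a point of depth \<open>1 / e\<close> exists by Gruenbaum's inequality.

  Let \<open>m = n + d\<close>. Gruenbaum's inequality is used in the form that a point \<open>x\<^sub>0\<close> (the centroid) has at
  least \<open>1 / e\<close> of the volume of \<open>K\<close> in every half-space whose boundary contains it. For a linear
  functional \<open>X\<close> with tail \<open>F s = P (X \<ge> s)\<close>, the Brunn-Minkowski inequality makes \<open>F\<close> log-concave.
  Since \<open>F (X)\<close> is stochastically at least uniform on the unit interval, \<open>E (ln (F X)) \<ge> - 1\<close>, and
  Jensen's inequality gives \<open>ln (F (E X)) \<ge> - 1\<close>; this is \<open>log_concave_tail_at_mean\<close>, and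
  \<open>grunbaum_point\<close> draws the conclusion. Depth \<open>1 / e\<close> also bounds the asymmetry of \<open>K\<close> about \<open>x\<^sub>0\<close>:
  a reflected point, contracted by a factor of order \<open>m\<close>, stays in \<open>K\<close> (\<open>reflection_in_body\<close>), so
  that \<open>K - K \<subseteq> 4 m (K - x\<^sub>0)\<close> (\<open>difference_in_body\<close>).

  The lattice enters through a flatness theorem (\<open>flatness\<close>, \<open>difference_body_covers\<close>): if
  the lattice width of \<open>K\<close> exceeds \<open>2 ^ (n - 1) / \<delta>\<close>, then the integer translates of the projection of
  \<open>\<delta> (K - K)\<close> cover \<open>n\<close>-space. Its proof passes to the quotient by a shortest lattice vector;
  its length is at most twice that of a shortest vector of the quotient, and the last quotient is
  a line, on which the gauge is the absolute value of an integral functional and hence is controlled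
  by the width. The constant \<open>2 ^ (n - 1)\<close> is far from optimal, but the hypothesis of the theorem
  allows \<open>n ^ (n + 2)\<close>.

  Put \<open>\<eta> = 1 / (8 c m)\<close> and \<open>\<delta> = \<eta> / (4 m)\<close>. Every real vector can be rounded to an integer vector by
  a shift in \<open>\<delta> (K - K) \<subseteq> \<eta> (K - x\<^sub>0)\<close>. Averaging the lattice sums of fiber volumes over all translates
  of the lattice yields the Lebesgue volume, and each translate can be moved to the lattice itself
  by such a shift. Hence the mixed volume of \<open>K\<close> is at most the volume of \<open>K\<close> enlarged by
  \<open>1 + \<eta>\<close> (\<open>mixed_vol_upper\<close>), and the mixed volume of \<open>K\<close> cut by a half-space through a suitable
  mixed-integer point \<open>x\<close> near \<open>x\<^sub>0\<close> is at least the volume of a copy of the cut through \<open>x\<^sub>0\<close>, scaled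
  by \<open>1 - 3 \<eta>\<close> and pushed into the half-space (\<open>mixed_vol_halfspace_lower\<close>). As
  \<open>((1 - 3 \<eta>) / (1 + \<eta>)) ^ m \<ge> exp (- 1 / c)\<close>, the point \<open>x\<close> has depth at least \<open>exp (- 1 / c - 1)\<close>
  (\<open>mixed_centerpoint\<close>), which is even more than claimed. All this needs \<open>c \<ge> 1\<close>; for smaller \<open>c\<close> the
  claimed bound is negative.
\<close>

section \<open>Seminorms and their quotients by a line\<close>

definition seminorm :: "('v::real_vector \<Rightarrow> real) \<Rightarrow> bool" where
  "seminorm N \<longleftrightarrow> (\<forall>x y. N (x + y) \<le> N x + N y) \<and> (\<forall>t x. N (t *\<^sub>R x) = \<bar>t\<bar> * N x)"

lemma seminorm_add: "seminorm N \<Longrightarrow> N (x + y) \<le> N x + N y"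
  and seminorm_scaleR: "seminorm N \<Longrightarrow> N (t *\<^sub>R x) = \<bar>t\<bar> * N x"
  by (auto simp: seminorm_def)

lemma seminorm_zero: "seminorm N \<Longrightarrow> N 0 = 0"
  using seminorm_scaleR[of N 0 0] by simp

lemma seminorm_minus: "seminorm N \<Longrightarrow> N (- x) = N x"
  using seminorm_scaleR[of N "-1" x] by simp

lemma seminorm_diff: "seminorm N \<Longrightarrow> N (x - y) \<le> N x + N y"
  using seminorm_add[of N x "- y"] by (simp add: seminorm_minus)

lemma seminorm_nonneg: "seminorm N \<Longrightarrow> 0 \<le> N x"
  using seminorm_diff[of N x x] by (simp add: seminorm_zero)

lemma seminorm_diff_null: "seminorm N \<Longrightarrow> N (x - y) = 0 \<Longrightarrow> N x = N y"
  using seminorm_add[of N "x - y" y] seminorm_diff[of N x "x - y"] by simp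

definition quot_seminorm :: "('v::real_vector \<Rightarrow> real) \<Rightarrow> 'v \<Rightarrow> 'v \<Rightarrow> real" where
  "quot_seminorm N b x = (INF r. N (x - r *\<^sub>R b))"

lemma quot_seminorm_le:
  assumes "seminorm N"
  shows "quot_seminorm N b x \<le> N (x - r *\<^sub>R b)"
  unfolding quot_seminorm_def
  by (rule cINF_lower) (auto intro!: bdd_belowI[of _ 0] seminorm_nonneg[OF assms])

lemma quot_seminorm_le': "seminorm N \<Longrightarrow> quot_seminorm N b x \<le> N x"
  using quot_seminorm_le[of N b x 0] by simp

lemma quot_seminorm_lessD:
  assumes "quot_seminorm N b x < c"
  obtains r where "N (x - r *\<^sub>R b) < c"
  using assms cINF_greatest[of UNIV c "\<lambda>r. N (x - r *\<^sub>R b)"]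
  unfolding quot_seminorm_def by (meson UNIV_not_empty not_le)

lemma seminorm_quot_seminorm:
  assumes N: "seminorm N"
  shows "seminorm (quot_seminorm N b)"
proof -
  let ?Q = "quot_seminorm N b"
  have nn: "0 \<le> ?Q x" for x
    unfolding quot_seminorm_def by (rule cINF_greatest) (auto simp: seminorm_nonneg[OF N])
  have add: "?Q (x + y) \<le> ?Q x + ?Q y" for x y
  proof (rule field_le_epsilon)
    fix e :: real assume e: "e > 0"
    obtain r where r: "N (x - r *\<^sub>R b) < ?Q x + e / 2"
      using e by (auto intro: quot_seminorm_lessD[of N b x "?Q x + e / 2"])
    obtain s where s: "N (y - s *\<^sub>R b) < ?Q y + e / 2"
      using e by (auto intro: quot_seminorm_lessD[of N b y "?Q y + e / 2"])
    have "?Q (x + y) \<le> N ((x + y) - (r + s) *\<^sub>R b)" by (rule quot_seminorm_le[OF N])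
    also have "\<dots> = N ((x - r *\<^sub>R b) + (y - s *\<^sub>R b))" by (simp add: algebra_simps)
    also have "\<dots> \<le> N (x - r *\<^sub>R b) + N (y - s *\<^sub>R b)" by (rule seminorm_add[OF N])
    finally show "?Q (x + y) \<le> ?Q x + ?Q y + e" using r s by simp
  qed
  have le: "?Q (t *\<^sub>R x) \<le> \<bar>t\<bar> * ?Q x" for t x
  proof (cases "t = 0")
    case True
    then show ?thesis using quot_seminorm_le'[OF N, of b 0] by (simp add: seminorm_zero[OF N])
  next
    case False
    have "?Q (t *\<^sub>R x) / \<bar>t\<bar> \<le> ?Q x"
      unfolding quot_seminorm_def[of N b x]
    proof (rule cINF_greatest)
      fix r
      have "?Q (t *\<^sub>R x) \<le> N (t *\<^sub>R x - (t * r) *\<^sub>R b)" by (rule quot_seminorm_le[OF N])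
      also have "\<dots> = N (t *\<^sub>R (x - r *\<^sub>R b))" by (simp add: algebra_simps)
      finally show "?Q (t *\<^sub>R x) / \<bar>t\<bar> \<le> N (x - r *\<^sub>R b)"
        using False by (simp add: seminorm_scaleR[OF N] pos_divide_le_eq mult.commute)
    qed simp
    then show ?thesis using False by (simp add: pos_divide_le_eq mult.commute)
  qed
  have "?Q (t *\<^sub>R x) = \<bar>t\<bar> * ?Q x" for t x
  proof (cases "t = 0")
    case True
    then show ?thesis using le[of 0 x] nn[of 0] by simp
  next
    case False
    have "?Q x = ?Q ((1 / t) *\<^sub>R (t *\<^sub>R x))" using False by simp
    also have "\<dots> \<le> \<bar>1 / t\<bar> * ?Q (t *\<^sub>R x)" by (rule le)
    finally have "\<bar>t\<bar> * ?Q x \<le> ?Q (t *\<^sub>R x)" using False by (simp add: field_simps)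
    then show ?thesis using le[of t x] by simp
  qed
  with add show ?thesis by (simp add: seminorm_def)
qed

text \<open>
  Successive quotients by lattice vectors keep the vector space and let the null space of the
  seminorm grow instead, so no quotient type and no lattice basis is needed. The dimension of the
  quotient is bounded by the number of vectors that span the space up to the null space.
\<close>

definition spans_modulo :: "('v::real_vector \<Rightarrow> real) \<Rightarrow> 'v set \<Rightarrow> bool" where
  "spans_modulo N E \<longleftrightarrow> (\<forall>x. \<exists>y\<in>span E. N (x - y) = 0)"

text \<open>
  Steinitz exchange: \<open>b\<close> takes the place of one of the spanning vectors, and \<open>b\<close> is null in the
  quotient. A smallest subset that still spans \<open>b\<close> up to null vectors contains a vector that can be
  expressed through \<open>b\<close> and the others.
\<close>

lemma spans_modulo_quot:
  assumes N: "seminorm N" and E: "spans_modulo N E" "finite E" and b: "N b > 0"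
  obtains e where "e \<in> E" "spans_modulo (quot_seminorm N b) (E - {e})"
proof -
  let ?Q = "quot_seminorm N b"
  have Q: "seminorm ?Q" by (rule seminorm_quot_seminorm[OF N])
  obtain y where y: "y \<in> span E" "N (b - y) = 0"
    using E unfolding spans_modulo_def by blast
  have "y \<noteq> 0" using seminorm_diff_null[OF N y(2)] b seminorm_zero[OF N] by auto
  have "?Q b \<le> 0" using quot_seminorm_le[OF N, of b b 1] by (simp add: seminorm_zero[OF N])
  then have "?Q y \<le> 0"
    using seminorm_diff[OF Q, of b "b - y"] quot_seminorm_le'[OF N, of b "b - y"] y(2) by simp
  then have Qy: "?Q y = 0" using seminorm_nonneg[OF Q, of y] by simp
  obtain E0 where E0: "E0 \<subseteq> E" "y \<in> span E0" and
    min: "\<And>E'. E' \<subseteq> E \<Longrightarrow> y \<in> span E' \<Longrightarrow> card E0 \<le> card E'"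
    using ex_has_least_nat[of "\<lambda>A. A \<subseteq> E \<and> y \<in> span A" E card] y(1) by blast
  have fin: "finite E0" using E0(1) E(2) by (rule finite_subset)
  have "E0 \<noteq> {}" using E0(2) \<open>y \<noteq> 0\<close> by auto
  then obtain e where e: "e \<in> E0" by blast
  have "y \<notin> span (E0 - {e})"
  proof
    assume "y \<in> span (E0 - {e})"
    then have "card E0 \<le> card (E0 - {e})" using E0(1) by (intro min) auto
    then show False using card_Diff1_less[OF fin e] by simp
  qed
  then have "e \<in> span (insert y (E0 - {e}))" using in_span_delete[OF E0(2)] by blast
  then have "e \<in> span (insert y (E - {e}))"
    using span_mono[of "insert y (E0 - {e})" "insert y (E - {e})"] E0(1) by blast
  then have sp: "span E \<subseteq> span (insert y (E - {e}))"
    by (intro span_minimal) (auto intro: span_base)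
  have "spans_modulo ?Q (E - {e})"
    unfolding spans_modulo_def
  proof
    fix x
    obtain s where s: "s \<in> span E" "N (x - s) = 0"
      using E(1) unfolding spans_modulo_def by blast
    obtain r where r: "s - r *\<^sub>R y \<in> span (E - {e})"
      using sp s(1) span_breakdown_eq[of s y "E - {e}"] by blast
    have "?Q (x - (s - r *\<^sub>R y)) = ?Q ((x - s) + r *\<^sub>R y)" by (simp add: algebra_simps)
    also have "\<dots> \<le> ?Q (x - s) + ?Q (r *\<^sub>R y)" by (rule seminorm_add[OF Q])
    also have "\<dots> \<le> 0" using quot_seminorm_le'[OF N, of b "x - s"] s(2)
      by (simp add: seminorm_scaleR[OF Q] Qy)
    finally have "?Q (x - (s - r *\<^sub>R y)) = 0" using seminorm_nonneg[OF Q] by (simp add: antisym)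
    with r show "\<exists>y\<in>span (E - {e}). ?Q (x - y) = 0" by blast
  qed
  then show ?thesis using that e E0(1) by blast
qed

section \<open>A flatness theorem\<close>

text \<open>
  Discreteness of the image of \<open>L\<close> in the quotient by the null space of \<open>N\<close>.
\<close>

definition discrete_modulo :: "('v::real_vector \<Rightarrow> real) \<Rightarrow> 'v set \<Rightarrow> bool" where
  "discrete_modulo N L \<longleftrightarrow>
     (\<forall>R. \<exists>F. finite F \<and> F \<subseteq> L \<and> (\<forall>v\<in>L. N v \<le> R \<longrightarrow> (\<exists>f\<in>F. N (v - f) = 0)))"

text \<open>
  Additive subgroups. They need not be discrete, since the coordinates beyond the integer ones are
  unrestricted in the application.
\<close>

definition subtraction_closed :: "'v::real_vector set \<Rightarrow> bool" where
  "subtraction_closed L \<longleftrightarrow> 0 \<in> L \<and> (\<forall>x\<in>L. \<forall>y\<in>L. x - y \<in> L)"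

lemma subgroup_scale_int:
  assumes L: "subtraction_closed L" and b: "b \<in> L"
  shows "of_int j *\<^sub>R b \<in> L"
proof -
  have neg: "- x \<in> L" if "x \<in> L" for x
    using L that unfolding subtraction_closed_def by (metis diff_0)
  have nat: "of_nat k *\<^sub>R b \<in> L" for k
  proof (induction k)
    case 0 then show ?case using L by (simp add: subtraction_closed_def)
  next
    case (Suc k)
    have "of_nat k *\<^sub>R b - (- b) \<in> L"
      using L Suc neg[OF b] unfolding subtraction_closed_def by blast
    then show ?case by (simp add: algebra_simps)
  qed
  show ?thesis
  proof (cases j rule: int_cases2)
    case (nonneg k) then show ?thesis using nat[of k] by simp
  next
    case (nonpos k) then show ?thesis using neg[OF nat[of k]] by simp
  qed
qed

lemma round_multiple:
  assumes N: "seminorm N" and b: "N (x - r *\<^sub>R b) < c"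
  shows "N (x - of_int (round r) *\<^sub>R b) < c + N b / 2"
proof -
  have "x - of_int (round r) *\<^sub>R b = (x - r *\<^sub>R b) + (r - of_int (round r)) *\<^sub>R b"
    by (simp add: algebra_simps)
  then have "N (x - of_int (round r) *\<^sub>R b) \<le> N (x - r *\<^sub>R b) + \<bar>r - of_int (round r)\<bar> * N b"
    using seminorm_add[OF N, of "x - r *\<^sub>R b" "(r - of_int (round r)) *\<^sub>R b"]
    by (simp only: seminorm_scaleR[OF N])
  moreover have "\<bar>r - of_int (round r)\<bar> * N b \<le> 1 / 2 * N b"
    using of_int_round_abs_le[of r] seminorm_nonneg[OF N]
    by (intro mult_right_mono) (auto simp: abs_minus_commute)
  ultimately show ?thesis using b by simp
qed

text \<open>
  A vector that is short in the quotient has a representative modulo \<open>b\<close> that is short for \<open>N\<close>, so the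
  same finite sets serve for the quotient.
\<close>

lemma discrete_modulo_quot:
  assumes N: "seminorm N" and L: "subtraction_closed L" and D: "discrete_modulo N L" and b: "b \<in> L"
  shows "discrete_modulo (quot_seminorm N b) L"
  unfolding discrete_modulo_def
proof
  fix R
  let ?Q = "quot_seminorm N b"
  have Q: "seminorm ?Q" by (rule seminorm_quot_seminorm[OF N])
  obtain F where F: "finite F" "F \<subseteq> L" "\<And>v. v \<in> L \<Longrightarrow> N v \<le> R + 1 + N b \<Longrightarrow> \<exists>f\<in>F. N (v - f) = 0"
    using D unfolding discrete_modulo_def by metis
  have "\<exists>f\<in>F. ?Q (v - f) = 0" if v: "v \<in> L" "?Q v \<le> R" for v
  proof -
    have "?Q v < R + 1" using v(2) by simp
    then obtain r where r: "N (v - r *\<^sub>R b) < R + 1" by (rule quot_seminorm_lessD)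
    define v' where "v' = v - of_int (round r) *\<^sub>R b"
    have "v' \<in> L" using v(1) subgroup_scale_int[OF L b] L unfolding v'_def subtraction_closed_def by blast
    moreover have "N v' \<le> R + 1 + N b"
      using round_multiple[OF N r] seminorm_nonneg[OF N, of b] by (simp add: v'_def)
    ultimately obtain f where f: "f \<in> F" "N (v' - f) = 0" using F(3) by blast
    have "?Q (v - f) \<le> N ((v - f) - of_int (round r) *\<^sub>R b)" by (rule quot_seminorm_le[OF N])
    also have "\<dots> = N (v' - f)" by (simp add: v'_def algebra_simps)
    finally have "?Q (v - f) = 0" using f(2) seminorm_nonneg[OF Q, of "v - f"] by simp
    then show ?thesis using f(1) by blast
  qed
  then show "\<exists>F. finite F \<and> F \<subseteq> L \<and> (\<forall>v\<in>L. ?Q v \<le> R \<longrightarrow> (\<exists>f\<in>F. ?Q (v - f) = 0))"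
    using F(1,2) by blast
qed

lemma discrete_modulo_min:
  assumes N: "seminorm N" and D: "discrete_modulo N L" and v: "v \<in> L" "N v > 0"
  obtains b where "b \<in> L" "N b > 0" "\<And>u. u \<in> L \<Longrightarrow> N u > 0 \<Longrightarrow> N b \<le> N u"
proof -
  obtain F where F: "finite F" "F \<subseteq> L" "\<And>u. u \<in> L \<Longrightarrow> N u \<le> N v \<Longrightarrow> \<exists>f\<in>F. N (u - f) = 0"
    using D unfolding discrete_modulo_def by metis
  let ?G = "{f\<in>F. N f > 0}"
  have G: "\<exists>f\<in>?G. N f = N u" if u: "u \<in> L" "N u \<le> N v" "N u > 0" for u
  proof -
    obtain f where f: "f \<in> F" "N (u - f) = 0" using F(3) u by blast
    then show ?thesis using seminorm_diff_null[OF N f(2)] u(3) by auto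
  qed
  have fin: "finite (N ` ?G)" using F(1) by simp
  have ne: "N ` ?G \<noteq> {}" using G[OF v(1) order_refl v(2)] by blast
  have "Min (N ` ?G) \<in> N ` ?G" by (rule Min_in[OF fin ne])
  then obtain b where b: "b \<in> ?G" "N b = Min (N ` ?G)" by auto
  have "N b \<le> N u" if u: "u \<in> L" "N u > 0" for u
  proof -
    have bv: "N b \<le> N v" using G[OF v(1) order_refl v(2)] b(2) fin by (metis (no_types, lifting) Min_le image_eqI)
    show ?thesis
    proof (cases "N u \<le> N v")
      case True
      then obtain f where "f \<in> ?G" "N f = N u" using G u by blast
      then have "N u \<in> N ` ?G" by (metis (no_types, lifting) imageI)
      then show ?thesis using b(2) Min_le[OF fin] by simp
    next
      case False then show ?thesis using bv by simp
    qed
  qed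
  then show ?thesis using that b(1) F(2) by blast
qed

text \<open>
  The infimum runs over a line along which \<open>N\<close> is Lipschitz and grows without bound, so only a compact
  interval matters.
\<close>

lemma quot_seminorm_attained:
  assumes N: "seminorm N" and b: "N b > 0"
  obtains r where "quot_seminorm N b x = N (x - r *\<^sub>R b)"
proof -
  define M where "M = 2 * N x / N b"
  let ?g = "\<lambda>r. N (x - r *\<^sub>R b)"
  have M: "0 \<le> M" using b seminorm_nonneg[OF N] by (simp add: M_def)
  have step: "?g r \<le> ?g s + N b * \<bar>r - s\<bar>" for r s
  proof -
    have "?g r = N ((x - s *\<^sub>R b) + (s - r) *\<^sub>R b)" by (simp add: algebra_simps)
    also have "\<dots> \<le> ?g s + \<bar>s - r\<bar> * N b"
      using seminorm_add[OF N, of "x - s *\<^sub>R b" "(s - r) *\<^sub>R b"] by (simp only: seminorm_scaleR[OF N])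
    finally show ?thesis by (simp add: abs_minus_commute mult.commute)
  qed
  have "(N b)-lipschitz_on {-M..M} ?g"
  proof (rule lipschitz_onI)
    show "dist (?g r) (?g s) \<le> N b * dist r s" for r s
      using step[of r s] step[of s r] by (simp add: dist_real_def abs_minus_commute abs_le_iff)
  qed (use b in simp)
  then have "continuous_on {-M..M} ?g" by (rule lipschitz_on_continuous_on)
  then obtain r where r: "r \<in> {-M..M}" "\<And>s. s \<in> {-M..M} \<Longrightarrow> ?g r \<le> ?g s"
    using continuous_attains_inf[of "{-M..M}" ?g] M by fastforce
  have "?g r \<le> ?g s" for s
  proof (cases "s \<in> {-M..M}")
    case False
    then have "M \<le> \<bar>s\<bar>" by auto
    then have "M * N b \<le> \<bar>s\<bar> * N b" using b by (intro mult_right_mono) auto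
    then have "2 * N x \<le> N (s *\<^sub>R b)" using b by (simp add: M_def seminorm_scaleR[OF N])
    also have "\<dots> \<le> N x + ?g s" using seminorm_diff[OF N, of x "x - s *\<^sub>R b"] by simp
    finally have "?g 0 \<le> ?g s" by simp
    moreover have "?g r \<le> ?g 0" using M by (intro r(2)) simp
    ultimately show ?thesis by linarith
  qed (rule r(2))
  then have "quot_seminorm N b x = ?g r"
    unfolding quot_seminorm_def by (intro cInf_eq_minimum) auto
  then show ?thesis by (rule that)
qed

text \<open>
  The quotient by \<open>b\<close> vanishes exactly if \<open>N\<close> is one-dimensional up to its null space. Then the
  coordinate along \<open>b\<close> is a linear functional, and it is integral on \<open>L\<close> because otherwise a
  difference from the nearest multiple of \<open>b\<close> would be a nonzero vector shorter than \<open>b\<close>.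
\<close>

lemma coordinate_functional:
  assumes N: "seminorm N" and b: "N b > 0" and Q: "\<And>x. quot_seminorm N b x = 0"
    and L: "subtraction_closed L" "b \<in> L" and min: "\<And>u. u \<in> L \<Longrightarrow> N u > 0 \<Longrightarrow> N b \<le> N u"
  obtains \<phi> where "linear \<phi>" "\<And>x. N x = \<bar>\<phi> x\<bar> * N b" "\<And>v. v \<in> L \<Longrightarrow> \<phi> v \<in> \<int>" "\<phi> b = 1"
proof -
  have "\<exists>r. N (x - r *\<^sub>R b) = 0" for x
  proof -
    obtain r where "quot_seminorm N b x = N (x - r *\<^sub>R b)"
      by (rule quot_seminorm_attained[OF N b])
    from trans[OF this[symmetric] Q] show ?thesis by (rule exI)
  qed
  then have "\<forall>x. \<exists>r. N (x - r *\<^sub>R b) = 0" ..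
  from choice[OF this] obtain \<phi> where \<phi>: "\<And>x. N (x - \<phi> x *\<^sub>R b) = 0" by blast
  have uniq: "\<phi> x = r" if "N (x - r *\<^sub>R b) = 0" for x r
  proof -
    have "N ((x - r *\<^sub>R b) - (x - \<phi> x *\<^sub>R b)) \<le> 0"
      using seminorm_diff[OF N, of "x - r *\<^sub>R b" "x - \<phi> x *\<^sub>R b"] \<phi> that by simp
    moreover have "(x - r *\<^sub>R b) - (x - \<phi> x *\<^sub>R b) = (\<phi> x - r) *\<^sub>R b"
      by (simp add: algebra_simps)
    ultimately have "\<bar>\<phi> x - r\<bar> * N b \<le> 0" by (simp only: seminorm_scaleR[OF N])
    then show ?thesis using b by (simp add: mult_le_0_iff)
  qed
  have "linear \<phi>"
  proof (rule linearI)
    fix x y :: 'a and t :: real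
    have "N ((x + y) - (\<phi> x + \<phi> y) *\<^sub>R b) = N ((x - \<phi> x *\<^sub>R b) + (y - \<phi> y *\<^sub>R b))"
      by (simp add: algebra_simps)
    also have "\<dots> \<le> 0" using seminorm_add[OF N, of "x - \<phi> x *\<^sub>R b" "y - \<phi> y *\<^sub>R b"] \<phi> by simp
    finally have "N ((x + y) - (\<phi> x + \<phi> y) *\<^sub>R b) = 0"
      using seminorm_nonneg[OF N] by (rule order_antisym)
    then show "\<phi> (x + y) = \<phi> x + \<phi> y" by (rule uniq)
    have "N (t *\<^sub>R x - (t * \<phi> x) *\<^sub>R b) = N (t *\<^sub>R (x - \<phi> x *\<^sub>R b))" by (simp add: algebra_simps)
    also have "\<dots> = 0" using \<phi> by (simp add: seminorm_scaleR[OF N])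
    finally have "\<phi> (t *\<^sub>R x) = t * \<phi> x" by (rule uniq)
    then show "\<phi> (t *\<^sub>R x) = t *\<^sub>R \<phi> x" by simp
  qed
  moreover have Nx: "N x = \<bar>\<phi> x\<bar> * N b" for x
    using seminorm_diff_null[OF N \<phi>[of x]] by (simp add: seminorm_scaleR[OF N])
  moreover have "\<phi> v \<in> \<int>" if v: "v \<in> L" for v
  proof -
    define u where "u = v - of_int (round (\<phi> v)) *\<^sub>R b"
    have u: "u \<in> L" using v subgroup_scale_int[OF L] L(1) unfolding u_def subtraction_closed_def by blast
    have "N u \<le> N (v - \<phi> v *\<^sub>R b) + N ((\<phi> v - of_int (round (\<phi> v))) *\<^sub>R b)"
      using seminorm_add[OF N, of "v - \<phi> v *\<^sub>R b" "(\<phi> v - of_int (round (\<phi> v))) *\<^sub>R b"]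
      by (simp add: u_def algebra_simps)
    also have "\<dots> = \<bar>\<phi> v - of_int (round (\<phi> v))\<bar> * N b"
      by (simp only: \<phi> seminorm_scaleR[OF N] add_0)
    also have "\<dots> \<le> 1 / 2 * N b"
      using of_int_round_abs_le[of "\<phi> v"] b
      by (intro mult_right_mono) (auto simp: abs_minus_commute)
    also have "\<dots> < N b" using b by simp
    finally have "\<not> N b \<le> N u" by simp
    then have "\<not> N u > 0" using min[OF u] by blast
    then have "N u = 0" using seminorm_nonneg[OF N, of u] by simp
    then have "\<phi> v = of_int (round (\<phi> v))" unfolding u_def by (rule uniq)
    then show ?thesis by (rule ssubst[where P = "\<lambda>t. t \<in> \<int>"]) (rule Ints_of_int)
  qed
  moreover have "\<phi> b = 1" by (rule uniq) (simp add: seminorm_zero[OF N])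
  ultimately show ?thesis by (rule that)
qed

text \<open>
  Every nonzero functional in the dual lattice has dual norm larger than \<open>w\<close>. The strict
  inequality is witnessed at a point, so the dual norm itself, a supremum, is not needed. Integrality
  on \<open>L\<close> does not refer to the seminorm, and passing to a quotient only decreases the seminorm: the
  condition is inherited by quotients.
\<close>

definition dual_large :: "('v::real_vector \<Rightarrow> real) \<Rightarrow> 'v set \<Rightarrow> real \<Rightarrow> bool" where
  "dual_large N L w \<longleftrightarrow>
     (\<forall>\<phi>. linear \<phi> \<and> (\<forall>v\<in>L. \<phi> v \<in> \<int>) \<and> \<phi> \<noteq> (\<lambda>_. 0) \<longrightarrow> (\<exists>x. w * N x < \<bar>\<phi> x\<bar>))"

lemma dual_large_quot:
  assumes N: "seminorm N" and w: "0 < w" and D: "dual_large N L w"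
  shows "dual_large (quot_seminorm N b) L w"
  unfolding dual_large_def
proof (intro allI impI)
  fix \<phi> :: "'a \<Rightarrow> real" assume "linear \<phi> \<and> (\<forall>v\<in>L. \<phi> v \<in> \<int>) \<and> \<phi> \<noteq> (\<lambda>_. 0)"
  then obtain x where "w * N x < \<bar>\<phi> x\<bar>" using D unfolding dual_large_def by blast
  then show "\<exists>x. w * quot_seminorm N b x < \<bar>\<phi> x\<bar>"
    using mult_left_mono[OF quot_seminorm_le'[OF N, of b x], of w] w by (intro exI[of _ x]) linarith
qed

lemma null_on_spanning:
  assumes N: "seminorm N" and E: "spans_modulo N E" and 0: "\<And>e. e \<in> E \<Longrightarrow> N e = 0"
  shows "N x = 0"
proof -
  obtain y where y: "y \<in> span E" "N (x - y) = 0" using E unfolding spans_modulo_def by blast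
  have "N y = 0" using y(1)
  proof (induction rule: span_induct_alt)
    case base show ?case by (rule seminorm_zero[OF N])
  next
    case (step c e y)
    have "N (c *\<^sub>R e + y) \<le> \<bar>c\<bar> * N e + N y"
      using seminorm_add[OF N, of "c *\<^sub>R e" y] by (simp only: seminorm_scaleR[OF N])
    then show ?case using 0[OF step(1)] step(2) seminorm_nonneg[OF N, of "c *\<^sub>R e + y"] by simp
  qed
  then show ?thesis using seminorm_diff_null[OF N y(2)] by simp
qed

text \<open>
  Let \<open>b\<close> be a shortest vector of \<open>L\<close>. Lifting a vector that is short in the quotient costs at most
  half the length of \<open>b\<close>, by rounding its coordinate along \<open>b\<close>. Applied to a short lattice vector of
  the quotient this gives a lattice vector no shorter than \<open>b\<close>, so the length of \<open>b\<close> is at most twice the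
  length in the quotient. Applied to \<open>x - p\<close> it adds \<open>N b / 2\<close> to the covering radius. Both bounds
  therefore double in each step. If the quotient is trivial, the coordinate along \<open>b\<close> is a
  dual vector of norm \<open>1 / N b\<close>, and \<open>dual_large\<close> bounds \<open>N b\<close> directly.
\<close>

lemma flatness:
  fixes N :: "'v::real_vector \<Rightarrow> real"
  assumes "seminorm N" and L: "subtraction_closed L" and "discrete_modulo N L"
    and "spans_modulo N E" "finite E" "E \<subseteq> L" "card E = k"
    and "dual_large N L w" and w: "0 < w"
  shows "(\<forall>x. \<exists>p\<in>L. 2 * w * N (x - p) < 2 ^ k) \<and>
    (\<forall>v\<in>L. N v > 0 \<longrightarrow> (\<exists>b\<in>L. N b > 0 \<and> 2 * w * N b < 2 ^ k))"
proof -
  have L0: "0 \<in> L" using L by (simp add: subtraction_closed_def)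
  show ?thesis
    using assms(1,3-8)
  proof (induction k arbitrary: N E)
  case 0
  then have "E = {}" by simp
  then have "N x = 0" for x using null_on_spanning[OF 0(1,3)] by simp
  then show ?case using L0 by auto
next
  case (Suc k)
  note N = Suc.prems(1)
  show ?case
  proof (cases "\<exists>v\<in>L. N v > 0")
    case False
    have "N e = 0" if "e \<in> E" for e
    proof -
      have "e \<in> L" using Suc.prems(5) that by blast
      then have "\<not> N e > 0" using False by blast
      then show ?thesis using seminorm_nonneg[OF N, of e] by simp
    qed
    then have "N x = 0" for x
      by (rule null_on_spanning[OF N Suc.prems(3)])
    then show ?thesis using L0 by auto
  next
    case True
    then obtain v where v: "v \<in> L" "N v > 0" by blast
    obtain b where b: "b \<in> L" "N b > 0" and min: "\<And>u. u \<in> L \<Longrightarrow> N u > 0 \<Longrightarrow> N b \<le> N u"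
      using discrete_modulo_min[OF N Suc.prems(2) v] by blast
    let ?Q = "quot_seminorm N b"
    have Q: "seminorm ?Q" by (rule seminorm_quot_seminorm[OF N])
    obtain e where e: "e \<in> E" "spans_modulo ?Q (E - {e})"
      by (rule spans_modulo_quot[OF N Suc.prems(3,4) b(2)])
    have IH: "(\<forall>x. \<exists>p\<in>L. 2 * w * ?Q (x - p) < 2 ^ k) \<and>
      (\<forall>v\<in>L. ?Q v > 0 \<longrightarrow> (\<exists>b\<in>L. ?Q b > 0 \<and> 2 * w * ?Q b < 2 ^ k))"
    proof (rule Suc.IH[of ?Q "E - {e}"])
      show "discrete_modulo ?Q L" by (rule discrete_modulo_quot[OF N L Suc.prems(2) b(1)])
      show "dual_large ?Q L w" by (rule dual_large_quot[OF N w Suc.prems(7)])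
      show "finite (E - {e})" "E - {e} \<subseteq> L" using Suc.prems(4,5) by auto
      show "card (E - {e}) = k" using Suc.prems(6) e(1) by simp
    qed (fact Q e(2))+
    have shift: "\<exists>j. 2 * w * N (x - of_int j *\<^sub>R b) < 2 ^ k + w * N b"
      if x: "2 * w * ?Q x < 2 ^ k" for x
    proof -
      have "?Q x < 2 ^ k / (2 * w)" using x w by (simp add: pos_less_divide_eq mult.commute)
      then obtain r where "N (x - r *\<^sub>R b) < 2 ^ k / (2 * w)" by (rule quot_seminorm_lessD)
      from round_multiple[OF N this]
      have "2 * w * N (x - of_int (round r) *\<^sub>R b) < 2 * w * (2 ^ k / (2 * w) + N b / 2)"
        using w by (intro mult_strict_left_mono) auto
      also have "\<dots> = 2 ^ k + w * N b" using w by (simp add: field_simps)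
      finally show ?thesis by blast
    qed
    \<comment> \<open>The length of \<open>b\<close>, from the quotient or, if that is trivial, from the dual lattice.\<close>
    have short: "2 * w * N b < 2 ^ Suc k"
    proof (cases "\<exists>v\<in>L. ?Q v > 0")
      case True
      then obtain u where u: "u \<in> L" "?Q u > 0" "2 * w * ?Q u < 2 ^ k" using IH by blast
      from shift[OF u(3)] obtain j where
        j: "2 * w * N (u - of_int j *\<^sub>R b) < 2 ^ k + w * N b" by blast
      have "u - of_int j *\<^sub>R b \<in> L"
        using u(1) subgroup_scale_int[OF L b(1)] L unfolding subtraction_closed_def by blast
      moreover have "N (u - of_int j *\<^sub>R b) > 0"
        using quot_seminorm_le[OF N, of b u "of_int j"] u(2) by linarith
      ultimately have "N b \<le> N (u - of_int j *\<^sub>R b)" by (rule min)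
      then have "2 * w * N b \<le> 2 * w * N (u - of_int j *\<^sub>R b)" using w by simp
      then show ?thesis using j by simp
    next
      case False
      have "?Q e' = 0" if "e' \<in> E" for e'
      proof -
        have "e' \<in> L" using Suc.prems(5) that by blast
        then have "\<not> ?Q e' > 0" using False by blast
        then show ?thesis using seminorm_nonneg[OF Q, of e'] by simp
      qed
      then have Q0: "?Q x = 0" for x
        using null_on_spanning[OF Q e(2)] by simp
      obtain \<phi> where \<phi>: "linear \<phi>" "\<And>x. N x = \<bar>\<phi> x\<bar> * N b" "\<And>v. v \<in> L \<Longrightarrow> \<phi> v \<in> \<int>" "\<phi> b = 1"
        using coordinate_functional[OF N b(2) Q0 L b(1) min] by blast
      have "\<phi> \<noteq> (\<lambda>_. 0)" using \<phi>(4) by auto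
      then obtain x where "w * N x < \<bar>\<phi> x\<bar>"
        using Suc.prems(7) \<phi>(1,3) unfolding dual_large_def by blast
      then have "\<bar>\<phi> x\<bar> * (w * N b) < \<bar>\<phi> x\<bar> * 1" using \<phi>(2)[of x] by (simp add: algebra_simps)
      then have "w * N b < 1" by (rule mult_left_less_imp_less) simp
      moreover have "(1::real) \<le> 2 ^ k" by simp
      ultimately have "w * N b < 2 ^ k" by (rule less_le_trans)
      then show ?thesis by simp
    qed
    moreover have "\<exists>p\<in>L. 2 * w * N (x - p) < 2 ^ Suc k" for x
    proof -
      obtain p where p: "p \<in> L" "2 * w * ?Q (x - p) < 2 ^ k" using IH by blast
      from shift[OF p(2)] obtain j where
        j: "2 * w * N (x - p - of_int j *\<^sub>R b) < 2 ^ k + w * N b" by blast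
      have "- (of_int j *\<^sub>R b) \<in> L" using subgroup_scale_int[OF L b(1), of "-j"] by simp
      then have "p - - (of_int j *\<^sub>R b) \<in> L" using p(1) L unfolding subtraction_closed_def by blast
      then have "p + of_int j *\<^sub>R b \<in> L" by simp
      moreover have "2 * w * N (x - (p + of_int j *\<^sub>R b)) < 2 ^ Suc k"
        using j short by (simp add: diff_diff_eq)
      ultimately show ?thesis by blast
    qed
    ultimately show ?thesis using b by blast
  qed
qed
qed

section \<open>Covering by integer translates of the difference body\<close>

text \<open>
  With pointwise operations, coordinate vectors form a real vector space, to which the abstract
  flatness theorem applies.
\<close>

instantiation "fun" :: (type, real_vector) real_vector
begin

definition scaleR_fun :: "real \<Rightarrow> ('a \<Rightarrow> 'b) \<Rightarrow> 'a \<Rightarrow> 'b" where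
  "scaleR_fun t f = (\<lambda>x. t *\<^sub>R f x)"

instance
  by standard (simp_all add: scaleR_fun_def fun_eq_iff algebra_simps)

end

lemma scaleR_fun_apply [simp]: "(t *\<^sub>R f) x = t *\<^sub>R f x"
  by (simp add: scaleR_fun_def)

lemma sum_fun_apply: "(\<Sum>i\<in>A. f i) x = (\<Sum>i\<in>A. f i x)"
  by (induction A rule: infinite_finite_induct) auto

lemma convex_body_Rn: "convex_body m K \<Longrightarrow> x \<in> K \<Longrightarrow> x \<in> Rn m"
  using compactin_subset_topspace[of "powertop_real {..<m}" K] by (auto simp: convex_body_def)

lemma convex_body_convex:
  assumes "convex_body m K" "x \<in> K" "y \<in> K" "0 \<le> t" "t \<le> 1"
  shows "(\<lambda>i\<in>{..<m}. (1 - t) * x i + t * y i) \<in> K"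
proof -
  have "\<forall>x\<in>K. \<forall>y\<in>K. \<forall>u\<ge>0. \<forall>v\<ge>0. u + v = 1 \<longrightarrow> (\<lambda>i\<in>{..<m}. u * x i + v * y i) \<in> K"
    using assms(1) unfolding convex_body_def by (elim conjE)
  from this[rule_format, OF assms(2,3), of "1 - t" t] show ?thesis using assms(4,5) by simp
qed

lemma convex_body_bounded:
  assumes "convex_body m K"
  obtains B where "B > 0" "\<forall>x\<in>K. \<forall>i<m. \<bar>x i\<bar> \<le> B"
proof -
  have "\<exists>b. \<forall>x\<in>K. \<bar>x i\<bar> \<le> b" if "i < m" for i
  proof -
    have "compactin euclideanreal ((\<lambda>x. x i) ` K)"
      using assms that unfolding convex_body_def
      by (intro image_compactin[of "powertop_real {..<m}"] continuous_map_product_projection) auto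
    then have "bounded ((\<lambda>x. x i) ` K)" by (simp add: compactin_euclidean_iff compact_imp_bounded)
    then show ?thesis by (auto simp: bounded_iff)
  qed
  then obtain b where b: "\<And>i x. i < m \<Longrightarrow> x \<in> K \<Longrightarrow> \<bar>x i\<bar> \<le> b i" by metis
  have "\<bar>x i\<bar> \<le> (\<Sum>i<m. \<bar>b i\<bar>) + 1" if "x \<in> K" "i < m" for x i
  proof -
    have "\<bar>b i\<bar> \<le> (\<Sum>i<m. \<bar>b i\<bar>)" using that by (intro member_le_sum) auto
    then show ?thesis using b[OF that(2,1)] by simp
  qed
  then show ?thesis by (intro that[of "(\<Sum>i<m. \<bar>b i\<bar>) + 1"]) (auto intro: add_nonneg_pos sum_nonneg)
qed

lemma convex_body_box:
  assumes "convex_body m K"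
  obtains p \<rho> where "p \<in> K" "\<rho> > 0" "\<forall>y\<in>Rn m. (\<forall>i<m. \<bar>y i - p i\<bar> < \<rho>) \<longrightarrow> y \<in> K"
proof -
  let ?X = "powertop_real {..<m}"
  have "?X interior_of K \<noteq> {}" using assms unfolding convex_body_def by (elim conjE)
  then obtain p where p: "p \<in> ?X interior_of K" by (meson all_not_in_conv)
  have "openin ?X (?X interior_of K)" by (rule openin_interior_of)
  then obtain U where U: "\<And>i. i < m \<Longrightarrow> open (U i)" "p \<in> Pi\<^sub>E {..<m} U" "Pi\<^sub>E {..<m} U \<subseteq> ?X interior_of K"
  proof -
    obtain U where "\<forall>i\<in>{..<m}. openin euclideanreal (U i)" "p \<in> Pi\<^sub>E {..<m} U"
      "Pi\<^sub>E {..<m} U \<subseteq> ?X interior_of K"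
      using \<open>openin _ _\<close> p unfolding openin_product_topology_alt by meson
    then show ?thesis by (intro that[of U]) simp_all
  qed
  have "\<exists>e>0. ball (p i) e \<subseteq> U i" if "i < m" for i
    using U(1)[OF that] PiE_mem[OF U(2), of i] that unfolding open_contains_ball by simp
  then obtain e where e: "\<And>i. i < m \<Longrightarrow> e i > 0" "\<And>i. i < m \<Longrightarrow> ball (p i) (e i) \<subseteq> U i" by metis
  define \<rho> where "\<rho> = Min (insert 1 (e ` {..<m}))"
  have \<rho>: "\<rho> > 0" unfolding \<rho>_def using e(1) by (subst Min_gr_iff) auto
  have \<rho>e: "\<rho> \<le> e i" if "i < m" for i unfolding \<rho>_def using that by (intro Min_le) auto
  have "y \<in> K" if y: "y \<in> Rn m" "\<And>i. i < m \<Longrightarrow> \<bar>y i - p i\<bar> < \<rho>" for y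
  proof -
    have "y i \<in> U i" if "i < m" for i
      using e(2)[OF that] y(2)[OF that] \<rho>e[OF that] by (auto simp: dist_real_def abs_minus_commute)
    then have "y \<in> Pi\<^sub>E {..<m} U" using y(1) by (auto simp: PiE_iff)
    then show ?thesis using U(3) interior_of_subset[of ?X K] by blast
  qed
  then show ?thesis using that[of p \<rho>] p \<rho> interior_of_subset[of ?X K] by blast
qed

text \<open>
  The gauge of the difference body of the projection of \<open>K\<close> to the first \<open>n\<close> coordinates. It is a
  seminorm on all coordinate vectors whose null vectors are those that vanish in these coordinates.
\<close>

definition diff_gauge :: "nat \<Rightarrow> (nat \<Rightarrow> real) set \<Rightarrow> (nat \<Rightarrow> real) \<Rightarrow> real" where
  "diff_gauge n K x = Inf {r. 0 \<le> r \<and> (\<exists>a\<in>K. \<exists>b\<in>K. \<forall>i<n. x i = r * (a i - b i))}"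

context
  fixes m n :: nat and K :: "(nat \<Rightarrow> real) set"
  assumes K: "convex_body m K" and nm: "n \<le> m"
begin

lemma diff_gauge_le:
  "0 \<le> r \<Longrightarrow> a \<in> K \<Longrightarrow> b \<in> K \<Longrightarrow> (\<And>i. i < n \<Longrightarrow> x i = r * (a i - b i)) \<Longrightarrow> diff_gauge n K x \<le> r"
  unfolding diff_gauge_def by (rule cInf_lower) (auto intro: bdd_belowI[of _ 0])

text \<open>
  The difference body absorbs every vector because \<open>K\<close> contains a box.
\<close>

lemma diff_gauge_nonempty: "{r. 0 \<le> r \<and> (\<exists>a\<in>K. \<exists>b\<in>K. \<forall>i<n. x i = r * (a i - b i))} \<noteq> {}"
proof -
  obtain p \<rho> where p: "p \<in> K" "\<rho> > 0" "\<forall>y\<in>Rn m. (\<forall>i<m. \<bar>y i - p i\<bar> < \<rho>) \<longrightarrow> y \<in> K"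
    by (rule convex_body_box[OF K])
  define s where "s = 1 + (\<Sum>i<m. \<bar>x i\<bar>)"
  have s: "s > 0" unfolding s_def by (intro add_pos_nonneg sum_nonneg) auto
  have xs: "\<bar>x i\<bar> < s" if "i < m" for i
    using member_le_sum[of i "{..<m}" "\<lambda>i. \<bar>x i\<bar>"] that by (simp add: s_def)
  define q where "q = (\<lambda>i\<in>{..<m}. p i + \<rho> / s * x i)"
  have "q \<in> K"
  proof (rule p(3)[rule_format])
    show "q \<in> Rn m" by (simp add: q_def)
    fix i assume i: "i < m"
    have "\<bar>q i - p i\<bar> = \<rho> * (\<bar>x i\<bar> / s)" using i s p(2) by (simp add: q_def abs_mult)
    also have "\<dots> < \<rho> * 1" using xs[OF i] s p(2) by (intro mult_strict_left_mono) auto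
    finally show "\<bar>q i - p i\<bar> < \<rho>" by simp
  qed
  moreover have "x i = s / \<rho> * (q i - p i)" if "i < n" for i
    using that nm s p(2) by (simp add: q_def)
  ultimately have "s / \<rho> \<in> {r. 0 \<le> r \<and> (\<exists>a\<in>K. \<exists>b\<in>K. \<forall>i<n. x i = r * (a i - b i))}"
    using s p(1,2) by (simp, blast)
  then show ?thesis by blast
qed

lemma diff_gauge_lessE:
  assumes "diff_gauge n K x < c"
  obtains r a b where "0 \<le> r" "r < c" "a \<in> K" "b \<in> K" "\<forall>i<n. x i = r * (a i - b i)"
proof -
  let ?S = "{r. 0 \<le> r \<and> (\<exists>a\<in>K. \<exists>b\<in>K. \<forall>i<n. x i = r * (a i - b i))}"
  have "\<exists>r\<in>?S. r < c"
  proof (rule ccontr)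
    assume "\<not> (\<exists>r\<in>?S. r < c)"
    then have "c \<le> Inf ?S" by (intro cInf_greatest[OF diff_gauge_nonempty]) (meson not_le)
    then show False using assms by (simp add: diff_gauge_def)
  qed
  then obtain r where r: "r \<in> ?S" "r < c" ..
  from r(1) obtain a b where "0 \<le> r" "a \<in> K" "b \<in> K" "\<forall>i<n. x i = r * (a i - b i)" by blast
  with r(2) show ?thesis by (intro that[of r a b]) simp_all
qed

lemma seminorm_diff_gauge: "seminorm (diff_gauge n K)"
proof -
  let ?N = "diff_gauge n K"
  have nn: "0 \<le> ?N x" for x
    unfolding diff_gauge_def by (rule cInf_greatest[OF diff_gauge_nonempty]) simp
  have add: "?N (x + y) \<le> ?N x + ?N y" for x y
  proof (rule field_le_epsilon)
    fix e :: real assume e: "e > 0"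
    have *: "?N x < ?N x + e / 2" "?N y < ?N y + e / 2" using e by auto
    obtain r a b where 1: "0 \<le> r" "r < ?N x + e / 2" "a \<in> K" "b \<in> K" "\<forall>i<n. x i = r * (a i - b i)"
      by (rule diff_gauge_lessE[OF *(1)])
    obtain s c d where 2: "0 \<le> s" "s < ?N y + e / 2" "c \<in> K" "d \<in> K" "\<forall>i<n. y i = s * (c i - d i)"
      by (rule diff_gauge_lessE[OF *(2)])
    have "?N (x + y) \<le> r + s"
    proof (cases "r + s = 0")
      case True
      then have rs: "r = 0" "s = 0" using 1(1) 2(1) by linarith+
      have "?N (x + y) \<le> 0" using 1(3-5) 2(5) by (intro diff_gauge_le[of 0 a b]) (simp_all add: rs)
      then show ?thesis using rs by simp
    next
      case False
      define t where "t = s / (r + s)"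
      have "r + s > 0" using 1(1) 2(1) False by linarith
      then have t: "0 \<le> t" "t \<le> 1" using 1(1) 2(1) by (simp_all add: t_def)
      have rs2: "(r + s) * t = s" using False by (simp add: t_def)
      then have rs: "(r + s) * (1 - t) = r" by (simp add: right_diff_distrib)
      have "(r + s) * (((1 - t) * a i + t * c i) - ((1 - t) * b i + t * d i)) = x i + y i" if "i < n" for i
      proof -
        have "(r + s) * (((1 - t) * a i + t * c i) - ((1 - t) * b i + t * d i)) =
          ((r + s) * (1 - t)) * (a i - b i) + ((r + s) * t) * (c i - d i)" by (simp add: algebra_simps)
        then show ?thesis using 1(5) 2(5) that by (simp only: rs rs2)
      qed
      then show ?thesis
        using 1(1) 2(1) nm convex_body_convex[OF K 1(3) 2(3) t] convex_body_convex[OF K 1(4) 2(4) t]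
        by (intro diff_gauge_le[of "r + s" "\<lambda>i\<in>{..<m}. (1 - t) * a i + t * c i"
              "\<lambda>i\<in>{..<m}. (1 - t) * b i + t * d i"]) auto
    qed
    then show "?N (x + y) \<le> ?N x + ?N y + e" using 1 2 by simp
  qed
  have le: "?N (t *\<^sub>R x) \<le> \<bar>t\<bar> * ?N x" for t x
  proof (rule field_le_epsilon)
    fix e :: real assume e: "e > 0"
    have "?N x < ?N x + e / (\<bar>t\<bar> + 1)" using e by simp
    then obtain r a b where 1: "0 \<le> r" "r < ?N x + e / (\<bar>t\<bar> + 1)" "a \<in> K" "b \<in> K" "\<forall>i<n. x i = r * (a i - b i)"
      by (rule diff_gauge_lessE)
    have "?N (t *\<^sub>R x) \<le> \<bar>t\<bar> * r"
    proof (cases "t \<ge> 0")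
      case True
      then show ?thesis using 1 by (intro diff_gauge_le[of _ a b]) auto
    next
      case False
      have "(t *\<^sub>R x) i = \<bar>t\<bar> * r * (b i - a i)" if "i < n" for i
      proof -
        have eq: "x i = r * (a i - b i)" using 1(5) that by blast
        show ?thesis unfolding scaleR_fun_apply eq using False by (simp add: algebra_simps)
      qed
      then show ?thesis using 1(1,3,4) by (intro diff_gauge_le[of _ b a]) auto
    qed
    also have "\<dots> \<le> \<bar>t\<bar> * (?N x + e / (\<bar>t\<bar> + 1))" using 1(2) by (intro mult_left_mono) auto
    also have "\<dots> = \<bar>t\<bar> * ?N x + e * (\<bar>t\<bar> / (\<bar>t\<bar> + 1))" by (simp add: algebra_simps)
    also have "e * (\<bar>t\<bar> / (\<bar>t\<bar> + 1)) \<le> e * 1" using e by (intro mult_left_mono) auto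
    finally show "?N (t *\<^sub>R x) \<le> \<bar>t\<bar> * ?N x + e" by simp
  qed
  have "?N (t *\<^sub>R x) = \<bar>t\<bar> * ?N x" for t x
  proof (cases "t = 0")
    case True
    then show ?thesis using le[of 0 x] nn[of 0] by simp
  next
    case False
    have "?N x = ?N ((1 / t) *\<^sub>R (t *\<^sub>R x))" using False by simp
    also have "\<dots> \<le> \<bar>1 / t\<bar> * ?N (t *\<^sub>R x)" by (rule le)
    finally have "\<bar>t\<bar> * ?N x \<le> ?N (t *\<^sub>R x)" using False by (simp add: field_simps)
    then show ?thesis using le[of t x] by simp
  qed
  with add show ?thesis unfolding seminorm_def by blast
qed

lemma diff_gauge_null: "(\<And>i. i < n \<Longrightarrow> x i = 0) \<Longrightarrow> diff_gauge n K x = 0"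
proof -
  assume x: "\<And>i. i < n \<Longrightarrow> x i = 0"
  obtain p where p: "p \<in> K" using convex_body_box[OF K] by blast
  have "diff_gauge n K x \<le> 0" by (rule diff_gauge_le[of _ p p]) (auto simp: p x)
  then show ?thesis using seminorm_nonneg[OF seminorm_diff_gauge, of x] by simp
qed

lemma diff_gauge_bound:
  assumes B: "B > 0" "\<forall>x\<in>K. \<forall>i<m. \<bar>x i\<bar> \<le> B" and i: "i < n"
  shows "\<bar>x i\<bar> \<le> diff_gauge n K x * (2 * B)"
proof -
  have "\<bar>x i\<bar> / (2 * B) \<le> diff_gauge n K x"
    unfolding diff_gauge_def
  proof (rule cInf_greatest[OF diff_gauge_nonempty])
    fix r assume "r \<in> {r. 0 \<le> r \<and> (\<exists>a\<in>K. \<exists>b\<in>K. \<forall>i<n. x i = r * (a i - b i))}"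
    then obtain a b where ab: "0 \<le> r" "a \<in> K" "b \<in> K" "x i = r * (a i - b i)" using i by blast
    have "\<bar>a i\<bar> \<le> B" "\<bar>b i\<bar> \<le> B" using B(2) ab(2,3) i nm by simp_all
    then have "\<bar>a i - b i\<bar> \<le> 2 * B" by linarith
    then have "r * \<bar>a i - b i\<bar> \<le> r * (2 * B)" using ab(1) by (rule mult_left_mono)
    then show "\<bar>x i\<bar> / (2 * B) \<le> r" using ab(1,4) B(1) by (simp add: abs_mult pos_divide_le_eq)
  qed
  then show ?thesis using B(1) by (simp add: pos_divide_le_eq)
qed

text \<open>
  The coordinates from \<open>n\<close> on are unrestricted in the lattice. A functional that is integral on all
  multiples of a vector vanishes on it, so only the first \<open>n\<close> coordinates count.
\<close>

lemma linear_integral_on_lattice: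
  fixes \<phi> :: "(nat \<Rightarrow> real) \<Rightarrow> real"
  assumes lin: "linear \<phi>" and int: "\<And>v. (\<forall>i<n. v i \<in> \<int>) \<Longrightarrow> \<phi> v \<in> \<int>"
  obtains z where "z \<in> Zn n" "\<And>x. \<phi> x = dot n z x"
proof -
  define e where "e i = (\<lambda>j. if j = i then 1 else 0 :: real)" for i :: nat
  define z where "z = (\<lambda>i\<in>{..<n}. \<phi> (e i))"
  have "\<phi> y = 0" if y: "\<And>i. i < n \<Longrightarrow> y i = 0" for y
  proof (rule ccontr)
    assume ne: "\<phi> y \<noteq> 0"
    have "\<phi> ((1 / (2 * \<phi> y)) *\<^sub>R y) \<in> \<int>" by (rule int) (simp add: y)
    then have "1 / 2 \<in> (\<int> :: real set)" using ne by (simp add: linear_cmul[OF lin])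
    then obtain j :: int where "1 / 2 = (of_int j :: real)" by (auto elim: Ints_cases)
    then have "(1::real) = of_int (2 * j)" by simp
    then have "1 = 2 * j" by linarith
    then show False by presburger
  qed
  then have null: "\<phi> x = \<phi> y" if "\<And>i. i < n \<Longrightarrow> x i = y i" for x y
    using that linear_diff[OF lin, of x y] by fastforce
  have "\<phi> x = dot n z x" for x
  proof -
    have "\<phi> x = \<phi> (\<Sum>i<n. x i *\<^sub>R e i)"
    proof (rule null)
      fix i assume "i < n"
      have "(\<Sum>j<n. x j *\<^sub>R e j) i = (\<Sum>j<n. if j = i then x j else 0)"
        unfolding sum_fun_apply by (rule sum.cong) (auto simp: e_def)
      then show "x i = (\<Sum>j<n. x j *\<^sub>R e j) i" using \<open>i < n\<close> by simp
    qed
    also have "\<dots> = (\<Sum>i<n. x i * \<phi> (e i))" by (simp add: linear_sum[OF lin] linear_cmul[OF lin])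
    also have "\<dots> = dot n z x" by (simp add: dot_def z_def mult.commute)
    finally show ?thesis .
  qed
  moreover have "z \<in> Zn n" using int by (auto simp: z_def e_def)
  ultimately show ?thesis using that by blast
qed

text \<open>
  The dual norm of the gauge at an integer vector \<open>z\<close> is the width of \<open>K\<close> along \<open>z\<close>, so the
  hypothesis bounds all nonzero dual vectors from below, and \<open>flatness\<close> bounds the covering radius
  by \<open>\<delta>\<close>.
\<close>

lemma difference_body_covers:
  assumes n: "1 \<le> n" and \<delta>: "0 < \<delta>" and width: "2 ^ (n - 1) < \<delta> * lattice_width n K"
  obtains a b where "a \<in> K" "b \<in> K" "\<And>i. i < n \<Longrightarrow> x i - \<delta> * (a i - b i) \<in> \<int>"
proof -
  let ?N = "diff_gauge n K"
  define L :: "(nat \<Rightarrow> real) set" where "L = {v. \<forall>i<n. v i \<in> \<int>}"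
  define w where "w = 2 ^ (n - 1) / \<delta>"
  have w: "0 < w" "w < lattice_width n K" using width \<delta> by (simp_all add: w_def pos_divide_less_eq mult.commute)
  define e where "e i = (\<lambda>j. if j = i then 1 else 0 :: real)" for i :: nat
  obtain B where B: "B > 0" "\<forall>x\<in>K. \<forall>i<m. \<bar>x i\<bar> \<le> B" by (rule convex_body_bounded[OF K])
  have N: "seminorm ?N" by (rule seminorm_diff_gauge)
  have L: "subtraction_closed L" by (auto simp: subtraction_closed_def L_def)
  have disc: "discrete_modulo ?N L"
    unfolding discrete_modulo_def
  proof
    fix R
    let ?F = "{..<n} \<rightarrow>\<^sub>E {a \<in> \<int>. \<bar>a::real\<bar> \<le> R * (2 * B)}"
    have "finite ?F" by (intro finite_PiE finite_abs_int_segment) auto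
    moreover have "?F \<subseteq> L" by (auto simp: L_def PiE_iff)
    moreover have "\<exists>f\<in>?F. ?N (v - f) = 0" if v: "v \<in> L" "?N v \<le> R" for v
    proof
      have "\<bar>v i\<bar> \<le> R * (2 * B)" if "i < n" for i
        using diff_gauge_bound[OF B that, of v] mult_right_mono[OF v(2), of "2 * B"] B(1) by linarith
      then show "restrict v {..<n} \<in> ?F" using v(1) by (auto simp: L_def)
      show "?N (v - restrict v {..<n}) = 0" by (rule diff_gauge_null) simp
    qed
    ultimately show "\<exists>F. finite F \<and> F \<subseteq> L \<and> (\<forall>v\<in>L. ?N v \<le> R \<longrightarrow> (\<exists>f\<in>F. ?N (v - f) = 0))"
      by blast
  qed
  have span: "spans_modulo ?N (e ` {..<n})"
    unfolding spans_modulo_def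
  proof
    fix x :: "nat \<Rightarrow> real"
    have "?N (x - (\<Sum>i<n. x i *\<^sub>R e i)) = 0"
    proof (rule diff_gauge_null)
      fix i assume "i < n"
      have "(\<Sum>j<n. x j *\<^sub>R e j) i = (\<Sum>j<n. if j = i then x j else 0)"
        unfolding sum_fun_apply by (rule sum.cong) (auto simp: e_def)
      then show "(x - (\<Sum>j<n. x j *\<^sub>R e j)) i = 0" using \<open>i < n\<close> by simp
    qed
    moreover have "(\<Sum>i<n. x i *\<^sub>R e i) \<in> span (e ` {..<n})"
      by (intro span_sum span_scale span_base) auto
    ultimately show "\<exists>y\<in>span (e ` {..<n}). ?N (x - y) = 0" by blast
  qed
  have "inj_on e {..<n}"
  proof (rule inj_onI)
    fix i j assume "e i = e j"
    from fun_cong[OF this, of i] show "i = j" by (simp add: e_def split: if_splits)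
  qed
  then have card: "card (e ` {..<n}) = n" by (simp add: card_image)
  have dual: "dual_large ?N L w"
    unfolding dual_large_def
  proof (intro allI impI, elim conjE)
    fix \<phi> :: "(nat \<Rightarrow> real) \<Rightarrow> real"
    assume \<phi>: "linear \<phi>" "\<forall>v\<in>L. \<phi> v \<in> \<int>" "\<phi> \<noteq> (\<lambda>_. 0)"
    obtain z where z: "z \<in> Zn n" "\<And>x. \<phi> x = dot n z x"
      using linear_integral_on_lattice[OF \<phi>(1)] \<phi>(2) unfolding L_def by blast
    have "z \<noteq> (\<lambda>i\<in>{..<n}. 0)"
    proof
      assume "z = (\<lambda>i\<in>{..<n}. 0)"
      then have "\<phi> = (\<lambda>_. 0)" by (simp add: fun_eq_iff z(2) dot_def)
      then show False using \<phi>(3) by simp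
    qed
    then have "lattice_width n K \<le> (SUP x\<in>K. dot n z x) - (INF x\<in>K. dot n z x)"
      using lattice_width_attained(2)[OF K nm n] z(1) by blast
    moreover obtain a where a: "a \<in> K" "dot n z a = (SUP x\<in>K. dot n z x)"
      using convex_body_dot_attained(1)[OF K nm] by blast
    moreover obtain b where b: "b \<in> K" "dot n z b = (INF x\<in>K. dot n z x)"
      using convex_body_dot_attained(2)[OF K nm] by blast
    ultimately have "w < dot n z a - dot n z b" using w(2) by linarith
    also have "\<dots> = \<phi> (a - b)" using linear_diff[OF \<phi>(1), of a b] by (simp only: z(2))
    also have "\<dots> \<le> \<bar>\<phi> (a - b)\<bar>" by simp
    finally have "w < \<bar>\<phi> (a - b)\<bar>" .
    moreover have "?N (a - b) \<le> 1" using a(1) b(1) by (intro diff_gauge_le[of _ a b]) auto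
    then have "w * ?N (a - b) \<le> w * 1" using w(1) by (intro mult_left_mono) auto
    ultimately show "\<exists>x. w * ?N x < \<bar>\<phi> x\<bar>" by (intro exI[of _ "a - b"]) linarith
  qed
  have "\<forall>x. \<exists>p\<in>L. 2 * w * ?N (x - p) < 2 ^ n"
    by (rule conjunct1[OF flatness[OF N L disc span _ _ card dual w(1)]])
      (auto simp: L_def e_def)
  then obtain p where p: "p \<in> L" "2 * w * ?N (x - p) < 2 ^ n" by blast
  have "(2::real) ^ n = 2 * 2 ^ (n - 1)" using n by (cases n) auto
  then have "w * ?N (x - p) < w * \<delta>" using p(2) \<delta> by (simp add: w_def)
  then have "?N (x - p) < \<delta>" using w(1) by simp
  then obtain r a b where r: "0 \<le> r" "r < \<delta>" "a \<in> K" "b \<in> K" "\<forall>i<n. (x - p) i = r * (a i - b i)"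
    by (rule diff_gauge_lessE)
  \<comment> \<open>Stretch the shorter difference \<open>r * (a - b)\<close> to \<open>\<delta>\<close> times a difference of two points.\<close>
  define a' where "a' = (\<lambda>i\<in>{..<m}. (1 - r / \<delta>) * b i + r / \<delta> * a i)"
  have "a' \<in> K" unfolding a'_def using r \<delta> by (intro convex_body_convex[OF K]) auto
  moreover have "x i - \<delta> * (a' i - b i) \<in> \<int>" if i: "i < n" for i
  proof -
    have "\<delta> * (a' i - b i) = r * (a i - b i)" using i nm \<delta> by (simp add: a'_def field_simps)
    moreover have "(x - p) i = r * (a i - b i)" using r(5) i by blast
    ultimately have "x i - \<delta> * (a' i - b i) = p i" by simp
    then show ?thesis using p(1) i by (simp add: L_def)
  qed
  ultimately show ?thesis using that r(4) by blast
qed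

end

section \<open>The Prekopa-Leindler inequality\<close>

lemma (in sigma_finite_measure) layer_cake:
  fixes f :: "'a \<Rightarrow> real"
  assumes f[measurable]: "f \<in> borel_measurable M" and nn: "\<And>x. x \<in> space M \<Longrightarrow> 0 \<le> f x"
  shows "(\<integral>\<^sup>+x. ennreal (f x) \<partial>M) = (\<integral>\<^sup>+t. emeasure M {x\<in>space M. t < f x} * indicator {0<..} t \<partial>lborel)"
    and "(\<lambda>t. emeasure M {x\<in>space M. t < f x}) \<in> borel_measurable borel"
proof -
  note sf = sigma_finite_measure_axioms
  interpret pair_sigma_finite M lborel by standard
  let ?I = "\<lambda>x t. indicator {0<..} t * (if t < f x then 1 else 0 :: ennreal)"
  have "(\<integral>\<^sup>+x. ennreal (f x) \<partial>M) = (\<integral>\<^sup>+x. \<integral>\<^sup>+t. ?I x t \<partial>lborel \<partial>M)"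
  proof (rule nn_integral_cong)
    fix x assume "x \<in> space M"
    have "ennreal (f x) = emeasure lborel {0<..<f x}" using nn[OF \<open>x \<in> space M\<close>] by simp
    also have "\<dots> = (\<integral>\<^sup>+t. indicator {0<..<f x} t \<partial>lborel)" by simp
    also have "\<dots> = (\<integral>\<^sup>+t. ?I x t \<partial>lborel)" by (rule nn_integral_cong) (auto split: split_indicator)
    finally show "ennreal (f x) = \<dots>" .
  qed
  also have "\<dots> = (\<integral>\<^sup>+t. \<integral>\<^sup>+x. ?I x t \<partial>M \<partial>lborel)"
    by (rule Fubini'[symmetric]) measurable
  also have "\<dots> = (\<integral>\<^sup>+t. emeasure M {x\<in>space M. t < f x} * indicator {0<..} t \<partial>lborel)"
  proof (rule nn_integral_cong)
    fix t :: real
    have "(\<integral>\<^sup>+x. ?I x t \<partial>M) = (\<integral>\<^sup>+x. indicator {0<..} t * indicator {x\<in>space M. t < f x} x \<partial>M)"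
      by (rule nn_integral_cong) (auto split: split_indicator)
    also have "\<dots> = indicator {0<..} t * emeasure M {x\<in>space M. t < f x}"
      by (subst nn_integral_cmult) auto
    finally show "(\<integral>\<^sup>+x. ?I x t \<partial>M) = emeasure M {x\<in>space M. t < f x} * indicator {0<..} t"
      by (simp add: mult.commute)
  qed
  finally show "(\<integral>\<^sup>+x. ennreal (f x) \<partial>M) = \<dots>" .
  have Q: "{p \<in> space (borel \<Otimes>\<^sub>M M). fst p < f (snd p)} \<in> sets (borel \<Otimes>\<^sub>M M)"
    by measurable
  have "Pair t -` {p \<in> space (borel \<Otimes>\<^sub>M M). fst p < f (snd p)} = {x\<in>space M. t < f x}" for t :: real
    by (auto simp: space_pair_measure)
  then show "(\<lambda>t. emeasure M {x\<in>space M. t < f x}) \<in> borel_measurable borel"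
    using sigma_finite_measure.measurable_emeasure_Pair[OF sf Q] by simp
qed

lemma emeasure_lborel_affine_preimage:
  fixes A :: "real set" and c v :: real
  assumes A[measurable]: "A \<in> sets borel" and c: "c > 0"
  shows "emeasure lborel {x. (x - v) / c \<in> A} = ennreal c * emeasure lborel A"
proof -
  have "{x. (x - v) / c \<in> A} = (\<lambda>x. (x - v) / c) -` A \<inter> space borel" by auto
  also have "\<dots> \<in> sets borel" by measurable
  finally have [measurable]: "{x. (x - v) / c \<in> A} \<in> sets borel" .
  have "emeasure lborel {x. (x - v) / c \<in> A} = (\<integral>\<^sup>+x. indicator {x. (x - v) / c \<in> A} x \<partial>lborel)"
    by simp
  also have "\<dots> = \<bar>c\<bar> * (\<integral>\<^sup>+x. indicator {x. (x - v) / c \<in> A} (v + c * x) \<partial>lborel)"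
    using c by (intro nn_integral_real_affine) auto
  also have "(\<integral>\<^sup>+x. indicator {x. (x - v) / c \<in> A} (v + c * x) \<partial>lborel) = (\<integral>\<^sup>+x. indicator A x \<partial>lborel)"
    using c by (intro nn_integral_cong) (auto split: split_indicator)
  finally show ?thesis using c by simp
qed

text \<open>
  Shift \<open>A\<close> by the least point of \<open>B\<close> and \<open>B\<close> by the greatest point of \<open>A\<close>: the two scaled copies lie
  in \<open>C\<close> and meet in at most the point \<open>c\<close>.
\<close>

lemma brunn_minkowski_line_compact:
  fixes A B C :: "real set"
  assumes A: "compact A" "A \<noteq> {}" and B: "compact B" "B \<noteq> {}" and C: "C \<in> sets borel"
    and l: "0 < l" "l < 1"
    and sub: "\<And>x y. x \<in> A \<Longrightarrow> y \<in> B \<Longrightarrow> (1 - l) * x + l * y \<in> C"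
  shows "ennreal (1 - l) * emeasure lborel A + ennreal l * emeasure lborel B \<le> emeasure lborel C"
proof -
  obtain a where a: "a \<in> A" "\<And>x. x \<in> A \<Longrightarrow> x \<le> a" using compact_attains_sup[OF A] by blast
  obtain b where b: "b \<in> B" "\<And>y. y \<in> B \<Longrightarrow> b \<le> y" using compact_attains_inf[OF B] by blast
  have bor[measurable]: "A \<in> sets borel" "B \<in> sets borel"
    using A(1) B(1) by (auto intro: borel_closed compact_imp_closed)
  define c where "c = (1 - l) * a + l * b"
  define A' where "A' = {x. (x - l * b) / (1 - l) \<in> A}"
  define B' where "B' = {x. (x - (1 - l) * a) / l \<in> B}"
  have [measurable]: "A' \<in> sets borel" "B' \<in> sets borel"
  proof -
    have "A' = (\<lambda>x. (x - l * b) / (1 - l)) -` A \<inter> space borel" by (auto simp: A'_def)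
    also have "\<dots> \<in> sets borel" by measurable
    finally show "A' \<in> sets borel" .
    have "B' = (\<lambda>x. (x - (1 - l) * a) / l) -` B \<inter> space borel" by (auto simp: B'_def)
    also have "\<dots> \<in> sets borel" by measurable
    finally show "B' \<in> sets borel" .
  qed
  have A': "x \<in> C \<and> x \<le> c" if x: "x \<in> A'" for x
  proof -
    define y where "y = (x - l * b) / (1 - l)"
    have y: "y \<in> A" "x = (1 - l) * y + l * b" using x l by (auto simp: A'_def y_def)
    have "(1 - l) * y \<le> (1 - l) * a" using a(2)[OF y(1)] l by (intro mult_left_mono) auto
    then show ?thesis using sub[OF y(1) b(1)] y(2) by (simp add: c_def)
  qed
  have B': "x \<in> C \<and> c \<le> x" if x: "x \<in> B'" for x
  proof -
    define y where "y = (x - (1 - l) * a) / l"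
    have y: "y \<in> B" "x = (1 - l) * a + l * y" using x l by (auto simp: B'_def y_def)
    have "l * b \<le> l * y" using b(2)[OF y(1)] l by (intro mult_left_mono) auto
    then show ?thesis using sub[OF a(1) y(1)] y(2) by (simp add: c_def)
  qed
  have "ennreal (1 - l) * emeasure lborel A + ennreal l * emeasure lborel B =
      emeasure lborel A' + emeasure lborel B'"
    using l by (simp add: A'_def B'_def emeasure_lborel_affine_preimage)
  also have "emeasure lborel A' = emeasure lborel (A' - {c})"
    by (rule emeasure_Diff_null_set[symmetric]) auto
  also have "emeasure lborel (A' - {c}) + emeasure lborel B' = emeasure lborel ((A' - {c}) \<union> B')"
    using A' B' by (intro plus_emeasure) (auto simp: not_less intro: order_antisym)
  also have "\<dots> \<le> emeasure lborel C"
    using A' B' C by (intro emeasure_mono) auto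
  finally show ?thesis .
qed

lemma inner_compact_approx:
  fixes A :: "real set"
  assumes A: "A \<in> sets borel" "bounded A" "A \<noteq> {}" and e: "e > 0"
  obtains T where "compact T" "T \<noteq> {}" "T \<subseteq> A" "emeasure lborel A \<le> emeasure lborel T + ennreal e"
proof -
  have "A \<in> sets lebesgue" using A(1) by simp
  then obtain T where T: "closed T" "T \<subseteq> A" "emeasure lebesgue (A - T) < ennreal e"
    using e by (rule sets_lebesgue_inner_closed)
  obtain x where x: "x \<in> A" using A(3) by blast
  have Tc: "compact (insert x T)"
    using T A(2) by (intro compact_insert) (simp add: compact_eq_bounded_closed bounded_subset)
  then have [measurable]: "insert x T \<in> sets borel" by (intro borel_closed compact_imp_closed)
  have [measurable]: "T \<in> sets borel" by (rule borel_closed[OF T(1)])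
  have "emeasure lborel A \<le> emeasure lborel (insert x T \<union> (A - T))"
    using A(1) by (intro emeasure_mono) auto
  also have "\<dots> \<le> emeasure lborel (insert x T) + emeasure lborel (A - T)"
    using A(1) by (intro emeasure_subadditive) auto
  also have "emeasure lborel (A - T) = emeasure lebesgue (A - T)"
    using A(1) by simp
  also have "emeasure lborel (insert x T) + emeasure lebesgue (A - T) \<le> emeasure lborel (insert x T) + ennreal e"
    using T(3) by (intro add_left_mono) simp
  finally show ?thesis using that[OF Tc] T(2) x by simp
qed

lemma brunn_minkowski_line:
  fixes A B C :: "real set"
  assumes A: "A \<in> sets borel" "bounded A" "A \<noteq> {}" and B: "B \<in> sets borel" "bounded B" "B \<noteq> {}"
    and C: "C \<in> sets borel" and l: "0 < l" "l < 1"
    and sub: "\<And>x y. x \<in> A \<Longrightarrow> y \<in> B \<Longrightarrow> (1 - l) * x + l * y \<in> C"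
  shows "ennreal (1 - l) * emeasure lborel A + ennreal l * emeasure lborel B \<le> emeasure lborel C"
proof (rule ennreal_le_epsilon)
  fix e :: real assume e: "e > 0"
  obtain S where S: "compact S" "S \<noteq> {}" "S \<subseteq> A" "emeasure lborel A \<le> emeasure lborel S + ennreal e"
    by (rule inner_compact_approx[OF A e])
  obtain T where T: "compact T" "T \<noteq> {}" "T \<subseteq> B" "emeasure lborel B \<le> emeasure lborel T + ennreal e"
    by (rule inner_compact_approx[OF B e])
  have "ennreal (1 - l) * emeasure lborel A + ennreal l * emeasure lborel B \<le>
      ennreal (1 - l) * (emeasure lborel S + ennreal e) + ennreal l * (emeasure lborel T + ennreal e)"
    using S(4) T(4) by (intro add_mono mult_left_mono) auto
  also have "\<dots> = (ennreal (1 - l) * emeasure lborel S + ennreal l * emeasure lborel T) +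
      (ennreal (1 - l) * ennreal e + ennreal l * ennreal e)"
    by (simp add: distrib_left ac_simps)
  also have "ennreal (1 - l) * ennreal e + ennreal l * ennreal e = ennreal e"
    using l e by (simp flip: ennreal_mult ennreal_plus add: algebra_simps)
  also have "ennreal (1 - l) * emeasure lborel S + ennreal l * emeasure lborel T \<le> emeasure lborel C"
    using S T by (intro brunn_minkowski_line_compact C l sub) auto
  finally show "ennreal (1 - l) * emeasure lborel A + ennreal l * emeasure lborel B \<le> emeasure lborel C + ennreal e"
    by simp
qed

lemma nn_integral_layers_scaled:
  fixes f :: "real \<Rightarrow> real"
  assumes f[measurable]: "f \<in> borel_measurable borel" and nn: "\<And>x. 0 \<le> f x" and a: "a > 0"
  shows "(\<integral>\<^sup>+x. ennreal (f x) \<partial>lborel) =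
    ennreal a * (\<integral>\<^sup>+t. emeasure lborel {x. t * a < f x} * indicator {0<..} t \<partial>lborel)"
    and "(\<lambda>t. emeasure lborel {x. t * a < f x}) \<in> borel_measurable borel"
proof -
  have eq: "{x \<in> space lborel. t < f x / a} = {x. t * a < f x}" for t
    using a by (auto simp: pos_less_divide_eq)
  have "(\<integral>\<^sup>+x. ennreal (f x) \<partial>lborel) = (\<integral>\<^sup>+x. ennreal a * ennreal (f x / a) \<partial>lborel)"
    using a nn by (intro nn_integral_cong) (simp flip: ennreal_mult)
  also have "\<dots> = ennreal a * (\<integral>\<^sup>+x. ennreal (f x / a) \<partial>lborel)" by (rule nn_integral_cmult) simp
  also have "(\<integral>\<^sup>+x. ennreal (f x / a) \<partial>lborel) =
      (\<integral>\<^sup>+t. emeasure lborel {x. t * a < f x} * indicator {0<..} t \<partial>lborel)"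
    using lborel.layer_cake(1)[of "\<lambda>x. f x / a"] a nn unfolding eq by simp
  finally show "(\<integral>\<^sup>+x. ennreal (f x) \<partial>lborel) = ennreal a * \<dots>" .
  show "(\<lambda>t. emeasure lborel {x. t * a < f x}) \<in> borel_measurable borel"
    using lborel.layer_cake(2)[of "\<lambda>x. f x / a"] a nn unfolding eq by simp
qed

lemma powr_weighted_am_gm:
  fixes a b :: real
  assumes "0 < l" "l < 1" "0 \<le> a" "0 \<le> b"
  shows "a powr (1 - l) * b powr l \<le> (1 - l) * a + l * b"
proof (cases "a = 0 \<or> b = 0")
  case True
  then show ?thesis using assms by auto
next
  case False
  then show ?thesis using assms Youngs_inequality_0[of "1 - l" l a b] by simp
qed

text \<open>
  Rescaled to supremum one, the superlevel sets of \<open>f\<close> and \<open>g\<close> at a common level below one are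
  nonempty, and their combination lies in a superlevel set of \<open>h\<close>. The one-dimensional
  Brunn-Minkowski inequality, integrated over all levels, bounds the integral of \<open>h\<close> by an
  arithmetic mean, which dominates the geometric mean.
\<close>

lemma prekopa_leindler_line:
  fixes f g h :: "real \<Rightarrow> real"
  assumes [measurable]: "f \<in> borel_measurable borel" "g \<in> borel_measurable borel" "h \<in> borel_measurable borel"
    and f: "\<And>x. 0 \<le> f x" "\<And>x. f x \<le> M" "\<And>x. R < \<bar>x\<bar> \<Longrightarrow> f x = 0"
    and g: "\<And>x. 0 \<le> g x" "\<And>x. g x \<le> M" "\<And>x. R < \<bar>x\<bar> \<Longrightarrow> g x = 0"
    and h: "\<And>x. 0 \<le> h x" and l: "0 < l" "l < 1"
    and fgh: "\<And>x y. f x powr (1 - l) * g y powr l \<le> h ((1 - l) * x + l * y)"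
    and fin: "(\<integral>\<^sup>+x. ennreal (f x) \<partial>lborel) = ennreal I" "(\<integral>\<^sup>+x. ennreal (g x) \<partial>lborel) = ennreal J"
      "0 \<le> I" "0 \<le> J"
  shows "ennreal (I powr (1 - l) * J powr l) \<le> (\<integral>\<^sup>+x. ennreal (h x) \<partial>lborel)"
proof (cases "I = 0 \<or> J = 0")
  case True
  then show ?thesis by auto
next
  case False
  have ba: "bdd_above (range f)" "bdd_above (range g)"
    using f(2) g(2) by (auto intro!: bdd_aboveI[of _ M])
  define a where "a = (SUP x. f x)"
  define b where "b = (SUP x. g x)"
  have fa: "f x \<le> a" and gb: "g x \<le> b" for x
    unfolding a_def b_def using ba by (auto intro: cSUP_upper)
  have "a > 0"
  proof (rule ccontr)
    assume "\<not> a > 0"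
    then have "f x = 0" for x using fa[of x] f(1)[of x] by linarith
    then show False using fin(1,3) False by simp
  qed
  have "b > 0"
  proof (rule ccontr)
    assume "\<not> b > 0"
    then have "g x = 0" for x using gb[of x] g(1)[of x] by linarith
    then show False using fin(2,4) False by simp
  qed
  define k where "k = a powr (1 - l) * b powr l"
  have k: "k > 0" using \<open>a > 0\<close> \<open>b > 0\<close> by (simp add: k_def)
  let ?A = "\<lambda>t. {x. t * a < f x}" and ?B = "\<lambda>t. {x. t * b < g x}" and ?C = "\<lambda>t. {x. t * k < h x}"
  let ?\<alpha> = "\<integral>\<^sup>+t. emeasure lborel (?A t) * indicator {0<..} t \<partial>lborel"
  let ?\<beta> = "\<integral>\<^sup>+t. emeasure lborel (?B t) * indicator {0<..} t \<partial>lborel"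
  let ?\<gamma> = "\<integral>\<^sup>+t. emeasure lborel (?C t) * indicator {0<..} t \<partial>lborel"
  note LA = nn_integral_layers_scaled[of f a, OF _ f(1) \<open>a > 0\<close>]
  note LB = nn_integral_layers_scaled[of g b, OF _ g(1) \<open>b > 0\<close>]
  note LC = nn_integral_layers_scaled[of h k, OF _ h k]
  have [measurable]: "(\<lambda>t. emeasure lborel (?A t)) \<in> borel_measurable borel"
    "(\<lambda>t. emeasure lborel (?B t)) \<in> borel_measurable borel"
    by (intro LA(2) LB(2), measurable)+
  have bm: "ennreal (1 - l) * emeasure lborel (?A t) + ennreal l * emeasure lborel (?B t) \<le> emeasure lborel (?C t)"
    if t: "0 < t" "t < 1" for t
  proof (rule brunn_minkowski_line)
    have bd: "bounded S" if "\<And>x. x \<in> S \<Longrightarrow> \<bar>x\<bar> \<le> R" for S :: "real set"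
      using that by (auto simp: bounded_iff)
    have pos: "0 < t * a" "0 < t * b" using t \<open>a > 0\<close> \<open>b > 0\<close> by simp_all
    show "bounded (?A t)" using f(3) pos by (intro bd) (force simp: not_less[symmetric])
    show "bounded (?B t)" using g(3) pos by (intro bd) (force simp: not_less[symmetric])
    have "t * a < a" "t * b < b" using t \<open>a > 0\<close> \<open>b > 0\<close> by simp_all
    then show "?A t \<noteq> {}" "?B t \<noteq> {}"
      unfolding a_def b_def using less_cSUP_iff[OF _ ba(1)] less_cSUP_iff[OF _ ba(2)] by auto
    fix x y assume xy: "x \<in> ?A t" "y \<in> ?B t"
    have "t * k = (t powr (1 - l) * t powr l) * k" using t by (simp flip: powr_add)
    also have "\<dots> = (t * a) powr (1 - l) * (t * b) powr l"
      using t \<open>a > 0\<close> \<open>b > 0\<close> by (simp add: k_def powr_mult)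
    also have "\<dots> < f x powr (1 - l) * g y powr l"
      using xy l pos by (intro mult_strict_mono powr_less_mono2) auto
    also have "\<dots> \<le> h ((1 - l) * x + l * y)" by (rule fgh)
    finally show "(1 - l) * x + l * y \<in> ?C t" by simp
  qed (use l in measurable)
  have empty: "?A t = {}" "?B t = {}" if "1 \<le> t" for t
  proof -
    have "a \<le> t * a" "b \<le> t * b" using that \<open>a > 0\<close> \<open>b > 0\<close> by simp_all
    then show "?A t = {}" "?B t = {}" using fa gb by (auto simp: not_less intro: order_trans)
  qed
  have "ennreal (1 - l) * ?\<alpha> + ennreal l * ?\<beta> =
      (\<integral>\<^sup>+t. ennreal (1 - l) * (emeasure lborel (?A t) * indicator {0<..} t) +
        ennreal l * (emeasure lborel (?B t) * indicator {0<..} t) \<partial>lborel)"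
    by (subst nn_integral_add) (simp_all add: nn_integral_cmult)
  also have "\<dots> \<le> ?\<gamma>"
  proof (rule nn_integral_mono)
    fix t :: real
    show "ennreal (1 - l) * (emeasure lborel (?A t) * indicator {0<..} t) +
        ennreal l * (emeasure lborel (?B t) * indicator {0<..} t) \<le> emeasure lborel (?C t) * indicator {0<..} t"
    proof (cases "1 \<le> t")
      case True
      then show ?thesis by (simp only: empty) simp
    next
      case False
      then show ?thesis using bm[of t] by (auto split: split_indicator)
    qed
  qed
  finally have main: "ennreal (1 - l) * ?\<alpha> + ennreal l * ?\<beta> \<le> ?\<gamma>" .
  have \<alpha>: "?\<alpha> = ennreal (I / a)"
  proof -
    have eq: "ennreal I = ennreal a * ?\<alpha>" using LA(1) fin(1) by simp
    have "ennreal (I / a) = ennreal (1 / a) * ennreal I"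
      using fin(3) \<open>a > 0\<close> by (simp flip: ennreal_mult)
    also have "\<dots> = ennreal (1 / a) * (ennreal a * ?\<alpha>)" unfolding eq ..
    also have "\<dots> = ?\<alpha>" using \<open>a > 0\<close> by (simp flip: ennreal_mult mult.assoc)
    finally show ?thesis by simp
  qed
  have \<beta>: "?\<beta> = ennreal (J / b)"
  proof -
    have eq: "ennreal J = ennreal b * ?\<beta>" using LB(1) fin(2) by simp
    have "ennreal (J / b) = ennreal (1 / b) * ennreal J"
      using fin(4) \<open>b > 0\<close> by (simp flip: ennreal_mult)
    also have "\<dots> = ennreal (1 / b) * (ennreal b * ?\<beta>)" unfolding eq ..
    also have "\<dots> = ?\<beta>" using \<open>b > 0\<close> by (simp flip: ennreal_mult mult.assoc)
    finally show ?thesis by simp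
  qed
  have "I powr (1 - l) * J powr l = k * ((I / a) powr (1 - l) * (J / b) powr l)"
    using \<open>a > 0\<close> \<open>b > 0\<close> fin(3,4) by (simp add: k_def powr_divide)
  also have "\<dots> \<le> k * ((1 - l) * (I / a) + l * (J / b))"
    using k l fin(3,4) \<open>a > 0\<close> \<open>b > 0\<close> by (intro mult_left_mono powr_weighted_am_gm) auto
  finally have "ennreal (I powr (1 - l) * J powr l) \<le> ennreal (k * ((1 - l) * (I / a) + l * (J / b)))"
    by (rule ennreal_leI)
  also have "\<dots> = ennreal k * (ennreal (1 - l) * ?\<alpha> + ennreal l * ?\<beta>)"
    unfolding \<alpha> \<beta> using k l fin(3,4) \<open>a > 0\<close> \<open>b > 0\<close>
    by (simp flip: ennreal_mult ennreal_plus)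
  also have "\<dots> \<le> ennreal k * ?\<gamma>" by (intro mult_left_mono main) simp
  also have "\<dots> = (\<integral>\<^sup>+x. ennreal (h x) \<partial>lborel)" using LC(1) by simp
  finally show ?thesis .
qed


text \<open>
  Integrating out the last coordinate preserves the hypothesis, by the one-dimensional case.
  Boundedness and bounded support keep all partial integrals finite, so that they are again
  real-valued functions of the same kind.
\<close>

lemma prekopa_leindler:
  fixes f g h :: "(nat \<Rightarrow> real) \<Rightarrow> real"
  assumes "f \<in> borel_measurable (\<Pi>\<^sub>M i\<in>{..<m}. lborel)" "g \<in> borel_measurable (\<Pi>\<^sub>M i\<in>{..<m}. lborel)"
      "h \<in> borel_measurable (\<Pi>\<^sub>M i\<in>{..<m}. lborel)"
    and "\<And>x. 0 \<le> f x \<and> f x \<le> M" "\<And>x. x \<in> Rn m \<Longrightarrow> (\<exists>i<m. R < \<bar>x i\<bar>) \<Longrightarrow> f x = 0"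
    and "\<And>x. 0 \<le> g x \<and> g x \<le> M" "\<And>x. x \<in> Rn m \<Longrightarrow> (\<exists>i<m. R < \<bar>x i\<bar>) \<Longrightarrow> g x = 0"
    and "\<And>x. 0 \<le> h x \<and> h x \<le> M" "\<And>x. x \<in> Rn m \<Longrightarrow> (\<exists>i<m. R < \<bar>x i\<bar>) \<Longrightarrow> h x = 0"
    and l: "0 < l" "l < 1" and R: "0 \<le> R"
    and "\<And>x y. x \<in> Rn m \<Longrightarrow> y \<in> Rn m \<Longrightarrow>
      f x powr (1 - l) * g y powr l \<le> h (\<lambda>i\<in>{..<m}. (1 - l) * x i + l * y i)"
  shows "ennreal (enn2real (\<integral>\<^sup>+x. ennreal (f x) \<partial>(\<Pi>\<^sub>M i\<in>{..<m}. lborel)) powr (1 - l) *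
      enn2real (\<integral>\<^sup>+x. ennreal (g x) \<partial>(\<Pi>\<^sub>M i\<in>{..<m}. lborel)) powr l) \<le>
    (\<integral>\<^sup>+x. ennreal (h x) \<partial>(\<Pi>\<^sub>M i\<in>{..<m}. lborel))"
  using assms(1-9,13)
proof (induction m arbitrary: f g h M)
  case 0
  have "f (\<lambda>_. undefined) powr (1 - l) * g (\<lambda>_. undefined) powr l \<le> h (\<lambda>i\<in>{}. (1 - l) * undefined + l * undefined)"
    using 0(10)[of "\<lambda>_. undefined" "\<lambda>_. undefined"] by (simp add: restrict_def)
  then show ?case
    using 0(4,6,8) by (simp add: PiM_empty nn_integral_count_space_finite restrict_def ennreal_leI)
next
  case (Suc m)
  interpret product_sigma_finite "\<lambda>_::nat. lborel :: real measure" by standard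
  let ?P = "\<Pi>\<^sub>M i\<in>{..<m}. (lborel :: real measure)"
  have ins: "{..<Suc m} = insert m {..<m}" by auto
  define sec where "sec u x = (\<integral>\<^sup>+r. ennreal (u (x(m := r))) \<partial>lborel)" for u :: "(nat \<Rightarrow> real) \<Rightarrow> real" and x
  have upd: "x(m := r) \<in> Rn (Suc m)" if "x \<in> Rn m" for x and r :: real
    using that by (auto simp: PiE_def extensional_def)
  have meas1: "(\<lambda>r. u (x(m := r))) \<in> borel_measurable borel"
    if u: "u \<in> borel_measurable (\<Pi>\<^sub>M i\<in>{..<Suc m}. lborel)" and x: "x \<in> Rn m" for u :: "(nat \<Rightarrow> real) \<Rightarrow> real" and x
  proof -
    have "(\<lambda>r. x(m := r)) \<in> lborel \<rightarrow>\<^sub>M (\<Pi>\<^sub>M i\<in>{..<Suc m}. lborel)"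
      unfolding ins by (rule measurable_component_update) (use x in \<open>auto simp: space_PiM\<close>)
    from measurable_compose[OF this u] show ?thesis by simp
  qed
  have meas2: "(\<lambda>x. sec u x) \<in> borel_measurable ?P"
    if u: "u \<in> borel_measurable (\<Pi>\<^sub>M i\<in>{..<Suc m}. lborel)" for u :: "(nat \<Rightarrow> real) \<Rightarrow> real"
  proof -
    have "(\<lambda>(x, r). x(m := r)) \<in> ?P \<Otimes>\<^sub>M lborel \<rightarrow>\<^sub>M (\<Pi>\<^sub>M i\<in>{..<Suc m}. lborel)"
      unfolding ins by (rule measurable_add_dim)
    from measurable_compose[OF this u] have "(\<lambda>p. u ((\<lambda>(x, r). x(m := r)) p)) \<in> borel_measurable (?P \<Otimes>\<^sub>M lborel)" .
    then have [measurable]: "(\<lambda>(x, r). u (x(m := r))) \<in> borel_measurable (?P \<Otimes>\<^sub>M lborel)"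
      by (simp add: case_prod_unfold)
    show ?thesis unfolding sec_def by measurable
  qed
  have fold: "(\<integral>\<^sup>+x. ennreal (u x) \<partial>(\<Pi>\<^sub>M i\<in>{..<Suc m}. lborel)) = (\<integral>\<^sup>+x. sec u x \<partial>?P)"
    if "u \<in> borel_measurable (\<Pi>\<^sub>M i\<in>{..<Suc m}. lborel)" for u
    using that unfolding sec_def ins by (intro product_nn_integral_insert) auto
  define M' where "M' = M * (2 * R)"
  have sec: "sec u x = ennreal (enn2real (sec u x))" "enn2real (sec u x) \<le> M'"
    "(\<exists>i<m. R < \<bar>x i\<bar>) \<Longrightarrow> sec u x = 0"
    if u: "\<forall>x. 0 \<le> u x \<and> u x \<le> M" "\<forall>x\<in>Rn (Suc m). (\<exists>i<Suc m. R < \<bar>x i\<bar>) \<longrightarrow> u x = 0"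
      and x: "x \<in> Rn m" for u :: "(nat \<Rightarrow> real) \<Rightarrow> real" and x
  proof -
    have "sec u x \<le> (\<integral>\<^sup>+r. ennreal M * indicator {-R..R} r \<partial>lborel)"
      unfolding sec_def
    proof (rule nn_integral_mono)
      fix r
      have "u (x(m := r)) = 0" if "r \<notin> {-R..R}" using that by (intro u(2)[rule_format] upd x exI[of _ m]) auto
      then show "ennreal (u (x(m := r))) \<le> ennreal M * indicator {-R..R} r"
        using u(1)[rule_format, of "x(m := r)"] by (auto split: split_indicator intro: ennreal_leI)
    qed
    also have "\<dots> = ennreal M' "
      using R u(1)[rule_format, of x] by (simp add: nn_integral_cmult M'_def ennreal_mult[symmetric])
    finally have le: "sec u x \<le> ennreal M'" .
    then show "sec u x = ennreal (enn2real (sec u x))"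
      by (metis ennreal_enn2real ennreal_less_top le_less_trans)
    have "0 \<le> M'" unfolding M'_def using R u(1)[rule_format, of x] by auto
    then show "enn2real (sec u x) \<le> M'" using le by (intro enn2real_leI)
    assume "\<exists>i<m. R < \<bar>x i\<bar>"
    then obtain i where i: "i < m" "R < \<bar>x i\<bar>" by blast
    then have "u (x(m := r)) = 0" for r by (intro u(2)[rule_format] upd x exI[of _ i]) auto
    then show "sec u x = 0" unfolding sec_def by simp
  qed
  note prems = Suc.prems
  have supp: "\<forall>x\<in>Rn (Suc m). (\<exists>i<Suc m. R < \<bar>x i\<bar>) \<longrightarrow> f x = 0"
      "\<forall>x\<in>Rn (Suc m). (\<exists>i<Suc m. R < \<bar>x i\<bar>) \<longrightarrow> g x = 0"
      "\<forall>x\<in>Rn (Suc m). (\<exists>i<Suc m. R < \<bar>x i\<bar>) \<longrightarrow> h x = 0"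
    using prems(5,7,9) by blast+
  note sf = sec[OF allI[OF prems(4)] supp(1)] and sg = sec[OF allI[OF prems(6)] supp(2)]
    and sh = sec[OF allI[OF prems(8)] supp(3)]
  let ?F = "\<lambda>x. if x \<in> Rn m then enn2real (sec f x) else 0"
  let ?G = "\<lambda>x. if x \<in> Rn m then enn2real (sec g x) else 0"
  let ?H = "\<lambda>x. if x \<in> Rn m then enn2real (sec h x) else 0"
  have meas3: "(\<lambda>x. if x \<in> Rn m then enn2real (sec u x) else 0) \<in> borel_measurable ?P"
    if "u \<in> borel_measurable (\<Pi>\<^sub>M i\<in>{..<Suc m}. lborel)" for u
  proof -
    have "(\<lambda>x. enn2real (sec u x)) \<in> borel_measurable ?P" using meas2[OF that] by measurable
    then show ?thesis by (rule measurable_cong[THEN iffD1, rotated]) (simp add: space_PiM)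
  qed
  have int: "(\<integral>\<^sup>+x. ennreal (u x) \<partial>(\<Pi>\<^sub>M i\<in>{..<Suc m}. lborel)) =
      (\<integral>\<^sup>+x. ennreal (if x \<in> Rn m then enn2real (sec u x) else 0) \<partial>?P)"
    if "u \<in> borel_measurable (\<Pi>\<^sub>M i\<in>{..<Suc m}. lborel)" "\<And>x. x \<in> Rn m \<Longrightarrow> sec u x = ennreal (enn2real (sec u x))" for u
    unfolding fold[OF that(1)] by (rule nn_integral_cong) (simp add: space_PiM that(2)[symmetric])
  have M': "0 \<le> M'" unfolding M'_def using R prems(4)[of undefined] by auto
  have "ennreal (enn2real (\<integral>\<^sup>+x. ennreal (?F x) \<partial>?P) powr (1 - l) * enn2real (\<integral>\<^sup>+x. ennreal (?G x) \<partial>?P) powr l) \<le>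
    (\<integral>\<^sup>+x. ennreal (?H x) \<partial>?P)"
  proof (rule Suc.IH[where M = M'])
    show "?F \<in> borel_measurable ?P" "?G \<in> borel_measurable ?P" "?H \<in> borel_measurable ?P"
      by (rule meas3[OF prems(1)] meas3[OF prems(2)] meas3[OF prems(3)])+
    show "0 \<le> ?F x \<and> ?F x \<le> M'" "0 \<le> ?G x \<and> ?G x \<le> M'" "0 \<le> ?H x \<and> ?H x \<le> M'" for x
      using sf(2) sg(2) sh(2) M' by auto
    show "?F x = 0" "?G x = 0" "?H x = 0" if "x \<in> Rn m" "\<exists>i<m. R < \<bar>x i\<bar>" for x
      using sf(3)[OF that] sg(3)[OF that] sh(3)[OF that] by simp_all
    fix x y assume xy: "x \<in> Rn m" "y \<in> Rn m"
    let ?z = "\<lambda>i\<in>{..<m}. (1 - l) * x i + l * y i"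
    have z: "?z \<in> Rn m" by simp
    have "ennreal (enn2real (sec f x) powr (1 - l) * enn2real (sec g y) powr l) \<le> (\<integral>\<^sup>+r. ennreal (h (?z(m := r))) \<partial>lborel)"
    proof (rule prekopa_leindler_line)
      show "(\<lambda>r. f (x(m := r))) \<in> borel_measurable borel" "(\<lambda>r. g (y(m := r))) \<in> borel_measurable borel"
        "(\<lambda>r. h (?z(m := r))) \<in> borel_measurable borel"
        by (rule meas1[OF prems(1) xy(1)] meas1[OF prems(2) xy(2)] meas1[OF prems(3) z])+
      show "f (x(m := r)) = 0" if "R < \<bar>r\<bar>" for r
        using that by (intro prems(5) upd xy exI[of _ m]) auto
      show "g (y(m := r)) = 0" if "R < \<bar>r\<bar>" for r
        using that by (intro prems(7) upd xy exI[of _ m]) auto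
      show "(\<integral>\<^sup>+r. ennreal (f (x(m := r))) \<partial>lborel) = ennreal (enn2real (sec f x))"
        using sf(1)[OF xy(1)] unfolding sec_def .
      show "(\<integral>\<^sup>+r. ennreal (g (y(m := r))) \<partial>lborel) = ennreal (enn2real (sec g y))"
        using sg(1)[OF xy(2)] unfolding sec_def .
      fix r s :: real
      have eq: "(\<lambda>i\<in>{..<Suc m}. (1 - l) * (x(m := r)) i + l * (y(m := s)) i) = ?z(m := (1 - l) * r + l * s)"
        by (auto simp: fun_eq_iff)
      show "f (x(m := r)) powr (1 - l) * g (y(m := s)) powr l \<le> h (?z(m := (1 - l) * r + l * s))"
        using prems(10)[OF upd[OF xy(1), of r] upd[OF xy(2), of s]] by (simp only: eq)
    qed (use l prems(4,6,8) in auto)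
    also have "\<dots> = ennreal (enn2real (sec h ?z))" using sh(1)[OF z] unfolding sec_def .
    finally show "?F x powr (1 - l) * ?G y powr l \<le> ?H ?z" using xy by simp
  qed
  moreover have "(\<integral>\<^sup>+x. ennreal (f x) \<partial>(\<Pi>\<^sub>M i\<in>{..<Suc m}. lborel)) = (\<integral>\<^sup>+x. ennreal (?F x) \<partial>?P)"
    by (rule int[OF prems(1)]) (rule sf(1))
  moreover have "(\<integral>\<^sup>+x. ennreal (g x) \<partial>(\<Pi>\<^sub>M i\<in>{..<Suc m}. lborel)) = (\<integral>\<^sup>+x. ennreal (?G x) \<partial>?P)"
    by (rule int[OF prems(2)]) (rule sg(1))
  moreover have "(\<integral>\<^sup>+x. ennreal (h x) \<partial>(\<Pi>\<^sub>M i\<in>{..<Suc m}. lborel)) = (\<integral>\<^sup>+x. ennreal (?H x) \<partial>?P)"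
    by (rule int[OF prems(3)]) (rule sh(1))
  ultimately show ?case by (simp only:)
qed

text \<open>
  The Prekopa-Leindler inequality for indicator functions.
\<close>

lemma brunn_minkowski_multiplicative:
  fixes A B C :: "(nat \<Rightarrow> real) set" and m :: nat
  defines "V \<equiv> \<Pi>\<^sub>M i\<in>{..<m}. (lborel :: real measure)"
  assumes sets: "A \<in> sets V" "B \<in> sets V" "C \<in> sets V"
    and fin: "emeasure V C \<noteq> \<infinity>"
    and bounded: "\<And>x i. x \<in> A \<union> B \<union> C \<Longrightarrow> i < m \<Longrightarrow> \<bar>x i\<bar> \<le> R" and R: "0 \<le> R"
    and l: "0 < l" "l < 1"
    and sub: "\<And>x y. x \<in> A \<Longrightarrow> y \<in> B \<Longrightarrow> (\<lambda>i\<in>{..<m}. (1 - l) * x i + l * y i) \<in> C"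
  shows "measure V A powr (1 - l) * measure V B powr l \<le> measure V C"
proof -
  have e: "(\<integral>\<^sup>+x. ennreal (indicator S x) \<partial>V) = emeasure V S" if "S \<in> sets V" for S
    using that by (simp add: ennreal_indicator)
  have "ennreal (enn2real (\<integral>\<^sup>+x. ennreal (indicator A x) \<partial>V) powr (1 - l) *
      enn2real (\<integral>\<^sup>+x. ennreal (indicator B x) \<partial>V) powr l) \<le> (\<integral>\<^sup>+x. ennreal (indicator C x) \<partial>V)"
    unfolding V_def
  proof (rule prekopa_leindler[where M = 1 and R = R])
    show "indicator A x = (0::real)" "indicator B x = (0::real)" "indicator C x = (0::real)"
      if "x \<in> Rn m" "\<exists>i<m. R < \<bar>x i\<bar>" for x
      using that(2) bounded[of x] by (force simp: indicator_def)+
    show "indicator A x powr (1 - l) * indicator B y powr l \<le>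
      (indicator C (\<lambda>i\<in>{..<m}. (1 - l) * x i + l * y i) :: real)" for x y
      using sub by (auto simp: indicator_def)
  qed (use sets l R in \<open>auto simp: V_def indicator_def\<close>)
  then have "ennreal (measure V A powr (1 - l) * measure V B powr l) \<le> emeasure V C"
    unfolding e[OF sets(1)] e[OF sets(2)] e[OF sets(3)] by (simp add: measure_def)
  then show ?thesis using fin by (simp add: emeasure_eq_ennreal_measure)
qed

section \<open>Log-concave tails at the mean\<close>

text \<open>
  The values \<open>s\<close> with \<open>F s < r\<close> form an up-set. A sequence in it that descends to its
  lower end exhausts the event in question by events of probability \<open>F (q k) < r\<close>.
\<close>

lemma (in prob_space) tail_of_tail:
  fixes X :: "'a \<Rightarrow> real"
  defines "F \<equiv> \<lambda>s. prob {x\<in>space M. s \<le> X x}"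
  assumes X[measurable]: "X \<in> borel_measurable M" and r: "0 < r"
  shows "prob {x\<in>space M. F (X x) < r} \<le> r"
proof (cases "{s. F s < r} = {}")
  case True
  then have "{x\<in>space M. F (X x) < r} = {}" by blast
  then show ?thesis using r by (simp only: measure_empty)
next
  case False
  let ?J = "{s. F s < r}"
  have anti: "F t \<le> F s" if "s \<le> t" for s t
    unfolding F_def using that by (intro finite_measure_mono) auto
  have up: "t \<in> ?J" if "s \<in> ?J" "s \<le> t" for s t
    using anti[OF that(2)] that(1) by simp
  have "\<exists>q::nat \<Rightarrow> real. decseq q \<and> (\<forall>k. q k \<in> ?J) \<and> (\<forall>s\<in>?J. \<exists>k. q k \<le> s)"
  proof (cases "bdd_below ?J")
    case bdd: True
    show ?thesis
    proof (cases "Inf ?J \<in> ?J")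
      case True
      then show ?thesis using cInf_lower[OF _ bdd] by (intro exI[of _ "\<lambda>_. Inf ?J"]) (auto simp: decseq_def)
    next
      case Inf: False
      let ?q = "\<lambda>k. Inf ?J + 1 / real (Suc k)"
      have "decseq ?q" by (auto simp: decseq_def frac_le)
      moreover have "?q k \<in> ?J" for k
      proof -
        have "Inf ?J < ?q k" by simp
        then obtain s where "s \<in> ?J" "s < ?q k"
          unfolding cInf_less_iff[OF False bdd] by blast
        then show ?thesis by (rule up[OF _ less_imp_le])
      qed
      moreover have "\<exists>k. ?q k \<le> s" if s: "s \<in> ?J" for s
      proof -
        have "Inf ?J \<le> s" by (rule cInf_lower[OF s bdd])
        moreover have "Inf ?J \<noteq> s" using Inf s by blast
        ultimately have "0 < s - Inf ?J" by simp
        then obtain k where "inverse (real (Suc k)) < s - Inf ?J" using reals_Archimedean by blast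
        then show ?thesis by (intro exI[of _ k]) (simp add: inverse_eq_divide)
      qed
      ultimately show ?thesis by blast
    qed
  next
    case unb: False
    have "- real k \<in> ?J" for k
    proof -
      have "\<not> (\<forall>s\<in>?J. - real k \<le> s)" using unb unfolding bdd_below_def by blast
      then obtain s where "s \<in> ?J" "s < - real k" by (auto simp: not_le)
      then show ?thesis by (rule up[OF _ less_imp_le])
    qed
    moreover have "\<exists>k. - real k \<le> s" for s
      using real_arch_simple[of "- s"] by (metis minus_le_iff)
    ultimately show ?thesis by (intro exI[of _ "\<lambda>k. - real k"]) (auto simp: decseq_def)
  qed
  then obtain q where q: "decseq q" "\<And>k. q k \<in> ?J" "\<And>s. s \<in> ?J \<Longrightarrow> \<exists>k. q k \<le> s" by blast
  have "(\<lambda>k. prob {x\<in>space M. q k \<le> X x}) \<longlonglongrightarrow> prob (\<Union>k. {x\<in>space M. q k \<le> X x})"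
    using q(1) by (intro finite_Lim_measure_incseq) (auto simp: incseq_def decseq_def intro: order_trans)
  moreover have "(\<Union>k. {x\<in>space M. q k \<le> X x}) = {x\<in>space M. F (X x) < r}"
  proof (intro equalityI subsetI)
    fix x assume "x \<in> (\<Union>k. {x\<in>space M. q k \<le> X x})"
    then obtain k where "x \<in> space M" "q k \<le> X x" by blast
    then show "x \<in> {x\<in>space M. F (X x) < r}" using up[OF q(2)] by blast
  next
    fix x assume "x \<in> {x\<in>space M. F (X x) < r}"
    then show "x \<in> (\<Union>k. {x\<in>space M. q k \<le> X x})" using q(3)[of "X x"] by blast
  qed
  ultimately have "(\<lambda>k. F (q k)) \<longlonglongrightarrow> prob {x\<in>space M. F (X x) < r}" by (simp add: F_def)
  then show ?thesis
    by (rule LIMSEQ_le_const2) (use q(2) in \<open>auto intro!: exI[of _ 0] less_imp_le\<close>)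
qed

lemma nn_integral_exp_tail: "(\<integral>\<^sup>+t. ennreal (exp (- t)) * indicator {0<..} t \<partial>lborel) \<le> 1"
proof -
  have "(\<integral>\<^sup>+t. ennreal (exp (- t)) * indicator {0<..} t \<partial>lborel) \<le>
      (\<integral>\<^sup>+t. ennreal (exp (- t)) * indicator {0..} t \<partial>lborel)"
    by (intro nn_integral_mono) (auto split: split_indicator)
  also have "\<dots> = ennreal (0 - (- exp (- 0)))"
  proof (rule nn_integral_FTC_atLeast)
    show "((\<lambda>t. - exp (- t)) \<longlongrightarrow> (0::real)) at_top"
      using tendsto_minus[OF filterlim_compose[OF exp_at_bot filterlim_uminus_at_bot_at_top]] by simp
    show "((\<lambda>t. - exp (- t)) has_real_derivative exp (- x)) (at x)" for x :: real
      by (auto intro!: derivative_eq_intros)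
  qed auto
  finally show ?thesis by simp
qed

text \<open>
  The slopes of \<open>ln F\<close> to the left of \<open>\<mu>\<close> are bounded by the slopes to its right, so their supremum
  is the slope of a supporting line. A positive value at some \<open>t > \<mu>\<close> is what makes the
  supremum finite.
\<close>

lemma support_line_of_log_concave:
  fixes F :: "real \<Rightarrow> real"
  assumes F: "antimono F" and lc: "\<And>s t l. 0 < l \<Longrightarrow> l < 1 \<Longrightarrow> F s powr (1 - l) * F t powr l \<le> F ((1 - l) * s + l * t)"
    and pos: "0 < F t" and t: "\<mu> < t"
  obtains a where "\<And>s. 0 < F s \<Longrightarrow> ln (F s) \<le> ln (F \<mu>) - a * (s - \<mu>)"
proof -
  have F\<mu>: "0 < F s" if "s \<le> \<mu>" for s using antimonoD[OF F, of s t] that t pos by simp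
  define slope where "slope s = (ln (F s) - ln (F \<mu>)) / (\<mu> - s)" for s
  have slopes: "slope s \<le> slope u" if s: "s < \<mu>" and u: "\<mu> < u" "0 < F u" for s u
  proof -
    define l where "l = (\<mu> - s) / (u - s)"
    have l: "0 < l" "l < 1" using s u by (auto simp: l_def)
    have 1: "l * (u - s) = \<mu> - s" using s u by (simp add: l_def)
    then have 2: "(1 - l) * (u - s) = u - \<mu>" by (simp add: algebra_simps)
    have "(1 - l) * s + l * u = s + l * (u - s)" by (simp add: algebra_simps)
    then have "(1 - l) * s + l * u = \<mu>" using 1 by simp
    then have "F s powr (1 - l) * F u powr l \<le> F \<mu>" using lc[OF l, of s u] by simp
    moreover have Fs: "0 < F s" using s by (intro F\<mu>) simp
    ultimately have "ln (F s powr (1 - l) * F u powr l) \<le> ln (F \<mu>)"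
      using u F\<mu>[of \<mu>] by (subst ln_le_cancel_iff) auto
    then have "(1 - l) * ln (F s) + l * ln (F u) \<le> ln (F \<mu>)"
      using Fs u by (simp add: ln_mult ln_powr)
    then have "((1 - l) * ln (F s) + l * ln (F u)) * (u - s) \<le> ln (F \<mu>) * (u - s)"
      using s u by (intro mult_right_mono) auto
    then have "((1 - l) * (u - s)) * ln (F s) + (l * (u - s)) * ln (F u) \<le> ln (F \<mu>) * (u - s)"
      by (simp add: algebra_simps)
    then have "(u - \<mu>) * ln (F s) + (\<mu> - s) * ln (F u) \<le> ln (F \<mu>) * (u - s)" by (simp only: 1 2)
    then have "(ln (F s) - ln (F \<mu>)) * (u - \<mu>) \<le> (ln (F \<mu>) - ln (F u)) * (\<mu> - s)"
      by (simp add: algebra_simps)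
    then have "(ln (F s) - ln (F \<mu>)) / (\<mu> - s) \<le> (ln (F \<mu>) - ln (F u)) / (u - \<mu>)"
      using s u by (simp add: divide_simps mult.commute)
    also have "(ln (F \<mu>) - ln (F u)) / (u - \<mu>) = slope u"
      unfolding slope_def by (metis minus_diff_eq minus_divide_divide)
    finally show ?thesis by (simp add: slope_def)
  qed
  define a where "a = (SUP s\<in>{..<\<mu>}. slope s)"
  have bdd: "bdd_above (slope ` {..<\<mu>})"
    using slopes[OF _ t pos] by (auto intro!: bdd_aboveI[of _ "slope t"])
  have "ln (F s) \<le> ln (F \<mu>) - a * (s - \<mu>)" if s: "0 < F s" for s
  proof (cases s \<mu> rule: linorder_cases)
    case less
    then have "slope s \<le> a" unfolding a_def using bdd by (intro cSUP_upper) auto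
    then have "slope s * (\<mu> - s) \<le> a * (\<mu> - s)" using less by (intro mult_right_mono) auto
    moreover have "slope s * (\<mu> - s) = ln (F s) - ln (F \<mu>)" using less by (simp add: slope_def)
    ultimately show ?thesis by (simp add: algebra_simps)
  next
    case greater
    then have "a \<le> slope s" unfolding a_def using slopes[OF _ greater s] by (intro cSUP_least) auto
    then have "a * (s - \<mu>) \<le> slope s * (s - \<mu>)" using greater by (intro mult_right_mono) auto
    also have "slope s * (s - \<mu>) = ln (F \<mu>) - ln (F s)"
      using greater by (simp add: slope_def divide_simps) (simp add: algebra_simps)
    finally show ?thesis by simp
  qed simp
  then show ?thesis by (rule that)
qed

text \<open>
  By \<open>tail_of_tail\<close>, \<open>- ln (F X)\<close> has mean at most that of an exponential variable, which is \<open>1\<close>. The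
  supporting line of \<open>ln F\<close> at the mean turns this into \<open>- ln (F (E X)) \<le> 1\<close>, which is Jensen's
  inequality.
\<close>

lemma (in prob_space) log_concave_tail_at_mean:
  fixes X :: "'a \<Rightarrow> real"
  defines "F \<equiv> \<lambda>s. prob {x\<in>space M. s \<le> X x}"
  assumes X: "integrable M X"
    and lc: "\<And>s t l. 0 < l \<Longrightarrow> l < 1 \<Longrightarrow> F s powr (1 - l) * F t powr l \<le> F ((1 - l) * s + l * t)"
  shows "exp (- 1) \<le> F (expectation X)"
proof -
  have [measurable]: "X \<in> borel_measurable M" using X by auto
  define \<mu> where "\<mu> = expectation X"
  have anti: "antimono F"
    unfolding F_def by (intro antimonoI finite_measure_mono) auto
  have F01: "0 \<le> F s" "F s \<le> 1" for s by (auto simp: F_def)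
  have "(\<lambda>s. - F s) \<in> borel_measurable borel"
    using anti by (intro borel_measurable_mono) (auto simp: mono_def antimono_def)
  from borel_measurable_uminus[OF this] have [measurable]: "F \<in> borel_measurable borel" by simp
  have tail: "prob {x\<in>space M. F (X x) < r} \<le> r" if "0 < r" for r
    unfolding F_def by (rule tail_of_tail) (use that in auto)
  have "prob {x\<in>space M. F (X x) = 0} \<le> 0"
  proof (rule field_le_epsilon)
    fix e :: real assume e: "0 < e"
    have "prob {x\<in>space M. F (X x) = 0} \<le> prob {x\<in>space M. F (X x) < e}"
      using e by (intro finite_measure_mono) auto
    then show "prob {x\<in>space M. F (X x) = 0} \<le> 0 + e" using tail[OF e] by simp
  qed
  then have "prob {x\<in>space M. F (X x) = 0} = 0" by (simp add: measure_le_0_iff)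
  then have "AE x in M. \<not> F (X x) = 0" by (subst (asm) prob_eq_0) auto
  then have AEpos: "AE x in M. 0 < F (X x)"
    by eventually_elim (use F01(1) in \<open>auto simp: less_le\<close>)
  define Y where "Y x = - ln (F (X x))" for x
  have [measurable]: "Y \<in> borel_measurable M" unfolding Y_def by measurable
  have Y0: "0 \<le> Y x" for x
    unfolding Y_def using F01[of "X x"] by (cases "F (X x) = 0") (auto simp: ln_le_zero_iff less_le)
  have "(\<integral>\<^sup>+x. ennreal (Y x) \<partial>M) = (\<integral>\<^sup>+t. emeasure M {x\<in>space M. t < Y x} * indicator {0<..} t \<partial>lborel)"
    by (rule layer_cake) (use Y0 in auto)
  also have "\<dots> \<le> (\<integral>\<^sup>+t. ennreal (exp (- t)) * indicator {0<..} t \<partial>lborel)"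
  proof (rule nn_integral_mono)
    fix t :: real
    have "emeasure M {x\<in>space M. t < Y x} \<le> ennreal (exp (- t))" if "0 < t"
    proof -
      have "F (X x) < exp (- t)" if "t < Y x" for x
      proof -
        have "F (X x) \<noteq> 0" using that \<open>0 < t\<close> by (auto simp: Y_def)
        then have "0 < F (X x)" using F01(1)[of "X x"] by simp
        moreover have "ln (F (X x)) < - t" using that by (simp add: Y_def)
        ultimately show ?thesis by (metis exp_less_cancel_iff exp_ln)
      qed
      then have "prob {x\<in>space M. t < Y x} \<le> prob {x\<in>space M. F (X x) < exp (- t)}"
        by (intro finite_measure_mono) auto
      also have "\<dots> \<le> exp (- t)" by (rule tail) simp
      finally show ?thesis by (simp add: emeasure_eq_measure ennreal_leI)
    qed
    then show "emeasure M {x\<in>space M. t < Y x} * indicator {0<..} t \<le> ennreal (exp (- t)) * indicator {0<..} t"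
      by (auto split: split_indicator)
  qed
  also have "\<dots> \<le> 1" by (rule nn_integral_exp_tail)
  finally have nnY: "(\<integral>\<^sup>+x. ennreal (Y x) \<partial>M) \<le> 1" .
  then have intY: "integrable M Y"
    using Y0 by (intro integrableI_nonneg) (auto intro: le_less_trans)
  have "ennreal (expectation Y) \<le> ennreal 1"
    using nnY nn_integral_eq_integral[OF intY] Y0 by simp
  then have EY: "expectation Y \<le> 1" by (subst (asm) ennreal_le_iff) auto
  have F\<mu>: "0 < F \<mu>"
  proof (rule ccontr)
    assume "\<not> 0 < F \<mu>"
    then have "F \<mu> = 0" using F01(1)[of \<mu>] by simp
    then have "AE x in M. \<not> \<mu> \<le> X x" unfolding F_def by (subst (asm) prob_eq_0) auto
    then have "AE x in M. X x < \<mu>" by (simp add: not_le)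
    then have "expectation X < \<mu>" by (rule expectation_less[OF X])
    then show False by (simp add: \<mu>_def)
  qed
  show ?thesis
  \<comment> \<open>If the tail vanishes beyond the mean, there is no supporting line, but then \<open>X\<close> is constant.\<close>
  proof (cases "\<exists>t>\<mu>. 0 < F t")
    case True
    then obtain t where t: "\<mu> < t" "0 < F t" by blast
    obtain a where a: "\<And>s. 0 < F s \<Longrightarrow> ln (F s) \<le> ln (F \<mu>) - a * (s - \<mu>)"
      using support_line_of_log_concave[OF anti lc t(2,1)] by blast
    have "AE x in M. - ln (F \<mu>) + a * (X x - \<mu>) \<le> Y x"
      using AEpos by eventually_elim (use a in \<open>force simp: Y_def\<close>)
    then have "expectation (\<lambda>x. - ln (F \<mu>) + a * (X x - \<mu>)) \<le> expectation Y"
      using X intY by (intro integral_mono_AE) auto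
    moreover have "expectation (\<lambda>x. - ln (F \<mu>) + a * (X x - \<mu>)) = - ln (F \<mu>)"
      using X by (simp add: prob_space \<mu>_def)
    ultimately have "- 1 \<le> ln (F \<mu>)" using EY by simp
    then show ?thesis using F\<mu> by (simp add: ln_ge_iff \<mu>_def)
  next
    case False
    have le: "AE x in M. X x \<le> \<mu>"
      using AEpos by eventually_elim (use False in \<open>auto simp: not_less\<close>)
    have "expectation (\<lambda>x. \<mu> - X x) = 0" using X by (simp add: prob_space \<mu>_def)
    then have "AE x in M. \<mu> - X x = 0"
      using X le by (subst (asm) integral_nonneg_eq_0_iff_AE) auto
    then have "AE x in M. \<mu> \<le> X x" by eventually_elim simp
    then have "F \<mu> = 1" unfolding F_def by (subst prob_eq_1) auto
    then show ?thesis by (simp add: \<mu>_def)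
  qed
qed

section \<open>Mixed-integer volume and Lebesgue volume\<close>

lemma emeasure_PiM_affine:
  fixes A :: "(nat \<Rightarrow> real) set" and I :: "nat set"
  defines "V \<equiv> \<Pi>\<^sub>M i\<in>I. (lborel :: real measure)"
  assumes I: "finite I" and A: "A \<in> sets V" and c: "0 < c"
  shows "{y \<in> I \<rightarrow>\<^sub>E UNIV. (\<lambda>i\<in>I. (y i - v i) / c) \<in> A} \<in> sets V" (is "?S \<in> _")
    and "emeasure V {y \<in> I \<rightarrow>\<^sub>E UNIV. (\<lambda>i\<in>I. (y i - v i) / c) \<in> A} = ennreal (c ^ card I) * emeasure V A"
proof -
  interpret product_sigma_finite "\<lambda>_::nat. lborel :: real measure" by standard
  define T where "T y = (\<lambda>i\<in>I. (y i - v i) / c)" for y :: "nat \<Rightarrow> real"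
  have spV: "space V = I \<rightarrow>\<^sub>E UNIV" by (simp add: V_def space_PiM)
  have T[measurable]: "T \<in> V \<rightarrow>\<^sub>M V"
    unfolding T_def V_def by measurable
  have eq: "?S = T -` A \<inter> space V" by (auto simp: T_def spV)
  show "?S \<in> sets V" unfolding eq using A by measurable
  let ?P = "scale_measure (ennreal (1 / c ^ card I)) (distr V V T)"
  have "?P = V"
    unfolding V_def
  proof (rule PiM_eqI[OF I])
    fix E :: "nat \<Rightarrow> real set" assume E: "\<And>i. i \<in> I \<Longrightarrow> E i \<in> sets lborel"
    have PE: "Pi\<^sub>E I E \<in> sets (\<Pi>\<^sub>M i\<in>I. lborel)" by (rule sets_PiM_I_finite[OF I E])
    have "T -` Pi\<^sub>E I E \<inter> space V = Pi\<^sub>E I (\<lambda>i. {x. (x - v i) / c \<in> E i})"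
      by (auto simp: T_def spV PiE_iff)
    then have "emeasure (distr V V T) (Pi\<^sub>E I E) = emeasure V (Pi\<^sub>E I (\<lambda>i. {x. (x - v i) / c \<in> E i}))"
      using PE by (simp add: emeasure_distr V_def[symmetric])
    also have "\<dots> = (\<Prod>i\<in>I. emeasure lborel {x. (x - v i) / c \<in> E i})"
      unfolding V_def
    proof (rule emeasure_PiM[OF I])
      fix i assume i: "i \<in> I"
      have [measurable]: "E i \<in> sets borel" using E[OF i] by simp
      have "{x. (x - v i) / c \<in> E i} = (\<lambda>x. (x - v i) / c) -` E i \<inter> space borel" by auto
      also have "\<dots> \<in> sets borel" by measurable
      finally show "{x. (x - v i) / c \<in> E i} \<in> sets lborel" by simp
    qed
    also have "\<dots> = (\<Prod>i\<in>I. ennreal c * emeasure lborel (E i))"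
      using E c by (intro prod.cong refl emeasure_lborel_affine_preimage) auto
    also have "\<dots> = ennreal (c ^ card I) * (\<Prod>i\<in>I. emeasure lborel (E i))"
      using c by (simp add: prod.distrib ennreal_power)
    finally have "emeasure (distr V V T) (Pi\<^sub>E I E) = ennreal (c ^ card I) * (\<Prod>i\<in>I. emeasure lborel (E i))" .
    then show "emeasure (scale_measure (ennreal (1 / c ^ card I)) (distr (Pi\<^sub>M I (\<lambda>i. lborel)) (Pi\<^sub>M I (\<lambda>i. lborel)) T)) (Pi\<^sub>E I E) =
        (\<Prod>i\<in>I. emeasure lborel (E i))"
      using c by (simp add: V_def[symmetric] ennreal_mult[symmetric] flip: mult.assoc)
  qed (simp add: V_def)
  then have "emeasure V A = emeasure ?P A" by simp
  also have "\<dots> = ennreal (1 / c ^ card I) * emeasure V ?S"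
    unfolding eq using A by (simp add: emeasure_distr)
  finally have "ennreal (c ^ card I) * emeasure V A = (ennreal (c ^ card I) * ennreal (1 / c ^ card I)) * emeasure V ?S"
    by (simp add: mult.assoc)
  also have "ennreal (c ^ card I) * ennreal (1 / c ^ card I) = 1"
    using c by (simp flip: ennreal_mult)
  finally show "emeasure V ?S = ennreal (c ^ card I) * emeasure V A" by (simp only: mult_1_left)
qed

lemma emeasure_PiM_translate:
  fixes A :: "(nat \<Rightarrow> real) set" and I :: "nat set"
  assumes I: "finite I" and A: "A \<in> sets (\<Pi>\<^sub>M i\<in>I. lborel)"
  shows "emeasure (\<Pi>\<^sub>M i\<in>I. lborel) {y \<in> I \<rightarrow>\<^sub>E UNIV. (\<lambda>i\<in>I. y i - v i) \<in> A} = emeasure (\<Pi>\<^sub>M i\<in>I. lborel) A"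
  using emeasure_PiM_affine(2)[OF I A, of 1 v] by simp

lemma nn_integral_PiM_translate:
  fixes f :: "(nat \<Rightarrow> real) \<Rightarrow> ennreal" and I :: "nat set"
  assumes I: "finite I" and f[measurable]: "f \<in> borel_measurable (\<Pi>\<^sub>M i\<in>I. lborel)"
  shows "(\<integral>\<^sup>+x. f (\<lambda>i\<in>I. x i - v i) \<partial>(\<Pi>\<^sub>M i\<in>I. lborel)) = (\<integral>\<^sup>+x. f x \<partial>(\<Pi>\<^sub>M i\<in>I. lborel))"
proof -
  let ?V = "\<Pi>\<^sub>M i\<in>I. (lborel :: real measure)" and ?T = "\<lambda>x::nat \<Rightarrow> real. \<lambda>i\<in>I. x i - v i"
  have T[measurable]: "?T \<in> ?V \<rightarrow>\<^sub>M ?V" by measurable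
  have "distr ?V ?V ?T = ?V"
  proof (rule measure_eqI)
    fix A assume "A \<in> sets (distr ?V ?V ?T)"
    then have A: "A \<in> sets ?V" by simp
    have "?T -` A \<inter> space ?V = {y \<in> I \<rightarrow>\<^sub>E UNIV. (\<lambda>i\<in>I. y i - v i) \<in> A}" by (auto simp: space_PiM)
    then show "emeasure (distr ?V ?V ?T) A = emeasure ?V A"
      using emeasure_PiM_translate[OF I A, of v] A by (simp add: emeasure_distr)
  qed simp
  then have "(\<integral>\<^sup>+x. f x \<partial>?V) = (\<integral>\<^sup>+x. f x \<partial>distr ?V ?V ?T)" by simp
  also have "\<dots> = (\<integral>\<^sup>+x. f (?T x) \<partial>?V)" by (rule nn_integral_distr) measurable
  finally show ?thesis by simp
qed

text \<open>
  The numerator of the mixed-integer volume with the integer lattice translated by \<open>t\<close>.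
\<close>

definition shifted_vol :: "nat \<Rightarrow> nat \<Rightarrow> (nat \<Rightarrow> real) set \<Rightarrow> (nat \<Rightarrow> real) \<Rightarrow> ennreal" where
  "shifted_vol n d C t =
     (\<integral>\<^sup>+z. emeasure (\<Pi>\<^sub>M i\<in>{n..<n + d}. lborel) (fiber n d C (\<lambda>i\<in>{..<n}. z i + t i)) \<partial>count_space (Zn n))"

abbreviation unit_cube :: "nat \<Rightarrow> (nat \<Rightarrow> real) set" where
  "unit_cube n \<equiv> {..<n} \<rightarrow>\<^sub>E {0..<1}"

lemma countable_Zn: "countable (Zn n)"
  by (intro countable_PiE) (auto simp: Ints_def)

lemma emeasure_unit_cube: "emeasure (\<Pi>\<^sub>M i\<in>{..<n}. lborel) (unit_cube n) = 1"
proof -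
  interpret product_sigma_finite "\<lambda>_::nat. lborel :: real measure" by standard
  show ?thesis by (subst emeasure_PiM) auto
qed

text \<open>
  Only the coordinatewise floor of \<open>x\<close> contributes.
\<close>

lemma unit_cube_tiles:
  assumes x: "x \<in> Rn n"
  shows "(\<integral>\<^sup>+z. indicator (unit_cube n) (\<lambda>i\<in>{..<n}. x i - z i) \<partial>count_space (Zn n)) = (1 :: ennreal)"
proof -
  define z0 where "z0 = (\<lambda>i\<in>{..<n}. of_int \<lfloor>x i\<rfloor> :: real)"
  have "indicator (unit_cube n) (\<lambda>i\<in>{..<n}. x i - z i) = (indicator {z0} z :: ennreal)" if z: "z \<in> Zn n" for z
  proof -
    have "(\<lambda>i\<in>{..<n}. x i - z i) \<in> unit_cube n \<longleftrightarrow> z = z0"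
    proof
      assume a: "(\<lambda>i\<in>{..<n}. x i - z i) \<in> unit_cube n"
      have "z i = z0 i" for i
      proof (cases "i < n")
        case True
        then obtain k where k: "z i = of_int k" using z by (auto simp: PiE_iff elim: Ints_cases)
        have "0 \<le> x i - z i \<and> x i - z i < 1" using a True by (simp add: PiE_iff)
        then have "\<lfloor>x i\<rfloor> = k" using k by linarith
        then show ?thesis using True k by (simp add: z0_def)
      next
        case False
        then show ?thesis using z by (auto simp: z0_def PiE_iff extensional_def)
      qed
      then show "z = z0" by (rule ext)
    next
      assume "z = z0"
      moreover have "0 \<le> x i - of_int \<lfloor>x i\<rfloor> \<and> x i - of_int \<lfloor>x i\<rfloor> < 1" for i by linarith
      ultimately show "(\<lambda>i\<in>{..<n}. x i - z i) \<in> unit_cube n" by (auto simp: z0_def)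
    qed
    then show ?thesis by (simp add: indicator_def)
  qed
  then have "(\<integral>\<^sup>+z. indicator (unit_cube n) (\<lambda>i\<in>{..<n}. x i - z i) \<partial>count_space (Zn n)) =
      (\<integral>\<^sup>+z. indicator {z0} z \<partial>count_space (Zn n))"
    by (intro nn_integral_cong) simp
  also have "\<dots> = 1" by (simp add: z0_def)
  finally show ?thesis .
qed

lemma nn_integral_fold_cube:
  fixes f :: "(nat \<Rightarrow> real) \<Rightarrow> ennreal"
  assumes f[measurable]: "f \<in> borel_measurable (\<Pi>\<^sub>M i\<in>{..<n}. lborel)"
  shows "(\<integral>\<^sup>+x. f x \<partial>(\<Pi>\<^sub>M i\<in>{..<n}. lborel)) =
    (\<integral>\<^sup>+t. indicator (unit_cube n) t * (\<integral>\<^sup>+z. f (\<lambda>i\<in>{..<n}. z i + t i) \<partial>count_space (Zn n)) \<partial>(\<Pi>\<^sub>M i\<in>{..<n}. lborel))"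
proof -
  let ?V = "\<Pi>\<^sub>M i\<in>{..<n}. (lborel :: real measure)" and ?Q = "unit_cube n"
  have spV: "space ?V = Rn n" by (simp add: space_PiM)
  have Q[measurable]: "?Q \<in> sets ?V" by (intro sets_PiM_I_finite) auto
  have [measurable]: "(\<lambda>x. \<lambda>i\<in>{..<n}. x i - z i) \<in> ?V \<rightarrow>\<^sub>M ?V" "(\<lambda>x. \<lambda>i\<in>{..<n}. z i + x i) \<in> ?V \<rightarrow>\<^sub>M ?V" for z
    by measurable
  have "(\<integral>\<^sup>+x. f x \<partial>?V) = (\<integral>\<^sup>+x. \<integral>\<^sup>+z. indicator ?Q (\<lambda>i\<in>{..<n}. x i - z i) * f x \<partial>count_space (Zn n) \<partial>?V)"
    by (intro nn_integral_cong) (simp add: nn_integral_multc unit_cube_tiles spV)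
  also have "\<dots> = (\<integral>\<^sup>+z. \<integral>\<^sup>+x. indicator ?Q (\<lambda>i\<in>{..<n}. x i - z i) * f x \<partial>?V \<partial>count_space (Zn n))"
    by (rule nn_integral_count_space_nn_integral[OF countable_Zn]) measurable
  also have "\<dots> = (\<integral>\<^sup>+z. \<integral>\<^sup>+x. indicator ?Q x * f (\<lambda>i\<in>{..<n}. z i + x i) \<partial>?V \<partial>count_space (Zn n))"
  proof (rule nn_integral_cong)
    fix z :: "nat \<Rightarrow> real"
    let ?g = "\<lambda>x. indicator ?Q x * f (\<lambda>i\<in>{..<n}. z i + x i)"
    have "(\<integral>\<^sup>+x. ?g (\<lambda>i\<in>{..<n}. x i - z i) \<partial>?V) = (\<integral>\<^sup>+x. ?g x \<partial>?V)"
      by (rule nn_integral_PiM_translate) (simp, measurable)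
    moreover have "?g (\<lambda>i\<in>{..<n}. x i - z i) = indicator ?Q (\<lambda>i\<in>{..<n}. x i - z i) * f x" if "x \<in> space ?V" for x
    proof -
      have "(\<lambda>i\<in>{..<n}. z i + (\<lambda>i\<in>{..<n}. x i - z i) i) = x"
        using that by (auto simp: spV fun_eq_iff PiE_iff extensional_def)
      then show ?thesis by simp
    qed
    ultimately show "(\<integral>\<^sup>+x. indicator ?Q (\<lambda>i\<in>{..<n}. x i - z i) * f x \<partial>?V) = (\<integral>\<^sup>+x. ?g x \<partial>?V)"
      by (metis (no_types, lifting) nn_integral_cong)
  qed
  also have "\<dots> = (\<integral>\<^sup>+x. \<integral>\<^sup>+z. indicator ?Q x * f (\<lambda>i\<in>{..<n}. z i + x i) \<partial>count_space (Zn n) \<partial>?V)"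
    by (rule nn_integral_count_space_nn_integral[OF countable_Zn, symmetric]) measurable
  also have "\<dots> = (\<integral>\<^sup>+x. indicator ?Q x * (\<integral>\<^sup>+z. f (\<lambda>i\<in>{..<n}. z i + x i) \<partial>count_space (Zn n)) \<partial>?V)"
    by (intro nn_integral_cong nn_integral_cmult) simp
  finally show ?thesis .
qed

text \<open>
  Fubini over the integer and the continuous coordinates, followed by cutting the space of integer
  coordinates into integer translates of the unit cube.
\<close>

lemma volume_as_average_of_shifts:
  assumes A: "A \<in> sets (\<Pi>\<^sub>M i\<in>{..<n + d}. lborel)"
  shows "emeasure (\<Pi>\<^sub>M i\<in>{..<n + d}. lborel) A =
    (\<integral>\<^sup>+t. indicator (unit_cube n) t * shifted_vol n d A t \<partial>(\<Pi>\<^sub>M i\<in>{..<n}. lborel))"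
proof -
  interpret product_sigma_finite "\<lambda>_::nat. lborel :: real measure" by standard
  let ?V = "\<Pi>\<^sub>M i\<in>{..<n}. (lborel :: real measure)" and ?W = "\<Pi>\<^sub>M i\<in>{n..<n + d}. (lborel :: real measure)"
  interpret W: finite_product_sigma_finite "\<lambda>_::nat. lborel :: real measure" "{n..<n + d}" by standard simp
  have U: "{..<n} \<union> {n..<n + d} = {..<n + d}" by auto
  have AR: "A \<subseteq> Rn (n + d)" using sets.sets_into_space[OF A] by (simp add: space_PiM)
  have "emeasure (\<Pi>\<^sub>M i\<in>{..<n + d}. lborel) A = (\<integral>\<^sup>+x. indicator A x \<partial>(\<Pi>\<^sub>M i\<in>{..<n} \<union> {n..<n + d}. lborel))"
    using A by (simp add: U)
  also have "\<dots> = (\<integral>\<^sup>+x. \<integral>\<^sup>+y. indicator A (merge {..<n} {n..<n + d} (x, y)) \<partial>?W \<partial>?V)"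
    using A by (intro product_nn_integral_fold) (auto simp: U)
  also have "\<dots> = (\<integral>\<^sup>+x. emeasure ?W (fiber n d A x) \<partial>?V)"
  proof (rule nn_integral_cong)
    fix x assume x: "x \<in> space ?V"
    have "fiber n d A x \<in> sets ?W"
      using A x by (intro fiber_sets) (auto simp: space_PiM cong: sets_PiM_cong)
    then have "emeasure ?W (fiber n d A x) = (\<integral>\<^sup>+y. indicator (fiber n d A x) y \<partial>?W)" by simp
    also have "\<dots> = (\<integral>\<^sup>+y. indicator A (merge {..<n} {n..<n + d} (x, y)) \<partial>?W)"
      by (rule nn_integral_cong) (auto simp: fiber_def space_PiM indicator_def)
    finally show "(\<integral>\<^sup>+y. indicator A (merge {..<n} {n..<n + d} (x, y)) \<partial>?W) = emeasure ?W (fiber n d A x)" ..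
  qed
  also have "\<dots> = (\<integral>\<^sup>+t. indicator (unit_cube n) t * shifted_vol n d A t \<partial>?V)"
    unfolding shifted_vol_def
  proof (rule nn_integral_fold_cube)
    have "merge {..<n} {n..<n + d} \<in> ?V \<Otimes>\<^sub>M ?W \<rightarrow>\<^sub>M (\<Pi>\<^sub>M i\<in>{..<n + d}. lborel)"
      using measurable_merge[of "{..<n}" "{n..<n + d}" "\<lambda>_. lborel :: real measure"] by (simp add: U)
    from measurable_sets[OF this A]
    have Q: "merge {..<n} {n..<n + d} -` A \<inter> space (?V \<Otimes>\<^sub>M ?W) \<in> sets (?V \<Otimes>\<^sub>M ?W)" .
    have "(\<lambda>x. emeasure ?W (Pair x -` (merge {..<n} {n..<n + d} -` A \<inter> space (?V \<Otimes>\<^sub>M ?W)))) \<in> borel_measurable ?V"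
      by (rule W.measurable_emeasure_Pair[OF Q])
    moreover have "Pair x -` (merge {..<n} {n..<n + d} -` A \<inter> space (?V \<Otimes>\<^sub>M ?W)) = fiber n d A x"
      if "x \<in> space ?V" for x
      using that by (auto simp: fiber_def space_pair_measure space_PiM)
    ultimately show "(\<lambda>x. emeasure ?W (fiber n d A x)) \<in> borel_measurable ?V"
      by (simp cong: measurable_cong)
  qed
  finally show ?thesis .
qed

text \<open>
  The integer part of \<open>v\<close> moves the fibers of \<open>A\<close> to those over a shifted lattice, and its continuous
  part translates each of them into the corresponding fiber of \<open>B\<close>.
\<close>

lemma shifted_vol_mono_shift:
  assumes B: "B \<in> sets (\<Pi>\<^sub>M i\<in>{..<n + d}. lborel)" and A: "A \<in> sets (\<Pi>\<^sub>M i\<in>{..<n + d}. lborel)"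
    and sub: "\<And>a. a \<in> A \<Longrightarrow> (\<lambda>i\<in>{..<n + d}. a i + v i) \<in> B"
  shows "shifted_vol n d A t \<le> shifted_vol n d B (\<lambda>i. t i + v i)"
  unfolding shifted_vol_def
proof (rule nn_integral_mono)
  fix z assume "z \<in> space (count_space (Zn n))"
  let ?W = "\<Pi>\<^sub>M i\<in>{n..<n + d}. (lborel :: real measure)"
  let ?x = "\<lambda>i\<in>{..<n}. z i + t i" and ?x' = "\<lambda>i\<in>{..<n}. z i + (t i + v i)"
  let ?F = "{y \<in> {n..<n + d} \<rightarrow>\<^sub>E UNIV. (\<lambda>i\<in>{n..<n + d}. y i - - v i) \<in> fiber n d B ?x'}"
  have FB: "fiber n d B ?x' \<in> sets ?W" using B by (intro fiber_sets) (auto cong: sets_PiM_cong)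
  have "fiber n d A ?x \<subseteq> ?F"
  proof
    fix y assume y: "y \<in> fiber n d A ?x"
    then have "merge {..<n} {n..<n + d} (?x, y) \<in> A" by (simp add: fiber_def)
    then have "(\<lambda>i\<in>{..<n + d}. merge {..<n} {n..<n + d} (?x, y) i + v i) \<in> B" by (rule sub)
    moreover have "(\<lambda>i\<in>{..<n + d}. merge {..<n} {n..<n + d} (?x, y) i + v i) =
        merge {..<n} {n..<n + d} (?x', \<lambda>i\<in>{n..<n + d}. y i - - v i)"
      by (auto simp: fun_eq_iff merge_def)
    ultimately show "y \<in> ?F" using y by (auto simp: fiber_def)
  qed
  moreover have "?F \<in> sets ?W"
    using emeasure_PiM_affine(1)[OF _ FB, of 1 "\<lambda>i. - v i"] by simp
  ultimately have "emeasure ?W (fiber n d A ?x) \<le> emeasure ?W ?F" by (rule emeasure_mono)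
  also have "\<dots> = emeasure ?W (fiber n d B ?x')" by (rule emeasure_PiM_translate[OF _ FB]) simp
  finally show "emeasure ?W (fiber n d A ?x) \<le> emeasure ?W (fiber n d B ?x')" .
qed

lemma shifted_vol_integer_shift:
  assumes t: "\<And>i. i < n \<Longrightarrow> t i \<in> \<int>"
  shows "shifted_vol n d B t = mixed_vol n d B"
proof -
  let ?g = "\<lambda>z. \<lambda>i\<in>{..<n}. z i + t i"
  have "bij_betw ?g (Zn n) (Zn n)"
  proof (rule bij_betw_byWitness[where f' = "\<lambda>z. \<lambda>i\<in>{..<n}. z i - t i"])
    have ext: "(\<lambda>i\<in>{..<n}. z i) = z" if "z \<in> Zn n" for z :: "nat \<Rightarrow> real"
      using that by (simp add: PiE_def extensional_restrict)
    show "\<forall>z\<in>Zn n. (\<lambda>i\<in>{..<n}. ?g z i - t i) = z"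
    proof
      fix z assume "z \<in> Zn n"
      have "(\<lambda>i\<in>{..<n}. ?g z i - t i) = (\<lambda>i\<in>{..<n}. z i)" by (rule restrict_ext) simp
      also have "\<dots> = z" by (rule ext) fact
      finally show "(\<lambda>i\<in>{..<n}. ?g z i - t i) = z" .
    qed
    show "\<forall>z\<in>Zn n. ?g (\<lambda>i\<in>{..<n}. z i - t i) = z"
    proof
      fix z assume "z \<in> Zn n"
      have "?g (\<lambda>i\<in>{..<n}. z i - t i) = (\<lambda>i\<in>{..<n}. z i)" by (rule restrict_ext) simp
      also have "\<dots> = z" by (rule ext) fact
      finally show "?g (\<lambda>i\<in>{..<n}. z i - t i) = z" .
    qed
    show "?g ` Zn n \<subseteq> Zn n" "(\<lambda>z. \<lambda>i\<in>{..<n}. z i - t i) ` Zn n \<subseteq> Zn n"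
      using t by (auto simp: PiE_iff intro!: Ints_add Ints_diff)
  qed
  from nn_integral_bij_count_space[OF this, of "\<lambda>z. emeasure (\<Pi>\<^sub>M i\<in>{n..<n + d}. lborel) (fiber n d B z)"]
  show ?thesis by (simp add: shifted_vol_def mixed_vol_def)
qed

text \<open>
  The shift \<open>v\<close> may depend on \<open>t\<close> in an arbitrary, possibly nonmeasurable way: it only serves to compare
  the integrands of \<open>volume_as_average_of_shifts\<close> at a fixed \<open>t\<close>.
\<close>

lemma volume_le_mixed_vol:
  assumes A: "A \<in> sets (\<Pi>\<^sub>M i\<in>{..<n + d}. lborel)" and B: "B \<in> sets (\<Pi>\<^sub>M i\<in>{..<n + d}. lborel)"
    and shift: "\<And>t. \<exists>v. (\<forall>i<n. t i + v i \<in> \<int>) \<and> (\<forall>a\<in>A. (\<lambda>i\<in>{..<n + d}. a i + v i) \<in> B)"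
  shows "emeasure (\<Pi>\<^sub>M i\<in>{..<n + d}. lborel) A \<le> mixed_vol n d B"
proof -
  let ?V = "\<Pi>\<^sub>M i\<in>{..<n}. (lborel :: real measure)"
  have Q: "unit_cube n \<in> sets ?V" by (intro sets_PiM_I_finite) auto
  have "shifted_vol n d A t \<le> mixed_vol n d B" for t
  proof -
    obtain v where v: "\<forall>i<n. t i + v i \<in> \<int>" "\<forall>a\<in>A. (\<lambda>i\<in>{..<n + d}. a i + v i) \<in> B" using shift by blast
    have "shifted_vol n d A t \<le> shifted_vol n d B (\<lambda>i. t i + v i)"
      by (rule shifted_vol_mono_shift[OF B A]) (use v(2) in blast)
    also have "\<dots> = mixed_vol n d B" by (rule shifted_vol_integer_shift) (use v(1) in blast)
    finally show ?thesis .
  qed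
  then have "emeasure (\<Pi>\<^sub>M i\<in>{..<n + d}. lborel) A \<le>
      (\<integral>\<^sup>+t. mixed_vol n d B * indicator (unit_cube n) t \<partial>?V)"
    unfolding volume_as_average_of_shifts[OF A]
    by (intro nn_integral_mono) (auto split: split_indicator)
  also have "\<dots> = mixed_vol n d B"
    by (simp only: nn_integral_cmult_indicator[OF Q] emeasure_unit_cube mult_1_right)
  finally show ?thesis .
qed

lemma mixed_vol_le_volume:
  assumes A: "A \<in> sets (\<Pi>\<^sub>M i\<in>{..<n + d}. lborel)" and B: "B \<in> sets (\<Pi>\<^sub>M i\<in>{..<n + d}. lborel)"
    and shift: "\<And>t. \<exists>v. (\<forall>i<n. t i - v i \<in> \<int>) \<and> (\<forall>b\<in>B. (\<lambda>i\<in>{..<n + d}. b i + v i) \<in> A)"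
  shows "mixed_vol n d B \<le> emeasure (\<Pi>\<^sub>M i\<in>{..<n + d}. lborel) A"
proof -
  let ?V = "\<Pi>\<^sub>M i\<in>{..<n}. (lborel :: real measure)"
  have Q: "unit_cube n \<in> sets ?V" by (intro sets_PiM_I_finite) auto
  have "mixed_vol n d B \<le> shifted_vol n d A t" for t
  proof -
    obtain v where v: "\<forall>i<n. t i - v i \<in> \<int>" "\<forall>b\<in>B. (\<lambda>i\<in>{..<n + d}. b i + v i) \<in> A" using shift by blast
    have "mixed_vol n d B = shifted_vol n d B (\<lambda>i. t i - v i)"
      by (rule shifted_vol_integer_shift[symmetric]) (use v(1) in blast)
    also have "\<dots> \<le> shifted_vol n d A (\<lambda>i. (t i - v i) + v i)"
      by (rule shifted_vol_mono_shift[OF A B]) (use v(2) in blast)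
    finally show ?thesis by simp
  qed
  then have "(\<integral>\<^sup>+t. mixed_vol n d B * indicator (unit_cube n) t \<partial>?V) \<le> emeasure (\<Pi>\<^sub>M i\<in>{..<n + d}. lborel) A"
    unfolding volume_as_average_of_shifts[OF A]
    by (intro nn_integral_mono) (auto split: split_indicator)
  then show ?thesis
    by (simp only: nn_integral_cmult_indicator[OF Q] emeasure_unit_cube mult_1_right)
qed

section \<open>A deep point of a convex body\<close>

lemma dot_cong: "(\<And>i. i < m \<Longrightarrow> x i = y i) \<Longrightarrow> dot m u x = dot m u y"
  by (simp add: dot_def)

lemma dot_add_scale: "dot m u (\<lambda>i. x i + c * y i) = dot m u x + c * dot m u y"
  by (simp add: dot_def algebra_simps sum.distrib sum_distrib_left)

lemma dot_measurable[measurable]: "dot m u \<in> borel_measurable (\<Pi>\<^sub>M i\<in>{..<m}. lborel)"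
  unfolding dot_def by measurable

lemma halfspace_sets: "{y \<in> Rn m. s \<le> dot m u y} \<in> sets (\<Pi>\<^sub>M i\<in>{..<m}. lborel)"
proof -
  have "{y \<in> space (\<Pi>\<^sub>M i\<in>{..<m}. (lborel :: real measure)). s \<le> dot m u y} \<in> sets (\<Pi>\<^sub>M i\<in>{..<m}. lborel)"
    by measurable
  then show ?thesis by (simp add: space_PiM)
qed

lemma convex_body_lborel_sets: "convex_body m K \<Longrightarrow> K \<in> sets (\<Pi>\<^sub>M i\<in>{..<m}. lborel)"
  using convex_body_sets by (simp cong: sets_PiM_cong)

lemma measure_positive:
  assumes "emeasure M A \<noteq> \<infinity>" "emeasure M A \<noteq> 0"
  shows "0 < measure M A"
proof -
  have "emeasure M A = ennreal (measure M A)"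
    by (rule emeasure_eq_ennreal_measure) (use assms(1) in simp)
  then have "measure M A \<noteq> 0" using assms(2) by auto
  then show ?thesis by (simp add: zero_less_measure_iff)
qed

lemma convex_body_volume:
  assumes K: "convex_body m K"
  shows "emeasure (\<Pi>\<^sub>M i\<in>{..<m}. lborel) K \<noteq> \<infinity>" "emeasure (\<Pi>\<^sub>M i\<in>{..<m}. lborel) K \<noteq> 0"
proof -
  interpret product_sigma_finite "\<lambda>_::nat. lborel :: real measure" by standard
  let ?V = "\<Pi>\<^sub>M i\<in>{..<m}. (lborel :: real measure)"
  obtain B where B: "B > 0" "\<forall>x\<in>K. \<forall>i<m. \<bar>x i\<bar> \<le> B" by (rule convex_body_bounded[OF K])
  have "x \<in> {..<m} \<rightarrow>\<^sub>E {-B..B}" if "x \<in> K" for x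
    using convex_body_Rn[OF K that] B(2) that by (auto simp: PiE_iff abs_le_iff minus_le_iff)
  then have "emeasure ?V K \<le> emeasure ?V ({..<m} \<rightarrow>\<^sub>E {-B..B})"
    by (intro emeasure_mono sets_PiM_I_finite) auto
  also have "\<dots> = (\<Prod>i<m. emeasure lborel {-B..B})" by (rule emeasure_PiM) auto
  also have "\<dots> < \<infinity>" using B(1) by (simp add: power_less_top_ennreal)
  finally show "emeasure ?V K \<noteq> \<infinity>" by simp
  obtain p \<rho> where p: "p \<in> K" "\<rho> > 0" "\<forall>y\<in>Rn m. (\<forall>i<m. \<bar>y i - p i\<bar> < \<rho>) \<longrightarrow> y \<in> K"
    by (rule convex_body_box[OF K])
  have ne: "(\<Prod>i<m. ennreal \<rho>) \<noteq> 0" using p(2) by simp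
  have "(\<Prod>i<m. ennreal \<rho>) = (\<Prod>i<m. emeasure lborel {p i - \<rho> / 2..p i + \<rho> / 2})" using p(2) by simp
  also have "\<dots> = emeasure ?V (\<Pi>\<^sub>E i\<in>{..<m}. {p i - \<rho> / 2..p i + \<rho> / 2})"
    by (rule emeasure_PiM[symmetric]) auto
  also have "\<dots> \<le> emeasure ?V K"
  proof (rule emeasure_mono)
    show "(\<Pi>\<^sub>E i\<in>{..<m}. {p i - \<rho> / 2..p i + \<rho> / 2}) \<subseteq> K"
    proof
      fix y assume y: "y \<in> (\<Pi>\<^sub>E i\<in>{..<m}. {p i - \<rho> / 2..p i + \<rho> / 2})"
      have "\<bar>y i - p i\<bar> < \<rho>" if "i < m" for i
      proof -
        have "p i - \<rho> / 2 \<le> y i \<and> y i \<le> p i + \<rho> / 2" using PiE_mem[OF y, of i] that by simp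
        then show ?thesis using p(2) by linarith
      qed
      moreover have "y \<in> Rn m" using y by (simp add: PiE_iff)
      ultimately show "y \<in> K" using p(3) by blast
    qed
  qed (rule convex_body_lborel_sets[OF K])
  finally show "emeasure ?V K \<noteq> 0" using ne by auto
qed

text \<open>
  The point is the centroid. A linear functional of a uniform random point of \<open>K\<close> has its mean at the
  centroid, and by the Brunn-Minkowski inequality its tail is log-concave.
\<close>

lemma grunbaum_point:
  fixes m :: nat
  defines "V \<equiv> \<Pi>\<^sub>M i\<in>{..<m}. (lborel :: real measure)"
  assumes K: "convex_body m K"
  obtains x0 where "x0 \<in> Rn m"
    "\<forall>u. exp (- 1) * measure V K \<le> measure V (K \<inter> {y \<in> Rn m. dot m u x0 \<le> dot m u y})"
proof -
  have spV: "space V = Rn m" by (simp add: V_def space_PiM)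
  have KV[measurable]: "K \<in> sets V" unfolding V_def by (rule convex_body_lborel_sets[OF K])
  have fin: "emeasure V K \<noteq> \<infinity>" "emeasure V K \<noteq> 0" unfolding V_def by (rule convex_body_volume[OF K])+
  have k: "measure V K > 0" by (rule measure_positive[OF fin])
  define U where "U = uniform_measure V K"
  have setsU: "sets U = sets V" and spU: "space U = Rn m" by (simp_all add: U_def spV)
  interpret U: prob_space U unfolding U_def by (rule prob_space_uniform_measure) (use fin in auto)
  obtain B where B: "B > 0" "\<forall>x\<in>K. \<forall>i<m. \<bar>x i\<bar> \<le> B" by (rule convex_body_bounded[OF K])
  have AEK: "AE x in U. x \<in> K" unfolding U_def by (rule AE_uniform_measureI) auto
  have int: "integrable U (\<lambda>x. x i)" if "i < m" for i
  proof (rule U.integrable_const_bound)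
    show "AE x in U. norm (x i) \<le> B" using AEK by eventually_elim (use B(2) that in auto)
    have "(\<lambda>x. x i) \<in> V \<rightarrow>\<^sub>M lborel"
      unfolding V_def using that by (intro measurable_component_singleton) simp
    then show "(\<lambda>x. x i) \<in> borel_measurable U" by (simp add: U_def)
  qed
  define x0 where "x0 = (\<lambda>i\<in>{..<m}. \<integral>x. x i \<partial>U)"
  have "exp (- 1) * measure V K \<le> measure V (K \<inter> {y \<in> Rn m. dot m u x0 \<le> dot m u y})" for u
  proof -
    let ?H = "\<lambda>s. {y \<in> Rn m. s \<le> dot m u y}"
    have H[measurable]: "?H s \<in> sets V" for s unfolding V_def by (rule halfspace_sets)
    have intX: "integrable U (dot m u)"
      unfolding dot_def using int by (intro Bochner_Integration.integrable_sum integrable_mult_right) auto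
    have EX: "U.expectation (dot m u) = dot m u x0"
      unfolding dot_def using int by (subst Bochner_Integration.integral_sum) (auto simp: x0_def)
    have F: "U.prob {y \<in> space U. s \<le> dot m u y} = measure V (K \<inter> ?H s) / measure V K" for s
      unfolding spU unfolding U_def using fin H by (intro measure_uniform_measure) auto
    have lc: "U.prob {y \<in> space U. s \<le> dot m u y} powr (1 - l) * U.prob {y \<in> space U. t \<le> dot m u y} powr l
        \<le> U.prob {y \<in> space U. (1 - l) * s + l * t \<le> dot m u y}" if l: "0 < l" "l < 1" for s t l
    proof -
      have "measure V (K \<inter> ?H s) powr (1 - l) * measure V (K \<inter> ?H t) powr l \<le>
          measure V (K \<inter> ?H ((1 - l) * s + l * t))"
        unfolding V_def
      proof (rule brunn_minkowski_multiplicative[where R = B])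
        show "K \<inter> ?H s \<in> sets (\<Pi>\<^sub>M i\<in>{..<m}. lborel)" "K \<inter> ?H t \<in> sets (\<Pi>\<^sub>M i\<in>{..<m}. lborel)"
          "K \<inter> ?H ((1 - l) * s + l * t) \<in> sets (\<Pi>\<^sub>M i\<in>{..<m}. lborel)"
          unfolding V_def[symmetric] using KV H by (blast intro: sets.Int)+
        have "emeasure V (K \<inter> ?H ((1 - l) * s + l * t)) \<le> emeasure V K" by (intro emeasure_mono) auto
        then show "emeasure (\<Pi>\<^sub>M i\<in>{..<m}. lborel) (K \<inter> ?H ((1 - l) * s + l * t)) \<noteq> \<infinity>"
          unfolding V_def[symmetric] using fin(1) by (auto simp: top_unique)
        fix x i assume "x \<in> K \<inter> ?H s \<union> K \<inter> ?H t \<union> K \<inter> ?H ((1 - l) * s + l * t)" "i < m"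
        then show "\<bar>x i\<bar> \<le> B" using B(2) by blast
      next
        fix x y assume x: "x \<in> K \<inter> ?H s" and y: "y \<in> K \<inter> ?H t"
        let ?z = "\<lambda>i\<in>{..<m}. (1 - l) * x i + l * y i"
        have "dot m u ?z = (1 - l) * dot m u x + l * dot m u y"
          by (simp add: dot_def algebra_simps sum.distrib sum_distrib_left sum_subtractf)
        moreover have "(1 - l) * s + l * t \<le> (1 - l) * dot m u x + l * dot m u y"
          using x y l by (intro add_mono mult_left_mono) auto
        moreover have "?z \<in> K" using x y l by (intro convex_body_convex[OF K]) auto
        ultimately show "?z \<in> K \<inter> ?H ((1 - l) * s + l * t)" by simp
      qed (use l B(1) in auto)
      moreover have "measure V K powr (1 - l) * measure V K powr l = measure V K"
        using k by (simp flip: powr_add)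
      ultimately show ?thesis
        unfolding F using k by (simp add: powr_divide divide_right_mono)
    qed
    have "exp (- 1) \<le> measure V (K \<inter> ?H (dot m u x0)) / measure V K"
      using U.log_concave_tail_at_mean[OF intX lc] unfolding EX F by simp
    then show ?thesis using k by (simp add: pos_le_divide_eq)
  qed
  moreover have "x0 \<in> Rn m" by (simp add: x0_def)
  ultimately show ?thesis using that by blast
qed

text \<open>
  The nearest point \<open>q\<close> of \<open>K\<close> to \<open>p\<close> gives the direction \<open>p - q\<close>: moving from \<open>q\<close> a small step
  \<open>t\<close> towards a point \<open>y\<close> on the wrong side would decrease the distance.
\<close>

lemma convex_body_separation:
  assumes K: "convex_body m K" and p: "p \<in> Rn m" "p \<notin> K"
  obtains u where "\<forall>y\<in>K. dot m u y < dot m u p"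
proof -
  define f where "f q = (\<Sum>i<m. (q i - p i)\<^sup>2)" for q :: "nat \<Rightarrow> real"
  have "continuous_map (powertop_real {..<m}) euclideanreal f"
    unfolding f_def
    by (intro continuous_map_sum continuous_map_real_pow continuous_map_diff continuous_map_product_projection
        continuous_map_const[THEN iffD2]) auto
  then have "compactin euclideanreal (f ` K)"
    using K unfolding convex_body_def by (blast intro: image_compactin)
  then have c: "compact (f ` K)" by (simp add: compactin_euclidean_iff)
  obtain p' where "p' \<in> K" using convex_body_box[OF K] by blast
  then have "f ` K \<noteq> {}" by blast
  then obtain q where q: "q \<in> K" "\<And>y. y \<in> K \<Longrightarrow> f q \<le> f y"
    using compact_attains_inf[OF c] by blast
  define u where "u i = p i - q i" for i
  have pq: "dot m u p - dot m u q > 0"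
  proof -
    have eq: "dot m u p - dot m u q = (\<Sum>i<m. (u i)\<^sup>2)"
      unfolding dot_def sum_subtractf[symmetric]
      by (rule sum.cong) (auto simp: u_def power2_eq_square algebra_simps)
    have "\<exists>i<m. p i \<noteq> q i"
    proof (rule ccontr)
      assume "\<not> (\<exists>i<m. p i \<noteq> q i)"
      then have "p = q" using p(1) convex_body_Rn[OF K q(1)] by (intro PiE_ext[of p "{..<m}" _ q]) auto
      then show False using p(2) q(1) by simp
    qed
    then obtain i where "i < m" "u i \<noteq> 0" by (auto simp: u_def)
    then show ?thesis unfolding eq by (intro sum_pos2[of _ i]) auto
  qed
  have "dot m u y \<le> dot m u q" if y: "y \<in> K" for y
  proof (rule ccontr)
    assume gt: "\<not> dot m u y \<le> dot m u q"
    define D where "D = dot m u y - dot m u q"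
    define S where "S = (\<Sum>i<m. (y i - q i)\<^sup>2)"
    have D: "D > 0" using gt by (simp add: D_def)
    have S: "S \<ge> 0" unfolding S_def by (intro sum_nonneg) auto
    define t where "t = min 1 (D / (S + 1))"
    have t: "0 < t" "t \<le> 1" using D S by (auto simp: t_def)
    let ?z = "\<lambda>i\<in>{..<m}. (1 - t) * q i + t * y i"
    have "?z \<in> K" using q(1) y t by (intro convex_body_convex[OF K]) auto
    then have "f q \<le> f ?z" by (rule q(2))
    moreover have "f ?z = f q - 2 * t * D + t\<^sup>2 * S"
    proof -
      have "f ?z = (\<Sum>i<m. (q i - p i)\<^sup>2 - 2 * t * (u i * (y i - q i)) + t\<^sup>2 * (y i - q i)\<^sup>2)"
        unfolding f_def by (rule sum.cong) (auto simp: u_def power2_eq_square algebra_simps)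
      also have "\<dots> = f q - 2 * t * (\<Sum>i<m. u i * (y i - q i)) + t\<^sup>2 * S"
        unfolding f_def S_def by (simp add: sum.distrib sum_subtractf sum_distrib_left)
      also have "(\<Sum>i<m. u i * (y i - q i)) = D"
        by (simp add: D_def dot_def right_diff_distrib sum_subtractf)
      finally show ?thesis .
    qed
    ultimately have "t * (2 * D) \<le> t * (t * S)" by (simp add: power2_eq_square)
    then have "2 * D \<le> t * S" using t(1) by simp
    also have "\<dots> \<le> D / (S + 1) * S" using S by (intro mult_right_mono) (auto simp: t_def)
    also have "\<dots> \<le> D" using D S by (simp add: field_simps)
    finally show False using D by simp
  qed
  then have "\<forall>y\<in>K. dot m u y < dot m u p" using pq by force
  then show ?thesis by (rule that)
qed

definition deep_point :: "nat \<Rightarrow> (nat \<Rightarrow> real) set \<Rightarrow> (nat \<Rightarrow> real) \<Rightarrow> bool" where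
  "deep_point m K x0 \<longleftrightarrow> x0 \<in> Rn m \<and> (\<forall>u. exp (- 1) * measure (\<Pi>\<^sub>M i\<in>{..<m}. lborel) K \<le>
     measure (\<Pi>\<^sub>M i\<in>{..<m}. lborel) (K \<inter> {y \<in> Rn m. dot m u x0 \<le> dot m u y}))"

text \<open>
  Otherwise some \<open>u\<close> separates the reflected point from \<open>K\<close>: beyond \<open>x\<^sub>0\<close>, the body extends less than
  \<open>1 / (4 m - 1)\<close> of the distance from \<open>x\<^sub>0\<close> back to \<open>q\<close> in direction \<open>u\<close>. Contracting \<open>K\<close> towards \<open>q\<close> by
  \<open>1 - s\<close> with \<open>s = 1 / (4 m)\<close> then puts all of it strictly below \<open>x\<^sub>0\<close>, so at least \<open>3 / 4\<close> of the
  volume lies below \<open>x\<^sub>0\<close>, while a deep point leaves at least \<open>1 / e \<ge> 1 / 3\<close> above.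
\<close>

lemma reflection_in_body:
  assumes K: "convex_body m K" and x0: "deep_point m K x0" and m: "1 \<le> m" and q: "q \<in> K"
  shows "(\<lambda>i\<in>{..<m}. x0 i - (q i - x0 i) / (4 * real m - 1)) \<in> K"
proof (rule ccontr)
  let ?V = "\<Pi>\<^sub>M i\<in>{..<m}. (lborel :: real measure)" and ?R = "4 * real m - 1"
  let ?p = "\<lambda>i\<in>{..<m}. x0 i - (q i - x0 i) / ?R"
  assume "?p \<notin> K"
  then obtain u where u: "\<forall>y\<in>K. dot m u y < dot m u ?p"
    using convex_body_separation[OF K, of ?p] by auto
  have R: "?R > 0" using m by simp
  define a where "a = dot m u x0 - dot m u q"
  have "dot m u ?p = dot m u (\<lambda>i. x0 i + (1 / ?R) * (x0 i + (- 1) * q i))"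
    by (rule dot_cong) (simp add: diff_divide_distrib add_divide_distrib)
  also have "\<dots> = dot m u x0 + a / ?R" unfolding dot_add_scale by (simp add: a_def)
  finally have up: "dot m u ?p = dot m u x0 + a / ?R" .
  let ?H = "{y \<in> Rn m. dot m u x0 \<le> dot m u y}"
  have KV: "K \<in> sets ?V" by (rule convex_body_lborel_sets[OF K])
  have HV: "?H \<in> sets ?V" by (rule halfspace_sets)
  note fin = convex_body_volume[OF K]
  have k: "measure ?V K > 0" by (rule measure_positive[OF fin])
  have deep: "exp (- 1) * measure ?V K \<le> measure ?V (K \<inter> ?H)" using x0 by (simp add: deep_point_def)
  have "K \<inter> ?H \<noteq> {}"
  proof
    assume "K \<inter> ?H = {}"
    then have "exp (- 1) * measure ?V K \<le> 0" using deep by (simp only: measure_empty)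
    moreover have "exp (- 1) * measure ?V K > 0" using k by simp
    ultimately show False by linarith
  qed
  then obtain y where "y \<in> K" "dot m u x0 \<le> dot m u y" by blast
  then have "0 < a / ?R" using u up by fastforce
  then have a: "0 < a" using R by (simp add: zero_less_divide_iff)
  define s where "s = 1 / (4 * real m)"
  have s: "0 < s" "s < 1" using m by (auto simp: s_def)
  let ?A = "{y \<in> Rn m. (\<lambda>i\<in>{..<m}. (y i - s * q i) / (1 - s)) \<in> K}"
  have AV: "?A \<in> sets ?V" and volA: "emeasure ?V ?A = ennreal ((1 - s) ^ m) * emeasure ?V K"
    using emeasure_PiM_affine[OF _ KV, of "1 - s" "\<lambda>i. s * q i"] s by simp_all
  have A: "y \<in> K \<and> dot m u y < dot m u x0" if y: "y \<in> ?A" for y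
  proof -
    define g where "g = (\<lambda>i\<in>{..<m}. (y i - s * q i) / (1 - s))"
    have g: "g \<in> K" using y by (simp add: g_def)
    have yi: "y i = (1 - s) * g i + s * q i" if "i < m" for i using that s by (simp add: g_def)
    have "y = (\<lambda>i\<in>{..<m}. (1 - s) * g i + s * q i)"
      using y yi by (intro PiE_ext[of y "{..<m}" "\<lambda>_. UNIV"]) auto
    then have "y \<in> K" using convex_body_convex[OF K g q, of s] s by simp
    moreover have "dot m u y < dot m u x0"
    proof -
      have "dot m u y = dot m u (\<lambda>i. (g i + (- s) * g i) + s * q i)"
        by (rule dot_cong) (simp add: yi algebra_simps)
      also have "\<dots> = (1 - s) * dot m u g + s * dot m u q"
        unfolding dot_add_scale by (simp add: algebra_simps)
      also have "\<dots> < (1 - s) * (dot m u x0 + a / ?R) + s * dot m u q"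
        using u g up s by (intro add_strict_right_mono mult_strict_left_mono) auto
      also have "\<dots> = dot m u x0 + ((1 - s) / ?R - s) * a"
        by (simp add: a_def algebra_simps diff_divide_distrib)
      also have "(1 - s) / ?R = s" using R m by (simp add: s_def field_simps)
      finally show ?thesis by simp
    qed
    ultimately show ?thesis by blast
  qed
  have "(1 - s) ^ m * measure ?V K + exp (- 1) * measure ?V K \<le> measure ?V ?A + measure ?V (K \<inter> ?H)"
    using deep s unfolding measure_def volA by (simp add: enn2real_mult)
  also have "\<dots> = measure ?V (?A \<union> (K \<inter> ?H))"
  proof (rule measure_Union[symmetric])
    show "emeasure ?V ?A \<noteq> \<infinity>" unfolding volA using fin(1) by (simp add: ennreal_mult_eq_top_iff)
    have "emeasure ?V (K \<inter> ?H) \<le> emeasure ?V K" using KV by (intro emeasure_mono) auto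
    then show "emeasure ?V (K \<inter> ?H) \<noteq> \<infinity>" using fin(1) by (auto simp: top_unique)
    show "?A \<inter> (K \<inter> ?H) = {}"
    proof (rule equals0I)
      fix y assume y: "y \<in> ?A \<inter> (K \<inter> ?H)"
      have "dot m u y < dot m u x0" using A[OF IntD1[OF y]] by (rule conjunct2)
      moreover have "dot m u x0 \<le> dot m u y" using IntD2[OF IntD2[OF y]] by simp
      ultimately show False by simp
    qed
  qed (use AV KV HV in auto)
  also have "\<dots> \<le> measure ?V K"
  proof (rule measure_mono_fmeasurable)
    show "?A \<union> (K \<inter> ?H) \<subseteq> K" using A by blast
    show "?A \<union> (K \<inter> ?H) \<in> sets ?V" using AV KV HV by (intro sets.Un sets.Int)
    show "K \<in> fmeasurable ?V" using KV fin(1) by (intro fmeasurableI) (simp_all add: top.not_eq_extremum)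
  qed
  finally have "((1 - s) ^ m + exp (- 1)) * measure ?V K \<le> 1 * measure ?V K" by (simp add: distrib_right)
  then have "(1 - s) ^ m + exp (- 1) \<le> 1" using k by simp
  moreover have "1 - real m * s \<le> (1 - s) ^ m"
    using Bernoulli_inequality[of "- s" m] s by simp
  moreover have "real m * s = 1 / 4" using m by (simp add: s_def)
  moreover have "1 / 3 \<le> exp (- 1 :: real)"
    using exp_le by (simp add: exp_minus inverse_eq_divide divide_simps)
  ultimately show False by linarith
qed

text \<open>
  This is the inclusion \<open>K - K \<subseteq> 4 m (K - x\<^sub>0)\<close>: \<open>k\<close> lies on the segment from the contracted
  reflection of \<open>b\<close> to \<open>a\<close>.
\<close>

lemma difference_in_body:
  assumes K: "convex_body m K" and x0: "deep_point m K x0" and m: "1 \<le> m" and a: "a \<in> K" and b: "b \<in> K"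
  obtains k where "k \<in> K" "\<forall>i<m. a i - b i = 4 * real m * (k i - x0 i)"
proof -
  define b' where "b' = (\<lambda>i\<in>{..<m}. x0 i - (b i - x0 i) / (4 * real m - 1))"
  define s where "s = 1 / (4 * real m)"
  have b': "b' \<in> K" unfolding b'_def by (rule reflection_in_body[OF K x0 m b])
  have s: "0 \<le> s" "s \<le> 1" using m by (auto simp: s_def)
  let ?k = "\<lambda>i\<in>{..<m}. (1 - s) * b' i + s * a i"
  have "?k \<in> K" by (rule convex_body_convex[OF K b' a s])
  moreover have "a i - b i = 4 * real m * (?k i - x0 i)" if i: "i < m" for i
  proof -
    define R where "R = 4 * real m - 1"
    have R: "R > 0" "4 * real m = R + 1" using m by (auto simp: R_def)
    have bi: "R * b' i = R * x0 i - (b i - x0 i)" 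
    proof -
      have b'i: "b' i = x0 i - (b i - x0 i) / R" using i by (simp add: b'_def R_def)
      have "R * ((b i - x0 i) / R) = b i - x0 i" using R(1) by simp
      then show ?thesis unfolding b'i right_diff_distrib[of R "x0 i"] by (simp only:)
    qed
    have "4 * real m * (?k i - x0 i) = (4 * real m * (1 - s)) * b' i + (4 * real m * s) * a i - 4 * real m * x0 i"
      using i by (simp add: algebra_simps)
    also have "4 * real m * s = 1" using m by (simp add: s_def)
    also have "4 * real m * (1 - s) = R" using m by (simp add: s_def R_def algebra_simps)
    also have "R * b' i + 1 * a i - 4 * real m * x0 i = a i - b i"
      unfolding bi R(2) by (simp add: algebra_simps)
    finally show ?thesis by simp
  qed
  ultimately show ?thesis using that by blast
qed

section \<open>The mixed-integer centerpoint\<close>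

text \<open>
  The shift \<open>v\<close> is \<open>\<delta> (a - b)\<close> with \<open>a\<close>, \<open>b\<close> in \<open>K\<close>. Exchanging \<open>a\<close> and \<open>b\<close> shows that both \<open>v\<close> and \<open>- v\<close> lie in
  \<open>\<eta> (K - x\<^sub>0)\<close>. The first membership keeps shifted points inside an enlarged body, the second bounds
  how far the shift can move them out of a half-space.
\<close>

lemma lattice_shift:
  assumes K: "convex_body m K" and nm: "n \<le> m" and n: "1 \<le> n" and x0: "deep_point m K x0"
    and \<eta>: "0 < \<eta>" and width: "2 ^ (n - 1) < \<eta> / (4 * real m) * lattice_width n K"
  obtains v k k' where "\<forall>i<n. t i - v i \<in> \<int>" "k \<in> K" "k' \<in> K"
    "\<forall>i<m. v i = \<eta> * (k i - x0 i)" "\<forall>i<m. v i = - (\<eta> * (k' i - x0 i))"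
proof -
  define \<delta> where "\<delta> = \<eta> / (4 * real m)"
  have m: "1 \<le> m" using n nm by simp
  have \<delta>: "0 < \<delta>" "\<delta> * (4 * real m) = \<eta>" using \<eta> m by (simp_all add: \<delta>_def)
  obtain a b where ab: "a \<in> K" "b \<in> K" "\<And>i. i < n \<Longrightarrow> t i - \<delta> * (a i - b i) \<in> \<int>"
    using difference_body_covers[OF K nm n \<delta>(1), of t] width unfolding \<delta>_def by blast
  obtain k where k: "k \<in> K" "\<forall>i<m. a i - b i = 4 * real m * (k i - x0 i)"
    by (rule difference_in_body[OF K x0 m ab(1,2)])
  obtain k' where k': "k' \<in> K" "\<forall>i<m. b i - a i = 4 * real m * (k' i - x0 i)"
    by (rule difference_in_body[OF K x0 m ab(2,1)])
  define v where "v i = \<delta> * (a i - b i)" for i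
  have v1: "v i = \<eta> * (k i - x0 i)" if i: "i < m" for i
  proof -
    have "v i = \<delta> * (4 * real m * (k i - x0 i))" using k(2) i by (simp only: v_def)
    also have "\<dots> = (\<delta> * (4 * real m)) * (k i - x0 i)" by (simp only: mult.assoc)
    finally show ?thesis by (simp only: \<delta>(2))
  qed
  have v2: "v i = - (\<eta> * (k' i - x0 i))" if i: "i < m" for i
  proof -
    have "v i = - (\<delta> * (b i - a i))" by (simp add: v_def algebra_simps)
    also have "\<dots> = - (\<delta> * (4 * real m * (k' i - x0 i)))" using k'(2) i by (simp only:)
    also have "\<dots> = - ((\<delta> * (4 * real m)) * (k' i - x0 i))" by (simp only: mult.assoc)
    finally show ?thesis by (simp only: \<delta>(2))
  qed
  have "\<forall>i<n. t i - v i \<in> \<int>" using ab(3) by (simp add: v_def)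
  then show ?thesis using that[of v k k'] k(1) k'(1) v1 v2 by blast
qed

text \<open>
  Shifts in \<open>\<eta> (K - x\<^sub>0)\<close> move \<open>K\<close> into \<open>x\<^sub>0 + (1 + \<eta>) (K - x\<^sub>0)\<close>.
\<close>

lemma mixed_vol_upper:
  fixes n d :: nat
  defines "V \<equiv> \<Pi>\<^sub>M i\<in>{..<n + d}. (lborel :: real measure)"
  assumes K: "convex_body (n + d) K" and n: "1 \<le> n" and x0: "deep_point (n + d) K x0"
    and \<eta>: "0 < \<eta>" and width: "2 ^ (n - 1) < \<eta> / (4 * real (n + d)) * lattice_width n K"
  shows "mixed_vol n d K \<le> ennreal ((1 + \<eta>) ^ (n + d)) * emeasure V K"
proof -
  let ?m = "n + d"
  have KV: "K \<in> sets V" unfolding V_def by (rule convex_body_lborel_sets[OF K])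
  let ?A = "{y \<in> Rn ?m. (\<lambda>i\<in>{..<?m}. (y i - (- \<eta> * x0 i)) / (1 + \<eta>)) \<in> K}"
  have AV: "?A \<in> sets V" "emeasure V ?A = ennreal ((1 + \<eta>) ^ ?m) * emeasure V K"
    using emeasure_PiM_affine[OF _ KV[unfolded V_def], of "1 + \<eta>" "\<lambda>i. - \<eta> * x0 i"] \<eta>
    unfolding V_def by simp_all
  have "mixed_vol n d K \<le> emeasure V ?A"
    unfolding V_def
  proof (rule mixed_vol_le_volume)
    fix t
    obtain v k k' where v: "\<forall>i<n. t i - v i \<in> \<int>" "k \<in> K" "\<forall>i<?m. v i = \<eta> * (k i - x0 i)"
      by (rule lattice_shift[OF K _ n x0 \<eta> width, of t]) simp_all
    have "(\<lambda>i\<in>{..<?m}. b i + v i) \<in> ?A" if b: "b \<in> K" for b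
    proof -
      define s where "s = \<eta> / (1 + \<eta>)"
      have s: "0 \<le> s" "s \<le> 1" using \<eta> by (auto simp: s_def)
      have "(\<lambda>i\<in>{..<?m}. ((\<lambda>i\<in>{..<?m}. b i + v i) i - (- \<eta> * x0 i)) / (1 + \<eta>)) =
          (\<lambda>i\<in>{..<?m}. (1 - s) * b i + s * k i)"
      proof (rule restrict_ext)
        fix i assume i: "i \<in> {..<?m}"
        have "v i = \<eta> * (k i - x0 i)" using v(3) i by blast
        then have "((\<lambda>i\<in>{..<?m}. b i + v i) i - (- \<eta> * x0 i)) = b i + \<eta> * k i"
          using i by (simp add: algebra_simps)
        moreover have "(1 - s) = 1 / (1 + \<eta>)" using \<eta> by (simp add: s_def field_simps)
        ultimately show "((\<lambda>i\<in>{..<?m}. b i + v i) i - (- \<eta> * x0 i)) / (1 + \<eta>) = (1 - s) * b i + s * k i"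
          by (simp add: s_def add_divide_distrib)
      qed
      also have "\<dots> \<in> K" by (rule convex_body_convex[OF K b v(2) s])
      finally show ?thesis by simp
    qed
    then show "\<exists>v. (\<forall>i<n. t i - v i \<in> \<int>) \<and> (\<forall>b\<in>K. (\<lambda>i\<in>{..<?m}. b i + v i) \<in> ?A)"
      using v(1) by blast
  qed (use AV KV in \<open>simp_all add: V_def\<close>)
  then show ?thesis using AV(2) by simp
qed

text \<open>
  Let \<open>G\<close> be the part of \<open>K\<close> beyond \<open>x\<^sub>0\<close> in direction \<open>u\<close> and \<open>p\<close> a point of \<open>K\<close> that is extremal in this
  direction. The set \<open>(1 - 3 \<eta>) G + 2 \<eta> p + \<eta> x\<^sub>0\<close> leaves room for a shift in \<open>\<eta> (K - x\<^sub>0)\<close> inside \<open>K\<close>.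
  One copy of \<open>\<eta> p\<close> compensates the displacement of the set by the shift, the other that of
  the half-space from \<open>x\<^sub>0\<close> to \<open>x\<close>; neither displacement exceeds \<open>\<eta>\<close> times the extent of \<open>K\<close> beyond \<open>x\<^sub>0\<close>.
\<close>

lemma mixed_vol_halfspace_lower:
  fixes n d :: nat
  defines "V \<equiv> \<Pi>\<^sub>M i\<in>{..<n + d}. (lborel :: real measure)"
  assumes K: "convex_body (n + d) K" and n: "1 \<le> n" and x0: "deep_point (n + d) K x0"
    and \<eta>: "0 < \<eta>" "3 * \<eta> < 1" and width: "2 ^ (n - 1) < \<eta> / (4 * real (n + d)) * lattice_width n K"
    and x: "k2 \<in> K" "\<And>i. i < n + d \<Longrightarrow> x i = x0 i + \<eta> * (k2 i - x0 i)"
  shows "ennreal ((1 - 3 * \<eta>) ^ (n + d)) * (ennreal (exp (- 1)) * emeasure V K) \<le> mixed_vol n d (K \<inter> halfspace (n + d) u x)"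
proof -
  let ?m = "n + d"
  have KV: "K \<in> sets V" unfolding V_def by (rule convex_body_lborel_sets[OF K])
  have HV: "{y \<in> Rn ?m. s \<le> dot ?m u y} \<in> sets V" for s unfolding V_def by (rule halfspace_sets)
  let ?G = "K \<inter> {y \<in> Rn ?m. dot ?m u x0 \<le> dot ?m u y}"
  have GV: "?G \<in> sets V" using KV HV by (rule sets.Int)
  have "halfspace ?m u x = {y \<in> Rn ?m. dot ?m u x \<le> dot ?m u y}"
    by (simp add: halfspace_def dot_diff)
  then have BV: "K \<inter> halfspace ?m u x \<in> sets V" using KV HV by (simp add: sets.Int)
  obtain p where "p \<in> K" "dot ?m u p = (SUP x\<in>K. dot ?m u x)"
    using convex_body_dot_attained(1)[OF K order_refl] by blast
  then have p: "p \<in> K" "\<And>y. y \<in> K \<Longrightarrow> dot ?m u y \<le> dot ?m u p"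
    using cSUP_upper[OF _ convex_body_dot_attained(3)[OF K order_refl]] by auto
  let ?c = "1 - 3 * \<eta>"
  let ?w = "\<lambda>i. 2 * \<eta> * p i + \<eta> * x0 i"
  let ?A = "{y \<in> Rn ?m. (\<lambda>i\<in>{..<?m}. (y i - ?w i) / ?c) \<in> ?G}"
  have AV: "?A \<in> sets V" "emeasure V ?A = ennreal (?c ^ ?m) * emeasure V ?G"
    using emeasure_PiM_affine[OF _ GV[unfolded V_def], of ?c ?w] \<eta>
    unfolding V_def by simp_all
  have "emeasure V ?A \<le> mixed_vol n d (K \<inter> halfspace ?m u x)"
    unfolding V_def
  proof (rule volume_le_mixed_vol)
    fix t :: "nat \<Rightarrow> real"
    obtain v k k' where v: "\<forall>i<n. - t i - v i \<in> \<int>" "k \<in> K" "k' \<in> K"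
      "\<forall>i<?m. v i = \<eta> * (k i - x0 i)" "\<forall>i<?m. v i = - (\<eta> * (k' i - x0 i))"
      by (rule lattice_shift[OF K _ n x0 \<eta>(1) width, of "\<lambda>i. - t i"]) simp_all
    have "\<forall>i<n. t i + v i \<in> \<int>"
    proof (intro allI impI)
      fix i assume "i < n"
      then have "- t i - v i \<in> \<int>" using v(1) by blast
      then have "- (- t i - v i) \<in> \<int>" by (rule Ints_minus)
      then show "t i + v i \<in> \<int>" by (simp add: add.commute)
    qed
    moreover have "(\<lambda>i\<in>{..<?m}. y i + v i) \<in> K \<inter> halfspace ?m u x" if y: "y \<in> ?A" for y
    proof -
      define g where "g = (\<lambda>i\<in>{..<?m}. (y i - ?w i) / ?c)"
      have g: "g \<in> K" "dot ?m u x0 \<le> dot ?m u g" using y by (simp_all add: g_def)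
      have yi: "y i = ?c * g i + ?w i" if "i < ?m" for i using that \<eta> by (simp add: g_def)
      have v1: "v i = \<eta> * (k i - x0 i)" if "i < ?m" for i using v(4) that by blast
      have v2: "v i = - (\<eta> * (k' i - x0 i))" if "i < ?m" for i using v(5) that by blast
      define q where "q = (\<lambda>i\<in>{..<?m}. (1 - 1 / 3) * p i + 1 / 3 * k i)"
      have q: "q \<in> K" unfolding q_def by (rule convex_body_convex[OF K p(1) v(2)]) auto
      have "(\<lambda>i\<in>{..<?m}. y i + v i) = (\<lambda>i\<in>{..<?m}. (1 - 3 * \<eta>) * g i + 3 * \<eta> * q i)"
      proof (rule restrict_ext)
        fix i assume i: "i \<in> {..<?m}"
        have "3 * \<eta> * q i = 2 * \<eta> * p i + \<eta> * k i" using i by (simp add: q_def algebra_simps)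
        then show "y i + v i = (1 - 3 * \<eta>) * g i + 3 * \<eta> * q i"
          using yi[of i] v1[of i] i by (simp add: algebra_simps)
      qed
      also have "\<dots> \<in> K" by (rule convex_body_convex[OF K g(1) q]) (use \<eta> in auto)
      finally have inK: "(\<lambda>i\<in>{..<?m}. y i + v i) \<in> K" .
      have "dot ?m u (\<lambda>i. (\<lambda>i\<in>{..<?m}. y i + v i) i - x i) =
          dot ?m u (\<lambda>i. (((0 + ?c * g i) + (- ?c) * x0 i) + (2 * \<eta>) * p i) + (- \<eta>) * (k' i + 1 * k2 i))"
      proof (rule dot_cong)
        fix i assume i: "i < ?m"
        show "(\<lambda>i\<in>{..<?m}. y i + v i) i - x i =
            (((0 + ?c * g i) + (- ?c) * x0 i) + (2 * \<eta>) * p i) + (- \<eta>) * (k' i + 1 * k2 i)"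
          using i by (simp add: yi v2 x(2) algebra_simps)
      qed
      also have "\<dots> = ?c * (dot ?m u g - dot ?m u x0) + \<eta> * (dot ?m u p - dot ?m u k') + \<eta> * (dot ?m u p - dot ?m u k2)"
      proof -
        have "dot ?m u (\<lambda>i. 0) = 0" by (simp add: dot_def)
        then show ?thesis unfolding dot_add_scale by (simp add: algebra_simps)
      qed
      also have "0 \<le> \<dots>"
        using g(2) p(2)[OF v(3)] p(2)[OF x(1)] \<eta> by (intro add_nonneg_nonneg mult_nonneg_nonneg) auto
      finally have "0 \<le> dot ?m u (\<lambda>i. (\<lambda>i\<in>{..<?m}. y i + v i) i - x i)" .
      then show ?thesis using inK convex_body_Rn[OF K inK] by (simp add: halfspace_def)
    qed
    ultimately show "\<exists>v. (\<forall>i<n. t i + v i \<in> \<int>) \<and> (\<forall>a\<in>?A. (\<lambda>i\<in>{..<?m}. a i + v i) \<in> K \<inter> halfspace ?m u x)"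
      by blast
  qed (use AV BV in \<open>simp_all add: V_def\<close>)
  moreover have "ennreal (exp (- 1)) * emeasure V K \<le> emeasure V ?G"
  proof -
    have fin: "emeasure V K \<noteq> \<infinity>" unfolding V_def by (rule convex_body_volume[OF K])
    have "emeasure V ?G \<le> emeasure V K" using KV by (intro emeasure_mono) auto
    then have "emeasure V ?G \<noteq> \<infinity>" using fin by (auto simp: top_unique)
    then have e: "emeasure V ?G = ennreal (measure V ?G)" "emeasure V K = ennreal (measure V K)"
      using fin by (simp_all add: emeasure_eq_ennreal_measure)
    have "exp (- 1) * measure V K \<le> measure V ?G"
      using x0 unfolding deep_point_def V_def by blast
    then have "ennreal (exp (- 1) * measure V K) \<le> ennreal (measure V ?G)" by (rule ennreal_leI)
    then show ?thesis unfolding e by (simp add: ennreal_mult)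
  qed
  then have "ennreal (?c ^ ?m) * (ennreal (exp (- 1)) * emeasure V K) \<le> ennreal (?c ^ ?m) * emeasure V ?G"
    by (rule mult_left_mono) simp
  ultimately show ?thesis unfolding AV(2)[symmetric] by (rule order_trans[rotated])
qed

text \<open>
  \<open>(1 - 3 \<eta>) / (1 + \<eta>) \<ge> 1 - 4 \<eta> = 1 - s / 2 \<ge> exp (- s)\<close> for \<open>s = 1 / (c m) \<le> 1\<close>.
\<close>

lemma shrink_ratio_bound:
  fixes c :: real and m :: nat
  assumes c: "1 \<le> c" and m: "1 \<le> m"
  defines "\<eta> \<equiv> 1 / (8 * c * real m)"
  shows "exp (- 1 / c) * (1 + \<eta>) ^ m \<le> (1 - 3 * \<eta>) ^ m"
proof -
  define s where "s = 1 / (c * real m)"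
  have "1 * 1 \<le> c * real m" using c m by (intro mult_mono) auto
  then have s: "0 < s" "s \<le> 1" by (auto simp: s_def divide_le_eq)
  have \<eta>: "\<eta> = s / 8" by (simp add: \<eta>_def s_def)
  have "exp (- s) = 1 / exp s" by (simp add: exp_minus inverse_eq_divide)
  also have "\<dots> \<le> 1 / (1 + s)" using exp_ge_add_one_self[of s] s by (intro divide_left_mono) auto
  also have "\<dots> \<le> 1 - s / 2"
  proof -
    have "1 \<le> (1 - s / 2) * (1 + s)" using s mult_left_mono[of s 1 s] by (simp add: algebra_simps)
    then show ?thesis using s by (simp add: pos_divide_le_eq)
  qed
  finally have "exp (- s) * (1 + \<eta>) \<le> (1 - 4 * \<eta>) * (1 + \<eta>)"
    using s by (intro mult_right_mono) (auto simp: \<eta>)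
  also have "\<dots> \<le> 1 - 3 * \<eta>" by (simp add: algebra_simps)
  finally have "(exp (- s) * (1 + \<eta>)) ^ m \<le> (1 - 3 * \<eta>) ^ m"
    using s by (intro power_mono) (auto simp: \<eta>)
  moreover have "exp (- s) ^ m = exp (- 1 / c)"
    using c m by (simp add: s_def flip: exp_of_nat_mult)
  ultimately show ?thesis by (simp add: power_mult_distrib)
qed

text \<open>
  The factor in front of \<open>W\<close> is \<open>1 / (32 c m\<^sup>2)\<close>. It cancels against \<open>32 c m\<^sup>2 \<le> 32 c m powr (5/2)\<close>, and
  \<open>n ^ (n + 2) \<ge> 2 ^ (n - 1)\<close> remains.
\<close>

lemma width_condition:
  fixes c W :: real and n m :: nat
  assumes c: "0 < c" and n: "1 \<le> n" "n \<le> m"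
    and W: "W > 2 * c * real n * real m powr (5/2) * 16 * real n ^ (n + 1)"
  defines "\<eta> \<equiv> 1 / (8 * c * real m)"
  shows "2 ^ (n - 1) < \<eta> / (4 * real m) * W"
proof -
  have m: "1 \<le> real m" using n by simp
  have "(2::real) ^ (n - 1) \<le> real n * real n ^ (n + 1)"
  proof (cases "n = 1")
    case False
    then have "2 \<le> n" using n by simp
    then have "(2::real) ^ (n - 1) \<le> real n ^ (n - 1)" by (intro power_mono) auto
    also have "\<dots> \<le> real n ^ (n + 2)" using n by (intro power_increasing) auto
    finally show ?thesis by simp
  qed simp
  moreover have "real n * real n ^ (n + 1) < \<eta> / (4 * real m) * W"
  proof -
    let ?X = "real n * real n ^ (n + 1)"
    have "real m ^ 2 = real m powr 2" using m by (simp add: powr_numeral)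
    also have "\<dots> \<le> real m powr (5 / 2)" using m by (intro powr_mono) auto
    finally have "32 * c * ?X * real m ^ 2 \<le> 32 * c * ?X * real m powr (5 / 2)"
      using c by (intro mult_left_mono) auto
    also have "\<dots> < W" using W by (simp add: mult_ac)
    finally have "?X * (32 * c * real m ^ 2) < W" by (simp add: mult_ac)
    moreover have "0 < 32 * c * real m ^ 2" using c m by simp
    ultimately have "?X < W / (32 * c * real m ^ 2)" by (simp only: pos_less_divide_eq)
    also have "\<dots> = \<eta> / (4 * real m) * W" using c m by (simp add: \<eta>_def power2_eq_square)
    finally show ?thesis .
  qed
  ultimately show ?thesis by linarith
qed

lemma calF_lower_bound:
  assumes M: "finite_measure M" and m: "1 \<le> m" and x: "x \<in> S"
    and r: "\<And>u. u \<in> unit_sphere m \<Longrightarrow> r \<le> measure M (halfspace m u x)"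
  shows "r \<le> calF m S M"
proof -
  interpret finite_measure M by fact
  define e where "e = (\<lambda>j\<in>{..<m}. if j = 0 then 1 else (0::real))"
  have "dot m e e = (\<Sum>j<m. if j = 0 then 1 else 0)"
    unfolding dot_def by (rule sum.cong) (auto simp: e_def)
  also have "\<dots> = 1" using m by (subst sum.delta) auto
  finally have e: "e \<in> unit_sphere m" by (simp add: unit_sphere_def) (simp add: e_def)
  have "depth m M y \<le> measure M (space M)" for y
  proof -
    have "depth m M y \<le> measure M (halfspace m e y)"
      unfolding depth_def using e by (intro cINF_lower bdd_belowI[of _ 0]) auto
    also have "\<dots> \<le> measure M (space M)" by (rule bounded_measure)
    finally show ?thesis .
  qed
  then have "bdd_above (depth m M ` S)" by (auto intro!: bdd_aboveI)
  then have "depth m M x \<le> calF m S M" unfolding calF_def using x by (intro cSUP_upper)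
  moreover have "r \<le> depth m M x"
    unfolding depth_def using e r by (intro cINF_greatest) auto
  ultimately show ?thesis by linarith
qed

text \<open>
  The point is \<open>x\<^sub>0\<close> rounded by a shift in \<open>\<eta> (K - x\<^sub>0)\<close>; its depth is the quotient of the bounds of
  \<open>mixed_vol_halfspace_lower\<close> and \<open>mixed_vol_upper\<close>.
\<close>

lemma mixed_centerpoint:
  assumes K: "convex_body (n + d) K" and n: "1 \<le> n" and c: "1 \<le> c"
    and width: "lattice_width n K > 2 * c * real n * real (n + d) powr (5/2) * 16 * real n ^ (n + 1)"
  shows "exp (- 1 / c - 1) \<le> calF (n + d) (mixed_lattice n d) (mixed_measure n d K)"
proof -
  let ?m = "n + d"
  let ?V = "\<Pi>\<^sub>M i\<in>{..<?m}. (lborel :: real measure)"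
  define \<eta> where "\<eta> = 1 / (8 * c * real ?m)"
  have m: "1 \<le> ?m" "n \<le> ?m" using n by simp_all
  have cm: "1 * 1 \<le> c * real ?m" using c m by (intro mult_mono) auto
  have \<eta>: "0 < \<eta>" "3 * \<eta> < 1" using cm c m by (auto simp: \<eta>_def divide_less_eq)
  have width': "2 ^ (n - 1) < \<eta> / (4 * real ?m) * lattice_width n K"
    unfolding \<eta>_def using c width by (intro width_condition[OF _ n m(2)]) auto
  obtain x0 where "x0 \<in> Rn ?m"
    "\<forall>u. exp (- 1) * measure ?V K \<le> measure ?V (K \<inter> {y \<in> Rn ?m. dot ?m u x0 \<le> dot ?m u y})"
    by (rule grunbaum_point[OF K])
  then have x0: "deep_point ?m K x0" by (simp add: deep_point_def)
  obtain v k k' where v: "\<forall>i<n. x0 i - v i \<in> \<int>" "k' \<in> K" "\<forall>i<?m. v i = - (\<eta> * (k' i - x0 i))"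
    by (rule lattice_shift[OF K m(2) n x0 \<eta>(1) width', of x0])
  define x where "x = (\<lambda>i\<in>{..<?m}. x0 i - v i)"
  have x: "x i = x0 i + \<eta> * (k' i - x0 i)" if "i < ?m" for i
    using v(3) that by (simp add: x_def)
  have xL: "x \<in> mixed_lattice n d" using v(1) by (simp add: mixed_lattice_def x_def)
  note fin = convex_body_volume[OF K]
  have upper: "mixed_vol n d K \<le> ennreal ((1 + \<eta>) ^ ?m) * emeasure ?V K"
    by (rule mixed_vol_upper[OF K n x0 \<eta>(1) width'])
  have lower: "ennreal ((1 - 3 * \<eta>) ^ ?m) * (ennreal (exp (- 1)) * emeasure ?V K) \<le> mixed_vol n d (K \<inter> halfspace ?m u x)" for u
    by (rule mixed_vol_halfspace_lower[OF K n x0 \<eta> width' v(2) x])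
  \<comment> \<open>The zero direction gives all of \<open>K\<close>, hence a positive denominator.\<close>
  have "K \<inter> halfspace ?m (\<lambda>_. 0) x = K"
    using convex_body_Rn[OF K] by (auto simp: halfspace_def dot_def)
  then have "ennreal ((1 - 3 * \<eta>) ^ ?m) * (ennreal (exp (- 1)) * emeasure ?V K) \<le> mixed_vol n d K"
    using lower[of "\<lambda>_. 0"] by simp
  moreover have "ennreal ((1 - 3 * \<eta>) ^ ?m) * (ennreal (exp (- 1)) * emeasure ?V K) \<noteq> 0"
    using fin(2) \<eta>(2) by simp
  ultimately have pos: "mixed_vol n d K \<noteq> 0" by auto
  have "ennreal ((1 + \<eta>) ^ ?m) * emeasure ?V K \<noteq> \<infinity>"
    using fin(1) by (simp add: ennreal_mult_eq_top_iff)
  then have finite: "mixed_vol n d K \<noteq> \<infinity>" using upper by (auto simp: top_unique)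
  have ratio: "ennreal (exp (- 1 / c - 1)) * mixed_vol n d K \<le> mixed_vol n d (K \<inter> halfspace ?m u x)" for u
  proof -
    have "ennreal (exp (- 1 / c - 1)) * mixed_vol n d K \<le>
        ennreal (exp (- 1 / c - 1)) * (ennreal ((1 + \<eta>) ^ ?m) * emeasure ?V K)"
      by (rule mult_left_mono[OF upper]) simp
    also have "\<dots> = ennreal (exp (- 1 / c) * (1 + \<eta>) ^ ?m) * (ennreal (exp (- 1)) * emeasure ?V K)"
    proof -
      have "exp (- 1 / c - 1) = exp (- 1 / c) * exp (- 1 :: real)" by (simp add: mult_exp_exp)
      then show ?thesis using \<eta>(1) by (simp add: ennreal_mult mult_ac)
    qed
    also have "\<dots> \<le> ennreal ((1 - 3 * \<eta>) ^ ?m) * (ennreal (exp (- 1)) * emeasure ?V K)"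
      unfolding \<eta>_def by (intro mult_right_mono ennreal_leI shrink_ratio_bound[OF c m(1)]) simp
    also have "\<dots> \<le> mixed_vol n d (K \<inter> halfspace ?m u x)" by (rule lower)
    finally show ?thesis .
  qed
  have Ks: "K \<in> sets (\<Pi>\<^sub>M i\<in>{..<?m}. borel)" by (rule convex_body_sets[OF K])
  have fm: "finite_measure (mixed_measure n d K)" by (rule finite_measure_mixed_measure[OF Ks])
  show ?thesis
  proof (rule calF_lower_bound[OF fm m(1) xL])
    fix u
    have "halfspace ?m u x = {y \<in> Rn ?m. dot ?m u x \<le> dot ?m u y}"
      by (simp add: halfspace_def dot_diff)
    then have H: "halfspace ?m u x \<in> sets (\<Pi>\<^sub>M i\<in>{..<?m}. borel)"
      using halfspace_sets[of ?m "dot ?m u x" u] by (simp cong: sets_PiM_cong)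
    have "ennreal (exp (- 1 / c - 1)) = ennreal (exp (- 1 / c - 1)) * mixed_vol n d K / mixed_vol n d K"
      using pos finite by (simp add: ennreal_mult_divide_eq)
    also have "\<dots> \<le> mixed_vol n d (halfspace ?m u x \<inter> K) / mixed_vol n d K"
      using ratio[of u] by (intro divide_right_mono_ennreal) (simp add: Int_commute)
    also have "\<dots> = emeasure (mixed_measure n d K) (halfspace ?m u x)"
      by (rule emeasure_mixed_measure[OF Ks H, symmetric])
    also have "\<dots> = ennreal (measure (mixed_measure n d K) (halfspace ?m u x))"
      by (rule finite_measure.emeasure_eq_measure[OF fm])
    finally show "exp (- 1 / c - 1) \<le> measure (mixed_measure n d K) (halfspace ?m u x)"
      by (subst (asm) ennreal_le_iff) auto
  qed
qed

lemma ratio_power_bounds: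
  assumes d: "1 \<le> d"
  shows "(real d / (real d + 1)) ^ d \<le> 1 / 2" "1 / exp 1 \<le> (real d / (real d + 1)) ^ d"
proof -
  have "real d / (real d + 1) = 1 / (1 + 1 / real d)" using d by (simp add: field_simps)
  then have eq: "(real d / (real d + 1)) ^ d = 1 / (1 + 1 / real d) ^ d" by (simp only: power_one_over)
  have pos: "0 < (1 + 1 / real d) ^ d" by (intro zero_less_power add_pos_nonneg) auto
  have "1 + real d * (1 / real d) \<le> (1 + 1 / real d) ^ d"
    by (rule Bernoulli_inequality) (rule order_trans[of _ 0], simp_all)
  then have "2 \<le> (1 + 1 / real d) ^ d" using d by simp
  then show "(real d / (real d + 1)) ^ d \<le> 1 / 2" 
    unfolding eq using pos by (intro divide_left_mono) auto
  have "(1 + 1 / real d) ^ d \<le> exp (1 / real d) ^ d"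
    using exp_ge_add_one_self[of "1 / real d"] by (intro power_mono) auto
  also have "\<dots> = exp 1" using d by (simp flip: exp_of_nat_mult)
  finally show "1 / exp 1 \<le> (real d / (real d + 1)) ^ d"
    unfolding eq using pos by (intro divide_left_mono) auto
qed

theorem theorem18:
  shows "\<exists>\<alpha>::real. \<forall>(n::nat) (d::nat) (K::(nat \<Rightarrow> real) set) (c::real).
    n \<ge> 1 \<and> d \<ge> 1 \<and> convex_body (n + d) K \<and> c > 0 \<and>
    lattice_width n K > 2 * c * real n * real (n + d) powr (5/2) * \<alpha> * real n ^ (n + 1) \<longrightarrow>
      calF (n + d) (mixed_lattice n d) (mixed_measure n d K) \<ge> exp (- 1/c - 1) + exp (- 2/c) - 1 \<and>
      (exp (- 1/c - 1) + exp (- 2/c) - 1 \<ge> 2 powr (- real n - 1) \<longrightarrow>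
        calF (n + d) (mixed_lattice n d) (mixed_measure n d K) \<ge> 1 / 2 ^ n * (1 / 2) \<and>
        1 / 2 ^ n * (1 / 2) \<ge> 1 / 2 ^ n * (real d / (real d + 1)) ^ d \<and>
        1 / 2 ^ n * (real d / (real d + 1)) ^ d \<ge> 1 / 2 ^ n * (1 / exp 1 :: real))"
\<comment> \<open>The value of \<open>\<alpha>\<close> for which \<open>width_condition\<close> holds.\<close>
proof (intro exI[of _ 16] allI impI, elim conjE)
  fix n d :: nat and K :: "(nat \<Rightarrow> real) set" and c :: real
  assume n: "n \<ge> 1" and d: "d \<ge> 1" and K: "convex_body (n + d) K" and c: "c > 0"
    and width: "lattice_width n K > 2 * c * real n * real (n + d) powr (5/2) * 16 * real n ^ (n + 1)"
  let ?F = "calF (n + d) (mixed_lattice n d) (mixed_measure n d K)"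
  have depth: "exp (- 1/c - 1) + exp (- 2/c) - 1 \<le> ?F"
  proof (cases "1 \<le> c")
    case True
    have "exp (- 2/c) \<le> (1::real)" using c by simp
    then show ?thesis using mixed_centerpoint[OF K n True width] by linarith
  next
    case False
    \<comment> \<open>Below \<open>c = 1\<close> the claimed bound is not positive, since both exponentials are at most \<open>1 / 2\<close>.\<close>
    have "exp (- 1/c - 1) \<le> (1 / 2 :: real)" "exp (- 2/c) \<le> (1 / 2 :: real)"
    proof -
      have half: "exp (- t) \<le> (1 / 2 :: real)" if "1 \<le> t" for t
      proof -
        have "2 \<le> exp t" using exp_ge_add_one_self[of t] that by linarith
        then show ?thesis by (simp add: exp_minus inverse_eq_divide divide_simps)
      qed
      have "1 \<le> 1 / c" using False c by simp
      moreover have "2 / c = 1 / c + 1 / c" by simp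
      ultimately have "1 \<le> 1 / c + 1" "1 \<le> 2 / c" by linarith+
      then show "exp (- 1/c - 1) \<le> (1 / 2 :: real)" "exp (- 2/c) \<le> (1 / 2 :: real)"
        using half[of "1 / c + 1"] half[of "2 / c"] by simp_all
    qed
    moreover have "0 \<le> ?F"
    proof (rule calF_lower_bound)
      show "finite_measure (mixed_measure n d K)"
        by (rule finite_measure_mixed_measure[OF convex_body_sets[OF K]])
      show "(\<lambda>i\<in>{..<n + d}. 0) \<in> mixed_lattice n d" by (simp add: mixed_lattice_def)
    qed (use n in auto)
    ultimately show ?thesis by linarith
  qed
  have half: "2 powr (- real n - 1) = 1 / 2 ^ n * (1 / 2 :: real)"
    by (simp add: powr_diff powr_minus powr_realpow inverse_eq_divide)
  have "1 / 2 ^ n * (real d / (real d + 1)) ^ d \<le> 1 / 2 ^ n * (1 / 2)"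
    "1 / 2 ^ n * (1 / exp 1) \<le> 1 / 2 ^ n * (real d / (real d + 1)) ^ d"
    by (intro mult_left_mono ratio_power_bounds[OF d], simp)+
  then show "exp (- 1/c - 1) + exp (- 2/c) - 1 \<le> ?F \<and>
      (exp (- 1/c - 1) + exp (- 2/c) - 1 \<ge> 2 powr (- real n - 1) \<longrightarrow>
        ?F \<ge> 1 / 2 ^ n * (1 / 2) \<and>
        1 / 2 ^ n * (1 / 2) \<ge> 1 / 2 ^ n * (real d / (real d + 1)) ^ d \<and>
        1 / 2 ^ n * (real d / (real d + 1)) ^ d \<ge> 1 / 2 ^ n * (1 / exp 1 :: real))"
    using depth unfolding half by linarith
qed

end
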